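(* For any $\epsilon>0$, there is a polynomial time two-sided distribution-free adaptive algorithm for $\epsilon$-testing $s$-Term Monotone $r$-DNF that makes $\tilde O(rs^2/\epsilon)$ queries.
   Context: Boolean functions $f:\{0,1\}^n\to\{0,1\}$ are accessed through a membership-query oracle that returns $f(x)$ for a queried $x$. For a distribution $\mathcal D$ on $\{0,1\}^n$, $f$ is $\epsilon$-far from a class $C$ with respect to $\mathcal D$ if $\Pr_{x\sim\mathcal D}[f(x)\neq g(x)]\ge\epsilon$ for every $g\in C$. A two-sided distribution-free adaptive algorithm for $\epsilon$-testing $C$ is a randomized algorithm that, given $\epsilon$, membership-query access to an arbitrary $f$, and an oracle returning independent samples from an arbitrary unknown distribution $\mathcal D$ on $\{0,1\}^n$, chooses queries possibly adaptively and, for every $\mathcal D$, accepts with probability at least $2/3$ if $f\in C$ and rejects with probability at least $2/3$ if $f$ is $\epsilon$-far from every function in $C$ with respect to $\mathcal D$. Queries count membership queries and samples. $\tilde O(T)$ means $O(T\cdot\mathrm{poly}(\log T))$. $s$-Term Monotone $r$-DNF is the class of disjunctions of at most $s$ terms, each a conjunction of at most $r$ unnegated variables. *)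

theory Defs
  imports "HOL-Probability.Probability"
begin

section \<open>Monotone DNF formulas over the Boolean cube\<close>

definition cube :: "nat \<Rightarrow> bool list set" where
  "cube n = {x. length x = n}"

text \<open>
  A term is the set of its variable indices and a formula is a set of terms. The empty formula is
  the constant 0 and the empty term is the constant 1. Functions are only constrained on the cube;
  their values on lists of other lengths are irrelevant throughout.
\<close>

definition monotone_DNF :: "nat \<Rightarrow> nat \<Rightarrow> nat \<Rightarrow> (bool list \<Rightarrow> bool) set" where
  "monotone_DNF n s r =
     {g. \<exists>F. F \<subseteq> Pow {..<n} \<and> card F \<le> s \<and> (\<forall>T\<in>F. card T \<le> r) \<and>
          (\<forall>x\<in>cube n. g x \<longleftrightarrow> (\<exists>T\<in>F. \<forall>i\<in>T. x ! i))}"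

definition far_from ::
    "bool list pmf \<Rightarrow> real \<Rightarrow> (bool list \<Rightarrow> bool) \<Rightarrow> (bool list \<Rightarrow> bool) set \<Rightarrow> bool" where
  "far_from D \<epsilon> f C \<longleftrightarrow> (\<forall>g\<in>C. measure_pmf.prob D {x. f x \<noteq> g x} \<ge> \<epsilon>)"


section \<open>Randomized oracle machines\<close>

text \<open>
  Programs run on a random access machine with uniform cost, addition and truncated subtraction as
  its only arithmetic, fair coins, and the two oracles. As there is no multiplication, numbers
  produced within \<open>t\<close> steps have \<open>O(t)\<close> bits more than the inputs, so polynomial time on this
  machine is polynomial time in the usual sense. The memory consists of infinite arrays of natural
  numbers; the array names occurring in a program are literals, whereas indices are computed. An
  expression has constant size once the program is fixed, so its evaluation is covered by the unit
  charged for the command containing it.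
\<close>

type_synonym memory = "nat \<Rightarrow> nat \<Rightarrow> nat"

datatype expr =
    Const nat
  | Get nat expr
  | Plus expr expr
  | Minus expr expr

primrec value_of :: "memory \<Rightarrow> expr \<Rightarrow> nat" where
  "value_of m (Const k) = k"
| "value_of m (Get a e) = m a (value_of m e)"
| "value_of m (Plus e1 e2) = value_of m e1 + value_of m e2"
| "value_of m (Minus e1 e2) = value_of m e1 - value_of m e2"

text \<open>
  \<open>Put a i e\<close> performs \<open>a[i] := e\<close>, and \<open>Flip a i\<close> stores a fair random bit in \<open>a[i]\<close>.
  \<open>Query a i b j\<close> stores in \<open>a[i]\<close> the value of the tested function at the point whose \<open>n\<close> bits
  are held in \<open>b[j], \<dots>, b[j + n - 1]\<close>. \<open>Sample b j\<close> draws a fresh point and stores its bits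
  there. Nonzero numbers count as true.
\<close>

datatype com =
    Skip
  | Put nat expr expr
  | Flip nat expr
  | Query nat expr nat expr
  | Sample nat expr
  | Seq com com
  | If expr com com
  | While expr com

record config =
  mem :: memory
  steps :: nat
  queries :: nat

definition tick :: "nat \<Rightarrow> config \<Rightarrow> config" where
  "tick t \<sigma> = \<sigma>\<lparr>steps := steps \<sigma> + t\<rparr>"

definition count_query :: "config \<Rightarrow> config" where
  "count_query \<sigma> = \<sigma>\<lparr>queries := queries \<sigma> + 1\<rparr>"

abbreviation val :: "config \<Rightarrow> expr \<Rightarrow> nat" where
  "val \<sigma> e \<equiv> value_of (mem \<sigma>) e"

definition set_cell :: "nat \<Rightarrow> nat \<Rightarrow> nat \<Rightarrow> config \<Rightarrow> config" where
  "set_cell a i v \<sigma> = \<sigma>\<lparr>mem := (mem \<sigma>)(a := (mem \<sigma> a)(i := v))\<rparr>"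

definition read_point :: "nat \<Rightarrow> nat \<Rightarrow> nat \<Rightarrow> config \<Rightarrow> bool list" where
  "read_point n b j \<sigma> = map (\<lambda>i. mem \<sigma> b (j + i) \<noteq> 0) [0..<n]"

definition write_point :: "nat \<Rightarrow> nat \<Rightarrow> bool list \<Rightarrow> config \<Rightarrow> config" where
  "write_point b j x \<sigma> = \<sigma>\<lparr>mem := (mem \<sigma>)(b :=
     (\<lambda>k. if j \<le> k \<and> k < j + length x then of_bool (x ! (k - j)) else mem \<sigma> b k))\<rparr>"

text \<open>
  \<open>exec n f D c \<sigma> P\<close>: started in \<open>\<sigma>\<close>, with membership queries answered by \<open>f\<close> and samples drawn
  from \<open>D\<close>, the program \<open>c\<close> halts on every path of positive probability, and \<open>P\<close> is the
  distribution of its final configuration. Each membership query and each sample counts as one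
  query, and is charged the time for transferring \<open>n\<close> bits.
\<close>

inductive exec ::
    "nat \<Rightarrow> (bool list \<Rightarrow> bool) \<Rightarrow> bool list pmf \<Rightarrow> com \<Rightarrow> config \<Rightarrow> config pmf \<Rightarrow> bool"
  for n :: nat and f :: "bool list \<Rightarrow> bool" and D :: "bool list pmf" where
  Skip: "exec n f D Skip \<sigma> (return_pmf (tick 1 \<sigma>))"
| Put: "exec n f D (Put a i e) \<sigma> (return_pmf (set_cell a (val \<sigma> i) (val \<sigma> e) (tick 1 \<sigma>)))"
| Flip: "exec n f D (Flip a i) \<sigma>
           (map_pmf (\<lambda>b. set_cell a (val \<sigma> i) (of_bool b) (tick 1 \<sigma>)) (bernoulli_pmf (1/2)))"
| Query: "exec n f D (Query a i b j) \<sigma>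
            (return_pmf (set_cell a (val \<sigma> i) (of_bool (f (read_point n b (val \<sigma> j) \<sigma>)))
              (count_query (tick (n + 1) \<sigma>))))"
| Sample: "exec n f D (Sample b j) \<sigma>
             (map_pmf (\<lambda>x. write_point b (val \<sigma> j) x (count_query (tick (n + 1) \<sigma>))) D)"
| Seq: "exec n f D c1 \<sigma> P \<Longrightarrow> (\<forall>\<sigma>'\<in>set_pmf P. exec n f D c2 \<sigma>' (Q \<sigma>')) \<Longrightarrow>
          exec n f D (Seq c1 c2) \<sigma> (bind_pmf P Q)"
| IfTrue: "val \<sigma> e \<noteq> 0 \<Longrightarrow> exec n f D c1 (tick 1 \<sigma>) P \<Longrightarrow> exec n f D (If e c1 c2) \<sigma> P"
| IfFalse: "val \<sigma> e = 0 \<Longrightarrow> exec n f D c2 (tick 1 \<sigma>) P \<Longrightarrow> exec n f D (If e c1 c2) \<sigma> P"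
| WhileFalse: "val \<sigma> e = 0 \<Longrightarrow> exec n f D (While e c) \<sigma> (return_pmf (tick 1 \<sigma>))"
| WhileTrue: "val \<sigma> e \<noteq> 0 \<Longrightarrow> exec n f D c (tick 1 \<sigma>) P \<Longrightarrow>
          (\<forall>\<sigma>'\<in>set_pmf P. exec n f D (While e c) \<sigma>' (Q \<sigma>')) \<Longrightarrow>
          exec n f D (While e c) \<sigma> (bind_pmf P Q)"

inductive_cases exec_SkipE: "exec n f D Skip \<sigma> P"
inductive_cases exec_PutE: "exec n f D (Put a i e) \<sigma> P"
inductive_cases exec_FlipE: "exec n f D (Flip a i) \<sigma> P"
inductive_cases exec_QueryE: "exec n f D (Query a i b j) \<sigma> P"
inductive_cases exec_SampleE: "exec n f D (Sample b j) \<sigma> P"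
inductive_cases exec_SeqE: "exec n f D (Seq c1 c2) \<sigma> P"
inductive_cases exec_IfE: "exec n f D (If e c1 c2) \<sigma> P"
inductive_cases exec_WhileE: "exec n f D (While e c) \<sigma> P"

lemma exec_deterministic:
  "exec n f D c \<sigma> P \<Longrightarrow> exec n f D c \<sigma> P' \<Longrightarrow> P = P'"
proof (induction arbitrary: P' rule: exec.induct)
  case (Seq c1 \<sigma> P c2 Q)
  from Seq.prems show ?case
  proof (rule exec_SeqE)
    fix P1 Q1
    assume P1: "exec n f D c1 \<sigma> P1"
      and Q1: "\<forall>\<sigma>'\<in>set_pmf P1. exec n f D c2 \<sigma>' (Q1 \<sigma>')"
      and P': "P' = bind_pmf P1 Q1"
    have "P = P1" using Seq.IH(1) P1 .
    moreover from this have "Q \<sigma>' = Q1 \<sigma>'" if "\<sigma>' \<in> set_pmf P1" for \<sigma>'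
      using Seq.IH(2) Q1 that by blast
    ultimately show ?case unfolding P' by (rule bind_pmf_cong)
  qed
next
  case (WhileTrue \<sigma> e c P Q)
  from WhileTrue.prems show ?case
  proof (rule exec_WhileE)
    fix P1 Q1
    assume P1: "exec n f D c (tick (Suc 0) \<sigma>) P1"
      and Q1: "\<forall>\<sigma>'\<in>set_pmf P1. exec n f D (While e c) \<sigma>' (Q1 \<sigma>')"
      and P': "P' = bind_pmf P1 Q1"
    have "P = P1" using WhileTrue.IH(1) P1 by simp
    moreover from this have "Q \<sigma>' = Q1 \<sigma>'" if "\<sigma>' \<in> set_pmf P1" for \<sigma>'
      using WhileTrue.IH(2) Q1 that by blast
    ultimately show ?case unfolding P' by (rule bind_pmf_cong)
  qed (use WhileTrue.hyps in simp)
next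
  case (WhileFalse \<sigma> e c)
  from WhileFalse.prems show ?case by (rule exec_WhileE) (use WhileFalse.hyps in simp_all)
next
  case (IfTrue \<sigma> e c1 P c2)
  from IfTrue.prems IfTrue.hyps have "exec n f D c1 (tick 1 \<sigma>) P'"
    by - (erule exec_IfE, simp_all)
  then show ?case by (rule IfTrue.IH)
next
  case (IfFalse \<sigma> e c2 P c1)
  from IfFalse.prems IfFalse.hyps have "exec n f D c2 (tick 1 \<sigma>) P'"
    by - (erule exec_IfE, simp_all)
  then show ?case by (rule IfFalse.IH)
qed (erule exec_SkipE exec_PutE exec_FlipE exec_QueryE exec_SampleE, simp)+

text \<open>
  Inputs are passed in the initial cells of array 0; the verdict is read off its cell 0. Inputs are
  natural numbers, so a real proximity parameter \<open>\<epsilon>\<close> is passed as \<open>\<lceil>1 / \<epsilon>\<rceil>\<close>, which is computable from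
  any rational \<open>\<epsilon>\<close>; the guarantees below refer to \<open>\<epsilon>\<close> itself.
\<close>

definition initial :: "nat list \<Rightarrow> config" where
  "initial inp = \<lparr>mem = (\<lambda>a i. if a = 0 \<and> i < length inp then inp ! i else 0),
                  steps = 0, queries = 0\<rparr>"

definition accepts :: "config \<Rightarrow> bool" where
  "accepts \<sigma> \<longleftrightarrow> mem \<sigma> 0 0 \<noteq> 0"


section \<open>Distribution-free testers\<close>

text \<open>
  \<open>c\<close> on input \<open>inp\<close> is a two-sided distribution-free (adaptive) \<open>\<epsilon>\<close>-tester for the class \<open>C\<close> of
  functions on the \<open>n\<close>-dimensional cube, which in all its runs makes at most \<open>q\<close> queries and at most
  \<open>t\<close> steps.
\<close>

definition distribution_free_tester ::
    "com \<Rightarrow> nat list \<Rightarrow> nat \<Rightarrow> (bool list \<Rightarrow> bool) set \<Rightarrow> real \<Rightarrow> real \<Rightarrow> real \<Rightarrow> bool" where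
  "distribution_free_tester c inp n C \<epsilon> q t \<longleftrightarrow>
     (\<forall>f D. set_pmf D \<subseteq> cube n \<longrightarrow>
       (\<exists>P. exec n f D c (initial inp) P \<and>
            (\<forall>\<sigma>\<in>set_pmf P. real (queries \<sigma>) \<le> q \<and> real (steps \<sigma>) \<le> t) \<and>
            (f \<in> C \<longrightarrow> measure_pmf.prob P {\<sigma>. accepts \<sigma>} \<ge> 2/3) \<and>
            (far_from D \<epsilon> f C \<longrightarrow> measure_pmf.prob P {\<sigma>. \<not> accepts \<sigma>} \<ge> 2/3)))"

text \<open>
  \<open>soft_O A q T\<close>: on the parameter set \<open>A\<close> one has \<open>q = O(T * poly (log T))\<close>, with a constant and a
  polynomial valid for all parameters at once. The shift inside the logarithm only matters for
  bounded \<open>T\<close>, where \<open>log T\<close> may vanish or be negative.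
\<close>

definition soft_O :: "'p set \<Rightarrow> ('p \<Rightarrow> real) \<Rightarrow> ('p \<Rightarrow> real) \<Rightarrow> bool" where
  "soft_O A q T \<longleftrightarrow> (\<exists>K k. \<forall>p\<in>A. q p \<le> K * (T p * log 2 (2 + T p) ^ k))"

end

theory Submission
  imports Defs
begin

text \<open>
  The tester learns the formula from samples. A hypothesis is a list of terms, each a set of literals.
  To keep the number of queries independent of \<open>n\<close>, literals are not variables but blocks of a random
  partition of the variables into polynomially many blocks (in \<open>r * s\<close>), which with probability \<open>3/4\<close>
  separates the at most \<open>r * s\<close> relevant variables. A literal is given by a witness \<open>w\<close> and a block
  \<open>b\<close>, and stands for the function \<open>g\<close> mapping \<open>y\<close> to the value of \<open>f\<close> at the point that agrees with
  \<open>y\<close> on \<open>b\<close> and with \<open>w\<close> elsewhere; if \<open>f\<close> belongs to the class and the blocks separate, \<open>g\<close> is a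
  single variable.

  With \<open>E = \<lceil>1 / \<epsilon>\<rceil>\<close>, each of \<open>108 * s * E\<close> rounds draws a sample \<open>x\<close> and evaluates every literal at \<open>x\<close> by
  self-correction, \<open>g u + g (u + x)\<close> for \<open>O(log (r * s))\<close> random \<open>u\<close>, rejecting if the values differ. It
  also checks on random points that \<open>g\<close> is additive and multiplicative, so that its self-correction is a
  single variable or 0. If the hypothesis is 1 and \<open>f x\<close> is 0, it rejects; in the opposite case it finds
  a minimal set of blocks of \<open>x\<close> keeping \<open>f\<close> true, by binary search, and adds it as a new term,
  rejecting after \<open>s\<close> terms or if more than \<open>r\<close> blocks are needed.

  If \<open>f\<close> is far from the class, then whatever the hypothesis, a round fails to confirm it with
  probability at least \<open>1 / (18 * E)\<close>: some literal is caught, or else the hypothesis is evaluated as a function of the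
  class. Hence \<open>2\<close> to the minus number of terms, set to 0 on rejection, decreases in expectation by a
  factor \<open>1 - 1 / (36 * E)\<close> per round, while acceptance requires it to be at least \<open>2\<close> to the minus \<open>s\<close>. The
  random bits of a round are drawn before they are used, so the rest of the round is a
  deterministic program.
\<close>


subsection \<open>A quantitative Hoare logic for oracle machines\<close>

text \<open>The obstacle is adaptivity: the hypothesis depends on earlier samples, and the rounds in
  which it grows are random. Every round is therefore analysed against an arbitrary fixed
  hypothesis, and the potential replaces a union bound over the rounds that add terms. Each round
  spends \<open>O(log (r * s))\<close> queries on each of at most \<open>r * s\<close> literals;
  times \<open>s * E\<close> rounds this is the claimed bound. Constants: a literal whose
  self-correction is not a variable or 0 passes its test with probability at most
  \<open>35/36 = 3/4 + 8/36\<close>. The rate \<open>1 / (18 * E)\<close> lies below both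
  \<open>1/36\<close> (as \<open>E >= 2\<close>) and \<open>1 / (2 * E)\<close>, the rate for a
  hypothesis that is corrected to a function of the class. A failed round only halves the potential,
  whence \<open>1 / (36 * E)\<close>, and \<open>108 * s * E\<close> rounds leave
  \<open>2^s * exp (-3 * s) <= 1/3\<close>. For members of the class the only source of error is a
  collision of labels; \<open>2^L >= 4 * (r * s)^2\<close> keeps it at \<open>1/4\<close>. For
  \<open>\<epsilon> >= 1\<close> the tester accepts without any query: no function is that far from
  both constants, and for large \<open>\<epsilon>\<close> the query bound drops below one.\<close>

lemma tick_simps [simp]:
  "mem (tick t \<sigma>) = mem \<sigma>" "steps (tick t \<sigma>) = steps \<sigma> + t" "queries (tick t \<sigma>) = queries \<sigma>"
  by (simp_all add: tick_def)

lemma count_query_simps [simp]: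
  "mem (count_query \<sigma>) = mem \<sigma>" "steps (count_query \<sigma>) = steps \<sigma>"
  "queries (count_query \<sigma>) = Suc (queries \<sigma>)"
  by (simp_all add: count_query_def)

lemma set_cell_simps [simp]:
  "mem (set_cell a i v \<sigma>) = (mem \<sigma>)(a := (mem \<sigma> a)(i := v))"
  "steps (set_cell a i v \<sigma>) = steps \<sigma>" "queries (set_cell a i v \<sigma>) = queries \<sigma>"
  by (simp_all add: set_cell_def)

definition write_row :: "nat \<Rightarrow> nat \<Rightarrow> bool list \<Rightarrow> memory \<Rightarrow> memory" where
  "write_row b j x m = m(b :=
     (\<lambda>k. if j \<le> k \<and> k < j + length x then of_bool (x ! (k - j)) else m b k))"

lemma write_point_simps [simp]:
  "mem (write_point b j x \<sigma>) = write_row b j x (mem \<sigma>)"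
  "steps (write_point b j x \<sigma>) = steps \<sigma>" "queries (write_point b j x \<sigma>) = queries \<sigma>"
  by (simp_all add: write_point_def write_row_def)

definition row :: "nat \<Rightarrow> memory \<Rightarrow> nat \<Rightarrow> nat \<Rightarrow> bool list" where
  "row n m b j = map (\<lambda>i. m b (j + i) \<noteq> 0) [0..<n]"

lemma length_row [simp]: "length (row n m b j) = n"
  by (simp add: row_def)

lemma nth_row [simp]: "i < n \<Longrightarrow> row n m b j ! i \<longleftrightarrow> m b (j + i) \<noteq> 0"
  by (simp add: row_def)

text \<open>
  A bound on the running time of a program each of whose loops makes at most \<open>B\<close> iterations.
\<close>

primrec cost :: "nat \<Rightarrow> com \<Rightarrow> nat" where
  "cost B Skip = 1"
| "cost B (Put a i e) = 1"
| "cost B (Flip a i) = 1"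
| "cost B (Query a i b j) = B + 1"
| "cost B (Sample b j) = B + 1"
| "cost B (Seq c1 c2) = cost B c1 + cost B c2"
| "cost B (If e c1 c2) = cost B c1 + cost B c2 + 1"
| "cost B (While e c) = B * (cost B c + 1) + 1"

text \<open>Induction on the program text: a loop multiplies the bound by \<open>B\<close>, and
  sequencing crudely adds the exponents, so the degree depends on the program alone.\<close>

lemma cost_polynomial: "\<exists>K d. \<forall>B\<ge>1. cost B c \<le> K * B ^ d"
proof (induction c)
  case (Query a i b j)
  show ?case by (rule exI[of _ 2], rule exI[of _ 1]) auto
next
  case (Sample b j)
  show ?case by (rule exI[of _ 2], rule exI[of _ 1]) auto
next
  case (Seq c1 c2)
  then obtain K1 d1 K2 d2 where
    1: "\<And>B. B \<ge> 1 \<Longrightarrow> cost B c1 \<le> K1 * B ^ d1" and 2: "\<And>B. B \<ge> 1 \<Longrightarrow> cost B c2 \<le> K2 * B ^ d2"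
    by blast
  show ?case
  proof (rule exI[of _ "K1 + K2"], rule exI[of _ "d1 + d2"], intro allI impI)
    fix B :: nat assume B: "B \<ge> 1"
    have "K1 * B ^ d1 \<le> K1 * B ^ (d1 + d2)" "K2 * B ^ d2 \<le> K2 * B ^ (d1 + d2)"
      using B by (auto intro!: mult_left_mono power_increasing)
    with 1[OF B] 2[OF B] show "cost B (Seq c1 c2) \<le> (K1 + K2) * B ^ (d1 + d2)"
      unfolding cost.simps distrib_right by linarith
  qed
next
  case (If e c1 c2)
  then obtain K1 d1 K2 d2 where
    1: "\<And>B. B \<ge> 1 \<Longrightarrow> cost B c1 \<le> K1 * B ^ d1" and 2: "\<And>B. B \<ge> 1 \<Longrightarrow> cost B c2 \<le> K2 * B ^ d2"
    by blast
  show ?case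
  proof (rule exI[of _ "K1 + K2 + 1"], rule exI[of _ "d1 + d2"], intro allI impI)
    fix B :: nat assume B: "B \<ge> 1"
    have "K1 * B ^ d1 \<le> K1 * B ^ (d1 + d2)" "K2 * B ^ d2 \<le> K2 * B ^ (d1 + d2)"
      using B by (auto intro!: mult_left_mono power_increasing)
    moreover have "1 \<le> B ^ (d1 + d2)" using B by simp
    ultimately show "cost B (If e c1 c2) \<le> (K1 + K2 + 1) * B ^ (d1 + d2)"
      using 1[OF B] 2[OF B] unfolding cost.simps distrib_right by linarith
  qed
next
  case (While e c)
  then obtain K d where 1: "\<And>B. B \<ge> 1 \<Longrightarrow> cost B c \<le> K * B ^ d" by blast
  show ?case
  proof (rule exI[of _ "K + 2"], rule exI[of _ "Suc d"], intro allI impI)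
    fix B :: nat assume B: "B \<ge> 1"
    have "B * cost B c \<le> B * (K * B ^ d)" by (rule mult_left_mono[OF 1[OF B]]) simp
    also have "\<dots> = K * B ^ Suc d" by simp
    finally have "B * cost B c \<le> K * B ^ Suc d" .
    moreover have "B ^ 1 \<le> B ^ Suc d" using B by (intro power_increasing) auto
    moreover have "1 \<le> B ^ Suc d" using B by (rule one_le_power)
    ultimately show "cost B (While e c) \<le> (K + 2) * B ^ Suc d"
      unfolding cost.simps distrib_right distrib_left power_one_right mult_1_right by linarith
  qed
qed (rule exI[of _ 1], rule exI[of _ 0], simp)+

text \<open>The guard is a truncated difference and vanishes once the counter reaches
  \<open>e\<close>. As \<open>e\<close> is evaluated anew in each iteration, the rules below ask
  that its value stay fixed.\<close>

definition For :: "nat \<Rightarrow> expr \<Rightarrow> com \<Rightarrow> com" where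
  "For a e c = Seq (Put a (Const 0) (Const 0))
     (While (Minus e (Get a (Const 0)))
       (Seq c (Put a (Const 0) (Plus (Get a (Const 0)) (Const 1)))))"

locale machine =
  fixes n :: nat and f :: "bool list \<Rightarrow> bool" and D :: "bool list pmf" and B :: nat
  assumes n_le: "n \<le> B"
begin

text \<open>A Hoare triple with resource bounds in which \<open>e\<close> dominates the pre-expectation of \<open>\<phi>\<close>.\<close>

definition pok ::
    "com \<Rightarrow> nat \<Rightarrow> memory \<Rightarrow> (memory \<Rightarrow> bool) \<Rightarrow> (memory \<Rightarrow> ennreal) \<Rightarrow> ennreal \<Rightarrow> bool" where
  "pok c q m Q \<phi> e \<longleftrightarrow> (\<forall>\<sigma>. mem \<sigma> = m \<longrightarrow> (\<exists>P. exec n f D c \<sigma> P \<and>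
     (\<forall>\<sigma>'\<in>set_pmf P. Q (mem \<sigma>') \<and> steps \<sigma>' \<le> steps \<sigma> + cost B c \<and> queries \<sigma>' \<le> queries \<sigma> + q) \<and>
     (\<integral>\<^sup>+\<sigma>'. \<phi> (mem \<sigma>') \<partial>P) \<le> e))"

text \<open>With target 0 the expectation bound is vacuous, and what remains is a postcondition on
  all paths together with the resource bounds.\<close>

definition ok :: "com \<Rightarrow> nat \<Rightarrow> memory \<Rightarrow> (memory \<Rightarrow> bool) \<Rightarrow> bool" where
  "ok c q m Q \<longleftrightarrow> pok c q m Q (\<lambda>_. 0) 0"

lemma pok_weaken:
  assumes "pok c q m Q \<phi> e" "q \<le> q'" "\<And>m'. Q m' \<Longrightarrow> Q' m'" "\<And>m'. Q m' \<Longrightarrow> \<phi>' m' \<le> \<phi> m'" "e \<le> e'"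
  shows "pok c q' m Q' \<phi>' e'"
  unfolding pok_def
proof (intro allI impI)
  fix \<sigma> :: config assume "mem \<sigma> = m"
  then obtain P where P: "exec n f D c \<sigma> P"
    "\<And>\<sigma>'. \<sigma>'\<in>set_pmf P \<Longrightarrow> Q (mem \<sigma>') \<and> steps \<sigma>' \<le> steps \<sigma> + cost B c \<and> queries \<sigma>' \<le> queries \<sigma> + q"
    "(\<integral>\<^sup>+\<sigma>'. \<phi> (mem \<sigma>') \<partial>P) \<le> e"
    using assms(1) unfolding pok_def by blast
  have "(\<integral>\<^sup>+\<sigma>'. \<phi>' (mem \<sigma>') \<partial>P) \<le> (\<integral>\<^sup>+\<sigma>'. \<phi> (mem \<sigma>') \<partial>P)"
    by (rule nn_integral_mono_AE) (use P(2) assms(4) in \<open>auto simp: AE_measure_pmf_iff\<close>)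
  also note P(3)
  also note assms(5)
  finally show "\<exists>P. exec n f D c \<sigma> P \<and>
     (\<forall>\<sigma>'\<in>set_pmf P. Q' (mem \<sigma>') \<and> steps \<sigma>' \<le> steps \<sigma> + cost B c \<and> queries \<sigma>' \<le> queries \<sigma> + q') \<and>
     (\<integral>\<^sup>+\<sigma>'. \<phi>' (mem \<sigma>') \<partial>P) \<le> e'"
    using P(1,2) assms(2,3) by (intro exI[of _ P]) fastforce
qed

lemma pok_conseq: "pok c q m Q \<phi> e \<Longrightarrow> (\<And>m'. Q m' \<Longrightarrow> Q' m') \<Longrightarrow> pok c q m Q' \<phi> e"
  by (erule pok_weaken) auto

lemma ok_weaken: "ok c q m Q \<Longrightarrow> q \<le> q' \<Longrightarrow> (\<And>m'. Q m' \<Longrightarrow> Q' m') \<Longrightarrow> ok c q' m Q'"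
  unfolding ok_def by (erule pok_weaken) auto

text \<open>A bound that holds pointwise under the postcondition bounds the expectation; this is how
  deterministic fragments enter the probabilistic analysis.\<close>

lemma pok_of_ok:
  assumes "ok c q m Q" "\<And>m'. Q m' \<Longrightarrow> \<phi> m' \<le> e"
  shows "pok c q m Q \<phi> e"
  unfolding pok_def
proof (intro allI impI)
  fix \<sigma> :: config assume "mem \<sigma> = m"
  then obtain P where P: "exec n f D c \<sigma> P"
    "\<And>\<sigma>'. \<sigma>'\<in>set_pmf P \<Longrightarrow> Q (mem \<sigma>') \<and> steps \<sigma>' \<le> steps \<sigma> + cost B c \<and> queries \<sigma>' \<le> queries \<sigma> + q"
    using assms(1) unfolding pok_def ok_def by blast
  have "(\<integral>\<^sup>+\<sigma>'. \<phi> (mem \<sigma>') \<partial>P) \<le> (\<integral>\<^sup>+\<sigma>'. e \<partial>P)"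
    by (rule nn_integral_mono_AE) (use P(2) assms(2) in \<open>auto simp: AE_measure_pmf_iff\<close>)
  then show "\<exists>P. exec n f D c \<sigma> P \<and>
     (\<forall>\<sigma>'\<in>set_pmf P. Q (mem \<sigma>') \<and> steps \<sigma>' \<le> steps \<sigma> + cost B c \<and> queries \<sigma>' \<le> queries \<sigma> + q) \<and>
     (\<integral>\<^sup>+\<sigma>'. \<phi> (mem \<sigma>') \<partial>P) \<le> e"
    using P by (intro exI[of _ P]) auto
qed

lemma pok_Skip: "Q m \<Longrightarrow> \<phi> m \<le> e \<Longrightarrow> pok Skip 0 m Q \<phi> e"
  unfolding pok_def by (intro allI impI exI conjI, rule exec.Skip) auto

lemma pok_Put:
  "Q (m(a := (m a)(value_of m i := value_of m e))) \<Longrightarrow>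
   \<phi> (m(a := (m a)(value_of m i := value_of m e))) \<le> u \<Longrightarrow> pok (Put a i e) 0 m Q \<phi> u"
  unfolding pok_def by (intro allI impI exI conjI, rule exec.Put) auto

lemma pok_Flip:
  assumes "\<And>b. Q (m(a := (m a)(value_of m i := of_bool b)))"
    and "(\<integral>\<^sup>+b. \<phi> (m(a := (m a)(value_of m i := of_bool b))) \<partial>(bernoulli_pmf (1/2))) \<le> u"
  shows "pok (Flip a i) 0 m Q \<phi> u"
  unfolding pok_def by (intro allI impI exI conjI, rule exec.Flip) (use assms in auto)

lemma pok_Sample:
  assumes "\<And>x. x \<in> set_pmf D \<Longrightarrow> Q (write_row b (value_of m j) x m)"
    and "(\<integral>\<^sup>+x. \<phi> (write_row b (value_of m j) x m) \<partial>D) \<le> u"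
  shows "pok (Sample b j) 1 m Q \<phi> u"
  unfolding pok_def by (intro allI impI exI conjI, rule exec.Sample) (use assms n_le in auto)

text \<open>Tower property: \<open>\<psi>\<close> bounds the pre-expectation of the second program
  at every intermediate memory.\<close>

lemma pok_Seq:
  assumes "pok c1 q1 m R \<psi> e" and "\<And>m'. R m' \<Longrightarrow> pok c2 q2 m' Q \<phi> (\<psi> m')"
  shows "pok (Seq c1 c2) (q1 + q2) m Q \<phi> e"
  unfolding pok_def
proof (intro allI impI)
  fix \<sigma> :: config assume "mem \<sigma> = m"
  then obtain P where P: "exec n f D c1 \<sigma> P"
    "\<And>\<sigma>'. \<sigma>'\<in>set_pmf P \<Longrightarrow> R (mem \<sigma>') \<and> steps \<sigma>' \<le> steps \<sigma> + cost B c1 \<and> queries \<sigma>' \<le> queries \<sigma> + q1"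
    "(\<integral>\<^sup>+\<sigma>'. \<psi> (mem \<sigma>') \<partial>P) \<le> e"
    using assms(1) unfolding pok_def by blast
  have "\<forall>\<sigma>'\<in>set_pmf P. \<exists>P'. exec n f D c2 \<sigma>' P' \<and>
     (\<forall>\<sigma>''\<in>set_pmf P'. Q (mem \<sigma>'') \<and> steps \<sigma>'' \<le> steps \<sigma>' + cost B c2 \<and> queries \<sigma>'' \<le> queries \<sigma>' + q2) \<and>
     (\<integral>\<^sup>+\<sigma>''. \<phi> (mem \<sigma>'') \<partial>P') \<le> \<psi> (mem \<sigma>')"
    using P(2) assms(2) unfolding pok_def by blast
  then obtain F where F: "\<And>\<sigma>'. \<sigma>'\<in>set_pmf P \<Longrightarrow> exec n f D c2 \<sigma>' (F \<sigma>') \<and>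
     (\<forall>\<sigma>''\<in>set_pmf (F \<sigma>'). Q (mem \<sigma>'') \<and> steps \<sigma>'' \<le> steps \<sigma>' + cost B c2 \<and> queries \<sigma>'' \<le> queries \<sigma>' + q2) \<and>
     (\<integral>\<^sup>+\<sigma>''. \<phi> (mem \<sigma>'') \<partial>(F \<sigma>')) \<le> \<psi> (mem \<sigma>')"
    by metis
  have "(\<integral>\<^sup>+\<sigma>''. \<phi> (mem \<sigma>'') \<partial>(bind_pmf P F)) =
      (\<integral>\<^sup>+\<sigma>'. (\<integral>\<^sup>+\<sigma>''. \<phi> (mem \<sigma>'') \<partial>(F \<sigma>')) \<partial>P)"
    by simp
  also have "\<dots> \<le> (\<integral>\<^sup>+\<sigma>'. \<psi> (mem \<sigma>') \<partial>P)"
    by (rule nn_integral_mono_AE) (use F in \<open>auto simp: AE_measure_pmf_iff\<close>)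
  also note P(3)
  finally have int: "(\<integral>\<^sup>+\<sigma>''. \<phi> (mem \<sigma>'') \<partial>(bind_pmf P F)) \<le> e" .
  have "exec n f D (Seq c1 c2) \<sigma> (bind_pmf P F)"
    by (rule exec.Seq) (use P F in blast)+
  moreover have "Q (mem \<sigma>'') \<and> steps \<sigma>'' \<le> steps \<sigma> + cost B (Seq c1 c2) \<and> queries \<sigma>'' \<le> queries \<sigma> + (q1 + q2)"
    if "\<sigma>'' \<in> set_pmf (bind_pmf P F)" for \<sigma>''
  proof -
    from that obtain \<sigma>' where "\<sigma>' \<in> set_pmf P" "\<sigma>'' \<in> set_pmf (F \<sigma>')" by auto
    with P(2)[of \<sigma>'] F[of \<sigma>'] show ?thesis by force
  qed
  ultimately show "\<exists>P. exec n f D (Seq c1 c2) \<sigma> P \<and>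
     (\<forall>\<sigma>'\<in>set_pmf P. Q (mem \<sigma>') \<and> steps \<sigma>' \<le> steps \<sigma> + cost B (Seq c1 c2) \<and> queries \<sigma>' \<le> queries \<sigma> + (q1 + q2)) \<and>
     (\<integral>\<^sup>+\<sigma>'. \<phi> (mem \<sigma>') \<partial>P) \<le> e"
    using int by blast
qed

lemma pok_If:
  assumes "value_of m b \<noteq> 0 \<Longrightarrow> pok c1 q m Q \<phi> e" "value_of m b = 0 \<Longrightarrow> pok c2 q m Q \<phi> e"
  shows "pok (If b c1 c2) q m Q \<phi> e"
  unfolding pok_def
proof (intro allI impI)
  fix \<sigma> :: config assume m: "mem \<sigma> = m"
  show "\<exists>P. exec n f D (If b c1 c2) \<sigma> P \<and>
     (\<forall>\<sigma>'\<in>set_pmf P. Q (mem \<sigma>') \<and> steps \<sigma>' \<le> steps \<sigma> + cost B (If b c1 c2) \<and> queries \<sigma>' \<le> queries \<sigma> + q) \<and>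
     (\<integral>\<^sup>+\<sigma>'. \<phi> (mem \<sigma>') \<partial>P) \<le> e"
  proof (cases "value_of m b = 0")
    case True
    have mt: "mem (tick 1 \<sigma>) = m" using m by simp
    from True assms(2) mt obtain P where P: "exec n f D c2 (tick 1 \<sigma>) P"
      "\<And>\<sigma>'. \<sigma>'\<in>set_pmf P \<Longrightarrow> Q (mem \<sigma>') \<and> steps \<sigma>' \<le> steps \<sigma> + 1 + cost B c2 \<and> queries \<sigma>' \<le> queries \<sigma> + q"
      "(\<integral>\<^sup>+\<sigma>'. \<phi> (mem \<sigma>') \<partial>P) \<le> e"
      unfolding pok_def by (metis tick_simps(2,3))
    have "exec n f D (If b c1 c2) \<sigma> P" by (rule exec.IfFalse) (use True m P in auto)
    with P show ?thesis by (intro exI[of _ P]) force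
  next
    case False
    have mt: "mem (tick 1 \<sigma>) = m" using m by simp
    from False assms(1) mt obtain P where P: "exec n f D c1 (tick 1 \<sigma>) P"
      "\<And>\<sigma>'. \<sigma>'\<in>set_pmf P \<Longrightarrow> Q (mem \<sigma>') \<and> steps \<sigma>' \<le> steps \<sigma> + 1 + cost B c1 \<and> queries \<sigma>' \<le> queries \<sigma> + q"
      "(\<integral>\<^sup>+\<sigma>'. \<phi> (mem \<sigma>') \<partial>P) \<le> e"
      unfolding pok_def by (metis tick_simps(2,3))
    have "exec n f D (If b c1 c2) \<sigma> P" by (rule exec.IfTrue) (use False m P in auto)
    with P show ?thesis by (intro exI[of _ P]) force
  qed
qed

text \<open>\<open>\<psi> i\<close> acts as a supermartingale: an iteration must not increase it on
  average. Invariant and \<open>\<psi>\<close> refer to the memory after the counter update, hence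
  the updated memory in the premise on the body.\<close>

lemma pok_For:
  assumes init: "I 0 (m(a := (m a)(0 := 0)))" and e0: "\<psi> 0 (m(a := (m a)(0 := 0))) \<le> u"
    and k: "k \<le> B" "\<And>i m'. I i m' \<Longrightarrow> m' a 0 = i \<Longrightarrow> value_of m' e = k"
    and body: "\<And>i m'. i < k \<Longrightarrow> I i m' \<Longrightarrow> m' a 0 = i \<Longrightarrow>
      pok c q m' (\<lambda>m''. m'' a 0 = i \<and> I (Suc i) (m''(a := (m'' a)(0 := Suc i))))
        (\<lambda>m''. \<psi> (Suc i) (m''(a := (m'' a)(0 := Suc i)))) (\<psi> i m')"
    and fin: "\<And>m'. I k m' \<Longrightarrow> m' a 0 = k \<Longrightarrow> Q m' \<and> \<phi> m' \<le> \<psi> k m'"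
  shows "pok (For a e c) (k * q) m Q \<phi> u"
proof -
  define c' where "c' = Seq c (Put a (Const 0) (Plus (Get a (Const 0)) (Const 1)))"
  have c': "pok c' q m' (\<lambda>m''. m'' a 0 = Suc i \<and> I (Suc i) m'') (\<psi> (Suc i)) (\<psi> i m')"
    if "i < k" "I i m'" "m' a 0 = i" for i m'
  proof -
    have "pok c' (q + 0) m' (\<lambda>m''. m'' a 0 = Suc i \<and> I (Suc i) m'') (\<psi> (Suc i)) (\<psi> i m')"
      unfolding c'_def by (rule pok_Seq[OF body[OF that]], rule pok_Put) auto
    then show ?thesis by simp
  qed
  \<comment> \<open>Induction on the number \<open>j\<close> of iterations left, with a step bound
    that is exact in \<open>j\<close>.\<close>
  have loop: "\<exists>P. exec n f D (While (Minus e (Get a (Const 0))) c') \<sigma> P \<and>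
      (\<forall>\<sigma>'\<in>set_pmf P. Q (mem \<sigma>') \<and> steps \<sigma>' \<le> steps \<sigma> + (j * (cost B c' + 1) + 1) \<and>
         queries \<sigma>' \<le> queries \<sigma> + j * q) \<and>
      (\<integral>\<^sup>+\<sigma>'. \<phi> (mem \<sigma>') \<partial>P) \<le> \<psi> i (mem \<sigma>)"
    if "I i (mem \<sigma>)" "mem \<sigma> a 0 = i" "i + j = k" for i j \<sigma>
    using that
  proof (induction j arbitrary: i \<sigma>)
    case 0
    then have "exec n f D (While (Minus e (Get a (Const 0))) c') \<sigma> (return_pmf (tick 1 \<sigma>))"
      using k(2)[of i "mem \<sigma>"] by (intro exec.WhileFalse) auto
    then show ?case using 0 fin[of "mem \<sigma>"] by (intro exI[of _ "return_pmf (tick 1 \<sigma>)"]) auto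
  next
    case (Suc j)
    let ?W = "While (Minus e (Get a (Const 0))) c'"
    have "i < k" "mem (tick 1 \<sigma>) = mem \<sigma>" using Suc.prems by auto
    with c'[OF \<open>i < k\<close> Suc.prems(1,2)] obtain P where P: "exec n f D c' (tick 1 \<sigma>) P"
      "\<And>\<sigma>'. \<sigma>'\<in>set_pmf P \<Longrightarrow> (mem \<sigma>' a 0 = Suc i \<and> I (Suc i) (mem \<sigma>')) \<and>
         steps \<sigma>' \<le> steps \<sigma> + 1 + cost B c' \<and> queries \<sigma>' \<le> queries \<sigma> + q"
      "(\<integral>\<^sup>+\<sigma>'. \<psi> (Suc i) (mem \<sigma>') \<partial>P) \<le> \<psi> i (mem \<sigma>)"
      unfolding pok_def by (metis tick_simps(2,3))
    have "\<forall>\<sigma>'\<in>set_pmf P. \<exists>P'. exec n f D ?W \<sigma>' P' \<and>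
      (\<forall>\<sigma>''\<in>set_pmf P'. Q (mem \<sigma>'') \<and> steps \<sigma>'' \<le> steps \<sigma>' + (j * (cost B c' + 1) + 1) \<and>
         queries \<sigma>'' \<le> queries \<sigma>' + j * q) \<and>
      (\<integral>\<^sup>+\<sigma>''. \<phi> (mem \<sigma>'') \<partial>P') \<le> \<psi> (Suc i) (mem \<sigma>')"
      using P(2) Suc.IH Suc.prems(3) by force
    then obtain F where F: "\<And>\<sigma>'. \<sigma>'\<in>set_pmf P \<Longrightarrow> exec n f D ?W \<sigma>' (F \<sigma>') \<and>
      (\<forall>\<sigma>''\<in>set_pmf (F \<sigma>'). Q (mem \<sigma>'') \<and> steps \<sigma>'' \<le> steps \<sigma>' + (j * (cost B c' + 1) + 1) \<and>
         queries \<sigma>'' \<le> queries \<sigma>' + j * q) \<and>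
      (\<integral>\<^sup>+\<sigma>''. \<phi> (mem \<sigma>'') \<partial>(F \<sigma>')) \<le> \<psi> (Suc i) (mem \<sigma>')"
      by metis
    have "(\<integral>\<^sup>+\<sigma>''. \<phi> (mem \<sigma>'') \<partial>(bind_pmf P F)) =
        (\<integral>\<^sup>+\<sigma>'. (\<integral>\<^sup>+\<sigma>''. \<phi> (mem \<sigma>'') \<partial>(F \<sigma>')) \<partial>P)"
      by simp
    also have "\<dots> \<le> (\<integral>\<^sup>+\<sigma>'. \<psi> (Suc i) (mem \<sigma>') \<partial>P)"
      by (rule nn_integral_mono_AE) (use F in \<open>auto simp: AE_measure_pmf_iff\<close>)
    also note P(3)
    finally have int: "(\<integral>\<^sup>+\<sigma>''. \<phi> (mem \<sigma>'') \<partial>(bind_pmf P F)) \<le> \<psi> i (mem \<sigma>)" .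
    have "exec n f D ?W \<sigma> (bind_pmf P F)"
    proof (rule exec.WhileTrue)
      show "val \<sigma> (Minus e (Get a (Const 0))) \<noteq> 0"
        using Suc.prems \<open>i < k\<close> k(2)[of i "mem \<sigma>"] by simp
    qed (use P F in auto)
    moreover have "Q (mem \<sigma>'') \<and> steps \<sigma>'' \<le> steps \<sigma> + (Suc j * (cost B c' + 1) + 1) \<and>
        queries \<sigma>'' \<le> queries \<sigma> + Suc j * q" if "\<sigma>'' \<in> set_pmf (bind_pmf P F)" for \<sigma>''
    proof -
      from that obtain \<sigma>' where s: "\<sigma>' \<in> set_pmf P" "\<sigma>'' \<in> set_pmf (F \<sigma>')" by auto
      have "steps \<sigma>' \<le> steps \<sigma> + 1 + cost B c'" "queries \<sigma>' \<le> queries \<sigma> + q"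
        using P(2)[OF s(1)] by auto
      moreover have "Q (mem \<sigma>'')" "steps \<sigma>'' \<le> steps \<sigma>' + (j * (cost B c' + 1) + 1)"
        "queries \<sigma>'' \<le> queries \<sigma>' + j * q" using F[OF s(1)] s(2) by auto
      ultimately show ?thesis by simp
    qed
    ultimately show ?case using int by blast
  qed
  show ?thesis unfolding pok_def
  proof (intro allI impI)
    fix \<sigma> :: config assume m: "mem \<sigma> = m"
    define \<sigma>1 where "\<sigma>1 = set_cell a 0 0 (tick 1 \<sigma>)"
    have s1: "mem \<sigma>1 = m(a := (m a)(0 := 0))" "steps \<sigma>1 = steps \<sigma> + 1" "queries \<sigma>1 = queries \<sigma>"
      by (simp_all add: \<sigma>1_def m)
    have "I 0 (mem \<sigma>1)" "mem \<sigma>1 a 0 = 0" unfolding s1 using init by auto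
    from loop[OF this, of k] obtain P where
      P: "exec n f D (While (Minus e (Get a (Const 0))) c') \<sigma>1 P"
      "\<And>\<sigma>'. \<sigma>'\<in>set_pmf P \<Longrightarrow> Q (mem \<sigma>') \<and> steps \<sigma>' \<le> steps \<sigma>1 + (k * (cost B c' + 1) + 1) \<and>
         queries \<sigma>' \<le> queries \<sigma>1 + k * q"
      "(\<integral>\<^sup>+\<sigma>'. \<phi> (mem \<sigma>') \<partial>P) \<le> \<psi> 0 (mem \<sigma>1)" by auto
    have "exec n f D (Put a (Const 0) (Const 0)) \<sigma> (return_pmf \<sigma>1)"
      using exec.Put[of n f D a "Const 0" "Const 0" \<sigma>] by (simp add: \<sigma>1_def)
    from exec.Seq[OF this, of "While (Minus e (Get a (Const 0))) c'" "\<lambda>_. P"] P(1)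
    have ex: "exec n f D (For a e c) \<sigma> P" by (simp add: For_def c'_def bind_return_pmf)
    \<comment> \<open>Only here is the exact number of iterations relaxed to \<open>B\<close>, the
      form that \<open>cost\<close> has.\<close>
    have "k * (cost B c' + 1) \<le> B * (cost B c' + 1)" using k(1) by (rule mult_right_mono) simp
    then have "steps \<sigma> + 1 + (k * (cost B c' + 1) + 1) \<le> steps \<sigma> + cost B (For a e c)"
      by (simp add: For_def c'_def)
    then have "\<forall>\<sigma>'\<in>set_pmf P. Q (mem \<sigma>') \<and> steps \<sigma>' \<le> steps \<sigma> + cost B (For a e c) \<and>
         queries \<sigma>' \<le> queries \<sigma> + k * q"
      using P(2) unfolding s1 by fastforce
    moreover have "(\<integral>\<^sup>+\<sigma>'. \<phi> (mem \<sigma>') \<partial>P) \<le> u"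
      using P(3) e0 unfolding s1 by (rule order_trans)
    ultimately show "\<exists>P. exec n f D (For a e c) \<sigma> P \<and>
     (\<forall>\<sigma>'\<in>set_pmf P. Q (mem \<sigma>') \<and> steps \<sigma>' \<le> steps \<sigma> + cost B (For a e c) \<and> queries \<sigma>' \<le> queries \<sigma> + k * q) \<and>
     (\<integral>\<^sup>+\<sigma>'. \<phi> (mem \<sigma>') \<partial>P) \<le> u"
      using ex by blast
  qed
qed

lemma ok_Skip: "Q m \<Longrightarrow> ok Skip 0 m Q"
  unfolding ok_def by (rule pok_Skip) auto

lemma ok_Put: "Q (m(a := (m a)(value_of m i := value_of m e))) \<Longrightarrow> ok (Put a i e) 0 m Q"
  unfolding ok_def by (rule pok_Put) auto

lemma ok_Query:
  "Q (m(a := (m a)(value_of m i := of_bool (f (row n m b (value_of m j)))))) \<Longrightarrow>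
   ok (Query a i b j) 1 m Q"
  unfolding ok_def pok_def
  by (intro allI impI exI conjI, rule exec.Query) (use n_le in \<open>auto simp: row_def read_point_def\<close>)

lemma ok_Seq:
  "ok c1 q1 m R \<Longrightarrow> (\<And>m'. R m' \<Longrightarrow> ok c2 q2 m' Q) \<Longrightarrow> ok (Seq c1 c2) (q1 + q2) m Q"
  unfolding ok_def by (rule pok_Seq)

lemma ok_If:
  "(value_of m b \<noteq> 0 \<Longrightarrow> ok c1 q m Q) \<Longrightarrow> (value_of m b = 0 \<Longrightarrow> ok c2 q m Q) \<Longrightarrow>
   ok (If b c1 c2) q m Q"
  unfolding ok_def by (rule pok_If)

lemma ok_For:
  assumes "I 0 (m(a := (m a)(0 := 0)))"
    and "k \<le> B" "\<And>i m'. I i m' \<Longrightarrow> m' a 0 = i \<Longrightarrow> value_of m' e = k"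
    and "\<And>i m'. i < k \<Longrightarrow> I i m' \<Longrightarrow> m' a 0 = i \<Longrightarrow>
      ok c q m' (\<lambda>m''. m'' a 0 = i \<and> I (Suc i) (m''(a := (m'' a)(0 := Suc i))))"
    and "\<And>m'. I k m' \<Longrightarrow> m' a 0 = k \<Longrightarrow> Q m'"
  shows "ok (For a e c) (k * q) m Q"
  unfolding ok_def
  by (rule pok_For[where I = I and \<psi> = "\<lambda>_ _. 0"]) (use assms in \<open>auto simp: ok_def\<close>)

end


subsection \<open>Random bits and union bounds\<close>

definition vxor :: "bool list \<Rightarrow> bool list \<Rightarrow> bool list" where
  "vxor x y = map2 (\<noteq>) x y"

definition vand :: "bool list \<Rightarrow> bool list \<Rightarrow> bool list" where
  "vand x y = map2 (\<and>) x y"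

abbreviation bits :: "nat \<Rightarrow> bool list pmf" where
  "bits k \<equiv> replicate_pmf k (bernoulli_pmf (1/2))"

abbreviation prob :: "'a pmf \<Rightarrow> 'a set \<Rightarrow> real" where
  "prob \<equiv> measure_pmf.prob"

lemma length_vxor [simp]: "length (vxor x y) = min (length x) (length y)"
  by (simp add: vxor_def)

lemma length_vand [simp]: "length (vand x y) = min (length x) (length y)"
  by (simp add: vand_def)

lemma nth_vxor [simp]: "i < length x \<Longrightarrow> i < length y \<Longrightarrow> vxor x y ! i \<longleftrightarrow> x ! i \<noteq> y ! i"
  by (simp add: vxor_def)

lemma nth_vand [simp]: "i < length x \<Longrightarrow> i < length y \<Longrightarrow> vand x y ! i \<longleftrightarrow> x ! i \<and> y ! i"
  by (simp add: vand_def)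

lemma cube_vxor [simp]: "x \<in> cube n \<Longrightarrow> y \<in> cube n \<Longrightarrow> vxor x y \<in> cube n"
  by (simp add: cube_def)

lemma cube_vand [simp]: "x \<in> cube n \<Longrightarrow> y \<in> cube n \<Longrightarrow> vand x y \<in> cube n"
  by (simp add: cube_def)

lemma cube_eqI: "x \<in> cube n \<Longrightarrow> y \<in> cube n \<Longrightarrow> (\<And>i. i < n \<Longrightarrow> x ! i = y ! i) \<Longrightarrow> x = y"
  by (auto simp: cube_def intro: nth_equalityI)

lemma set_bits [simp]: "set_pmf (bits k) = cube k"
  by (auto simp: set_replicate_pmf cube_def in_lists_conv_set set_pmf_bernoulli)

text \<open>Coordinate by coordinate: negating a fair bit leaves it fair. This translation
  invariance makes \<open>u\<close> and \<open>u + x\<close> both uniform in the linearity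
  test.\<close>

lemma map_pmf_vxor_bits:
  assumes "a \<in> cube k"
  shows "map_pmf (vxor a) (bits k) = bits k"
  using assms
proof (induction k arbitrary: a)
  case 0
  then show ?case by (simp add: cube_def vxor_def)
next
  case (Suc k)
  then obtain b a' where a: "a = b # a'" "a' \<in> cube k" by (auto simp: cube_def length_Suc_conv)
  have b: "map_pmf ((\<noteq>) b) (bernoulli_pmf (1/2)) = bernoulli_pmf (1/2)"
  proof (rule pmf_eqI)
    fix i
    have "pmf (map_pmf ((\<noteq>) b) (bernoulli_pmf (1/2))) ((\<noteq>) b (b \<noteq> i)) = pmf (bernoulli_pmf (1/2)) (b \<noteq> i)"
      by (rule pmf_map_inj') (auto simp: inj_def)
    then show "pmf (map_pmf ((\<noteq>) b) (bernoulli_pmf (1/2))) i = pmf (bernoulli_pmf (1/2)) i"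
      by (cases b; cases i) auto
  qed
  have "map_pmf (vxor a) (bits (Suc k)) =
      bind_pmf (map_pmf ((\<noteq>) b) (bernoulli_pmf (1/2))) (\<lambda>x. bind_pmf (map_pmf (vxor a') (bits k)) (\<lambda>xs. return_pmf (x # xs)))"
    by (simp add: a(1) map_bind_pmf bind_map_pmf vxor_def)
  also have "\<dots> = bits (Suc k)" unfolding b Suc.IH[OF a(2)] by simp
  finally show ?case .
qed

lemma prob_vxor_bits:
  assumes "a \<in> cube k"
  shows "prob (bits k) {u. P (vxor a u)} = prob (bits k) {u. P u}"
proof -
  have "prob (bits k) {u. P u} = prob (map_pmf (vxor a) (bits k)) {u. P u}"
    by (simp only: map_pmf_vxor_bits[OF assms])
  then show ?thesis by (simp add: vimage_def)
qed

lemma map_pmf_pair_vxor_bits: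
  assumes "a \<in> cube k" "b \<in> cube k"
  shows "map_pmf (\<lambda>(y, z). (vxor a y, vxor b z)) (pair_pmf (bits k) (bits k)) = pair_pmf (bits k) (bits k)"
  by (simp only: map_pair map_pmf_vxor_bits[OF assms(1)] map_pmf_vxor_bits[OF assms(2)])

lemma prob_le_add:
  assumes "\<And>x. x \<in> set_pmf p \<Longrightarrow> P x \<Longrightarrow> Q x \<or> R x"
  shows "prob p {x. P x} \<le> prob p {x. Q x} + prob p {x. R x}"
proof -
  have "prob p {x. P x} \<le> prob p ({x. Q x} \<union> {x. R x})"
    by (rule measure_pmf.finite_measure_mono_AE) (use assms in \<open>auto simp: AE_measure_pmf_iff\<close>)
  also have "\<dots> \<le> prob p {x. Q x} + prob p {x. R x}"
    by (rule measure_Un_le) auto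
  finally show ?thesis .
qed

lemma prob_mono:
  assumes "\<And>x. x \<in> set_pmf p \<Longrightarrow> P x \<Longrightarrow> Q x"
  shows "prob p {x. P x} \<le> prob p {x. Q x}"
  by (rule measure_pmf.finite_measure_mono_AE) (use assms in \<open>auto simp: AE_measure_pmf_iff\<close>)

lemma prob_not: "prob p {x. \<not> P x} = 1 - prob p {x. P x}"
  proof -
  have "{x. \<not> P x} = space (measure_pmf p) - {x. P x}" by auto
  then show ?thesis by (simp only: measure_pmf.prob_compl sets_measure_pmf UNIV_I)
qed

lemma prob_pair_fst: "prob (pair_pmf p q) {x. P (fst x)} = prob p {x. P x}"
proof -
  have "prob (map_pmf fst (pair_pmf p q)) {x. P x} = prob (pair_pmf p q) {x. P (fst x)}"
    by (simp add: vimage_def)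
  then show ?thesis by (simp add: map_fst_pair_pmf)
qed

lemma prob_pair_snd: "prob (pair_pmf p q) {x. P (snd x)} = prob q {x. P x}"
proof -
  have "prob (map_pmf snd (pair_pmf p q)) {x. P x} = prob (pair_pmf p q) {x. P (snd x)}"
    by (simp add: vimage_def)
  then show ?thesis by (simp add: map_snd_pair_pmf)
qed

lemma prob_pair_integral:
  "prob (pair_pmf p q) {(x, y). P x y} =
   measure_pmf.expectation p (\<lambda>x. prob q {y. P x y})"
proof -
  have "emeasure (measure_pmf (pair_pmf p q)) {(x, y). P x y} =
      (\<integral>\<^sup>+x. \<integral>\<^sup>+y. indicator {(x, y). P x y} (x, y) \<partial>q \<partial>p)"
    by (subst nn_integral_indicator[symmetric], simp, subst nn_integral_pair_pmf') simp
  also have "\<dots> = (\<integral>\<^sup>+x. emeasure (measure_pmf q) {y. P x y} \<partial>p)"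
  proof (rule nn_integral_cong)
    fix x
    have "(\<lambda>y. indicator {(x, y). P x y} (x, y) :: ennreal) = indicator {y. P x y}"
      by (auto simp: indicator_def)
    then show "(\<integral>\<^sup>+y. indicator {(x, y). P x y} (x, y) \<partial>q) = emeasure (measure_pmf q) {y. P x y}"
      by simp
  qed
  also have "\<dots> = ennreal (measure_pmf.expectation p (\<lambda>x. prob q {y. P x y}))"
    unfolding measure_pmf.emeasure_eq_measure
    by (rule nn_integral_eq_integral) (auto intro!: measure_pmf.integrable_const_bound[where B = 1])
  finally show ?thesis
    by (simp add: measure_pmf.emeasure_eq_measure integral_nonneg_AE)
qed

lemma prob_pair_le:
  assumes "\<And>x. x \<in> set_pmf p \<Longrightarrow> prob q {y. P x y} \<le> c"
  shows "prob (pair_pmf p q) {(x, y). P x y} \<le> c"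
proof -
  have "measure_pmf.expectation p (\<lambda>x. prob q {y. P x y}) \<le> measure_pmf.expectation p (\<lambda>_. c)"
    by (rule integral_mono_AE)
       (use assms in \<open>auto simp: AE_measure_pmf_iff intro!: measure_pmf.integrable_const_bound[where B = 1]\<close>)
  then show ?thesis by (simp add: prob_pair_integral)
qed

lemma prob_pair_ge:
  assumes "\<And>x. x \<in> set_pmf p \<Longrightarrow> Q x \<Longrightarrow> prob q {y. P x y} \<ge> c" "c \<ge> 0"
  shows "prob (pair_pmf p q) {(x, y). P x y} \<ge> prob p {x. Q x} * c"
proof -
  have "prob p {x. Q x} * c = measure_pmf.expectation p (\<lambda>x. indicator {x. Q x} x * c)"
    by simp
  also have "\<dots> \<le> measure_pmf.expectation p (\<lambda>x. prob q {y. P x y})"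
  proof (rule integral_mono_AE)
    show "integrable (measure_pmf p) (\<lambda>x. indicator {x. Q x} x * c)"
      using assms(2) by (intro measure_pmf.integrable_const_bound[where B = c]) (auto simp: indicator_def)
    show "integrable (measure_pmf p) (\<lambda>x. prob q {y. P x y})"
      by (intro measure_pmf.integrable_const_bound[where B = 1]) auto
    show "AE x in measure_pmf p. indicator {x. Q x} x * c \<le> prob q {y. P x y}"
      using assms by (auto simp: AE_measure_pmf_iff indicator_def)
  qed
  finally show ?thesis by (simp add: prob_pair_integral)
qed

lemma prob_exI:
  assumes "prob p {x. P x} < 1"
  obtains x where "x \<in> set_pmf p" "\<not> P x"
proof -
  have "\<not> (\<forall>x\<in>set_pmf p. P x)"
  proof
    assume "\<forall>x\<in>set_pmf p. P x"
    then have "prob p {x. P x} = 1"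
      by (subst measure_pmf.prob_eq_1) (auto simp: AE_measure_pmf_iff)
    with assms show False by simp
  qed
  then show ?thesis using that by blast
qed


subsection \<open>The linearity and dictator test\<close>

lemma vxor_commute: "x \<in> cube n \<Longrightarrow> y \<in> cube n \<Longrightarrow> vxor x y = vxor y x"
  by (rule cube_eqI[of _ n]) (auto simp: cube_def)

lemma vxor_assoc:
  "x \<in> cube n \<Longrightarrow> y \<in> cube n \<Longrightarrow> z \<in> cube n \<Longrightarrow> vxor (vxor x y) z = vxor x (vxor y z)"
  by (rule cube_eqI[of _ n]) (auto simp: cube_def)

lemma vand_commute: "x \<in> cube n \<Longrightarrow> y \<in> cube n \<Longrightarrow> vand x y = vand y x"
  by (rule cube_eqI[of _ n]) (auto simp: cube_def)

lemma vand_vxor_left: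
  "x \<in> cube n \<Longrightarrow> y \<in> cube n \<Longrightarrow> z \<in> cube n \<Longrightarrow>
   vand (vxor x y) z = vxor (vand x z) (vand y z)"
  by (rule cube_eqI[of _ n]) (auto simp: cube_def)

lemma prob_cong:
  assumes "\<And>x. x \<in> set_pmf p \<Longrightarrow> P x \<longleftrightarrow> Q x"
  shows "prob p {x. P x} = prob p {x. Q x}"
  by (rule antisym; rule prob_mono) (use assms in auto)

lemma prob_map_pmf: "prob (map_pmf h p) {x. P x} = prob p {x. P (h x)}"
  by (simp add: vimage_def)

text \<open>\<open>majority n g x\<close> is the value of \<open>g\<close> at \<open>x\<close> after self-correction.\<close>

definition majority :: "nat \<Rightarrow> (bool list \<Rightarrow> bool) \<Rightarrow> bool list \<Rightarrow> bool" where
  "majority n g x \<longleftrightarrow> prob (bits n) {u. g u \<noteq> g (vxor u x)} \<ge> 1/2"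

definition linear_defect :: "nat \<Rightarrow> (bool list \<Rightarrow> bool) \<Rightarrow> real" where
  "linear_defect n g = prob (pair_pmf (bits n) (bits n))
     {(y, z). (g y \<noteq> g z) \<noteq> g (vxor y z)}"

definition additive_on_cube :: "nat \<Rightarrow> (bool list \<Rightarrow> bool) \<Rightarrow> bool" where
  "additive_on_cube n G \<longleftrightarrow> (\<forall>x\<in>cube n. \<forall>y\<in>cube n. G (vxor x y) \<longleftrightarrow> G x \<noteq> G y)"

text \<open>Two random voters disagree with probability \<open>2 * p * (1 - p)\<close>, where
  \<open>p\<close> is the share of votes for 1. A disagreement violates additivity at
  \<open>(u, v)\<close> or at \<open>(u + x, v + x)\<close>, so this is at most twice the defect,
  and it dominates the share of the minority.\<close>

lemma majority_error:
  assumes x: "x \<in> cube n"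
  shows "prob (bits n) {u. (g u \<noteq> g (vxor u x)) \<noteq> majority n g x} \<le> 2 * linear_defect n g"
proof -
  let ?U = "bits n"
  define A where "A = (\<lambda>u. g u \<noteq> g (vxor u x))"
  define p where "p = prob ?U {u. A u}"
  have p01: "0 \<le> p" "p \<le> 1" by (auto simp: p_def)
  have "prob (pair_pmf ?U ?U) {(u, v). A u \<noteq> A v} =
      measure_pmf.expectation ?U (\<lambda>u. prob ?U {v. A u \<noteq> A v})"
    by (rule prob_pair_integral)
  also have "\<dots> = measure_pmf.expectation ?U (\<lambda>u. indicator {u. A u} u * (1 - p) + indicator {u. \<not> A u} u * p)"
  proof (intro Bochner_Integration.integral_cong refl)
    fix u
    show "prob ?U {v. A u \<noteq> A v} = indicator {u. A u} u * (1 - p) + indicator {u. \<not> A u} u * p"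
      by (cases "A u") (simp_all add: p_def prob_not)
  qed
  also have "\<dots> = p * (1 - p) + (1 - p) * p"
    by (subst Bochner_Integration.integral_add)
       (auto simp: p_def prob_not measure_pmf.emeasure_eq_measure intro!: integrable_mult_left integrable_real_indicator)
  finally have eq: "prob (pair_pmf ?U ?U) {(u, v). A u \<noteq> A v} = 2 * p * (1 - p)" by simp
  \<comment> \<open>Translating both points by \<open>x\<close> preserves their sum, so the
    translated triple has the same defect.\<close>
  have shift: "prob (pair_pmf ?U ?U)
      {(u, v). (g (vxor u x) \<noteq> g (vxor v x)) \<noteq> g (vxor u v)} = linear_defect n g"
  proof -
    have "linear_defect n g = prob
        (map_pmf (\<lambda>(y, z). (vxor x y, vxor x z)) (pair_pmf ?U ?U)) {(y, z). (g y \<noteq> g z) \<noteq> g (vxor y z)}"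
      by (simp only: map_pmf_pair_vxor_bits[OF x x] linear_defect_def)
    also have "\<dots> = prob (pair_pmf ?U ?U)
        {(u, v). (g (vxor u x) \<noteq> g (vxor v x)) \<noteq> g (vxor u v)}"
      unfolding prob_map_pmf
    proof (rule prob_cong)
      fix w assume "w \<in> set_pmf (pair_pmf ?U ?U)"
      then obtain u v where w: "w = (u, v)" "u \<in> cube n" "v \<in> cube n" by auto
      have "vxor (vxor x u) (vxor x v) = vxor u v"
        using w x by (intro cube_eqI[of _ n]) (auto simp: cube_def)
      then show "(case (case w of (y, z) \<Rightarrow> (vxor x y, vxor x z)) of
          (y, z) \<Rightarrow> (g y \<noteq> g z) \<noteq> g (vxor y z)) \<longleftrightarrow>
        (case w of (u, v) \<Rightarrow> (g (vxor u x) \<noteq> g (vxor v x)) \<noteq> g (vxor u v))"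
        using w x by (simp add: vxor_commute[OF x])
    qed
    finally show ?thesis ..
  qed
  have "prob (pair_pmf ?U ?U) {w. case w of (u, v) \<Rightarrow> A u \<noteq> A v} \<le>
    prob (pair_pmf ?U ?U) {w. case w of (u, v) \<Rightarrow> (g u \<noteq> g v) \<noteq> g (vxor u v)} +
    prob (pair_pmf ?U ?U) {w. case w of (u, v) \<Rightarrow> (g (vxor u x) \<noteq> g (vxor v x)) \<noteq> g (vxor u v)}"
    by (rule prob_le_add) (auto simp: A_def)
  then have ineq: "2 * p * (1 - p) \<le> 2 * linear_defect n g"
    using eq shift by (simp add: linear_defect_def)
  \<comment> \<open>Whichever of \<open>p\<close> and \<open>1 - p\<close> is the minority is at
    most \<open>2 * p * (1 - p)\<close>, because the other factor is at least
    \<open>1/2\<close>.\<close>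
  show ?thesis
  proof (cases "p \<ge> 1/2")
    case True
    then have "majority n g x" by (simp add: majority_def p_def A_def)
    then have "prob ?U {u. (g u \<noteq> g (vxor u x)) \<noteq> majority n g x} = 1 - p"
      using prob_not[of ?U A] by (simp add: p_def A_def)
    moreover have "1 * (1 - p) \<le> 2 * p * (1 - p)" using True p01 by (intro mult_right_mono) auto
    ultimately show ?thesis using ineq by simp
  next
    case False
    then have "\<not> majority n g x" by (simp add: majority_def p_def A_def)
    then have "prob ?U {u. (g u \<noteq> g (vxor u x)) \<noteq> majority n g x} = p"
      by (simp add: p_def A_def)
    moreover have "p \<le> 2 * p * (1 - p)"
      using False p01 mult_left_mono[of 1 "2 * (1 - p)" p] by (simp add: algebra_simps)
    ultimately show ?thesis using ineq by linarith
  qed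
qed

text \<open>Three votes are compared: for \<open>x\<close> at \<open>v\<close>, for \<open>y\<close>
  at \<open>x + v\<close>, and for \<open>x + y\<close> at \<open>v\<close>. Each errs with
  probability below \<open>1/3\<close>, so some \<open>v\<close> makes all three correct, and there
  the votes telescope.\<close>

lemma additive_majority:
  assumes "linear_defect n g < 1/6"
  shows "additive_on_cube n (majority n g)"
  unfolding additive_on_cube_def
proof (intro ballI)
  fix x y assume x: "x \<in> cube n" and y: "y \<in> cube n"
  let ?U = "bits n"
  let ?E = "\<lambda>v w. (g v \<noteq> g (vxor v w)) \<noteq> majority n g w"
  have 1: "prob ?U {v. ?E v x} \<le> 2 * linear_defect n g" by (rule majority_error[OF x])
  have 3: "prob ?U {v. ?E v (vxor x y)} \<le> 2 * linear_defect n g"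
    by (rule majority_error) (use x y in simp)
  have "prob ?U {v. ?E (vxor x v) y} = prob ?U {v. ?E v y}"
    by (rule prob_vxor_bits[OF x])
  with majority_error[OF y] have 2: "prob ?U {v. ?E (vxor x v) y} \<le> 2 * linear_defect n g"
    by simp
  have "prob ?U {v. (?E v x \<or> ?E (vxor x v) y) \<or> ?E v (vxor x y)} \<le>
      prob ?U {v. ?E v x \<or> ?E (vxor x v) y} + prob ?U {v. ?E v (vxor x y)}"
    by (rule prob_le_add) auto
  also have "prob ?U {v. ?E v x \<or> ?E (vxor x v) y} \<le>
      prob ?U {v. ?E v x} + prob ?U {v. ?E (vxor x v) y}"
    by (rule prob_le_add) auto
  finally have "prob ?U {v. (?E v x \<or> ?E (vxor x v) y) \<or> ?E v (vxor x y)} < 1"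
    using 1 2 3 assms by linarith
  then obtain v where v: "v \<in> cube n"
    and nv: "\<not> ((?E v x \<or> ?E (vxor x v) y) \<or> ?E v (vxor x y))"
    by (rule prob_exI) auto
  have "vxor (vxor x v) y = vxor v (vxor x y)" "vxor x v = vxor v x"
    using x y v by (simp_all add: vxor_commute[OF x v] vxor_assoc)
  with nv show "majority n g (vxor x y) \<longleftrightarrow> majority n g x \<noteq> majority n g y" by auto
qed

text \<open>For random \<open>u\<close>, a wrong \<open>g y\<close> means that additivity fails at
  \<open>(u, y)\<close>, costing one defect, or that the vote of \<open>u\<close> for
  \<open>y\<close> is wrong, costing two.\<close>

lemma majority_distance:
  "prob (bits n) {y. g y \<noteq> majority n g y} \<le> 3 * linear_defect n g"
proof -
  let ?U = "bits n"
  let ?bad = "\<lambda>w. case w of (u, y) \<Rightarrow> (g u \<noteq> g y) \<noteq> g (vxor u y)"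
  let ?err = "\<lambda>w. case w of (y, u) \<Rightarrow> (g u \<noteq> g (vxor u y)) \<noteq> majority n g y"
  have sw: "prob (pair_pmf ?U ?U) {w. ?bad (snd w, fst w)} = linear_defect n g"
  proof -
    have "prob (map_pmf (\<lambda>(x, y). (y, x)) (pair_pmf ?U ?U)) {w. ?bad w} =
        prob (pair_pmf ?U ?U) {w. ?bad (snd w, fst w)}"
      by (simp add: vimage_def case_prod_beta)
    then show ?thesis by (simp add: linear_defect_def flip: pair_commute_pmf)
  qed
  have "prob ?U {y. g y \<noteq> majority n g y} =
      prob (pair_pmf ?U ?U) {w. g (fst w) \<noteq> majority n g (fst w)}"
    by (rule prob_pair_fst[symmetric])
  also have "\<dots> \<le> prob (pair_pmf ?U ?U) {w. ?bad (snd w, fst w)} +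
      prob (pair_pmf ?U ?U) {w. ?err w}"
    by (rule prob_le_add) (auto split: prod.splits)
  also have "prob (pair_pmf ?U ?U) {w. ?err w} \<le> 2 * linear_defect n g"
  proof (rule prob_pair_le)
    fix y assume "y \<in> set_pmf ?U"
    then have "y \<in> cube n" by simp
    then show "prob ?U {u. (g u \<noteq> g (vxor u y)) \<noteq> majority n g y} \<le> 2 * linear_defect n g"
      by (rule majority_error)
  qed
  finally show ?thesis using sw by simp
qed

text \<open>
  For additive \<open>G\<close> the form \<open>B y z = G (y \<and> z) + G y * G z\<close> is bilinear over the two-element
  field, so it vanishes identically or is nonzero with probability at least \<open>1/4\<close>.
\<close>

lemma additive_half:
  assumes "additive_on_cube n G" "y0 \<in> cube n" "G y0"
  shows "prob (bits n) {y. G y} \<ge> 1/2"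
proof -
  have "prob (bits n) {y. G (vxor y0 y)} = prob (bits n) {y. G y}"
    by (rule prob_vxor_bits) fact
  \<comment> \<open>Adding \<open>y0\<close> flips the value of \<open>G\<close>, so the zeros are
    carried into the ones.\<close>
  moreover have "prob (bits n) {y. \<not> G y} \<le> prob (bits n) {y. G (vxor y0 y)}"
    by (rule prob_mono) (use assms in \<open>auto simp: additive_on_cube_def\<close>)
  ultimately show ?thesis using prob_not[of "bits n" G] by simp
qed

lemma multiplicative_or_quarter:
  assumes G: "additive_on_cube n G"
  shows "(\<forall>y\<in>cube n. \<forall>z\<in>cube n. G (vand y z) \<longleftrightarrow> G y \<and> G z) \<or>
    prob (pair_pmf (bits n) (bits n)) {(y, z). G (vand y z) \<noteq> (G y \<and> G z)} \<ge> 1/4"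
proof (rule disjCI)
  let ?B = "\<lambda>y z. G (vand y z) \<noteq> (G y \<and> G z)"
  assume "\<not> prob (pair_pmf (bits n) (bits n)) {(y, z). ?B y z} \<ge> 1/4"
  then have lt: "prob (pair_pmf (bits n) (bits n)) {(y, z). ?B y z} < 1/4" by simp
  have addl: "additive_on_cube n (\<lambda>y. ?B y z)" if "z \<in> cube n" for z
    using G that unfolding additive_on_cube_def by (auto simp: vand_vxor_left)
  have addr: "additive_on_cube n (\<lambda>z. ?B y z)" if "y \<in> cube n" for y
    unfolding additive_on_cube_def
  proof (intro ballI)
    fix a b assume ab: "a \<in> cube n" "b \<in> cube n"
    have sym: "?B y c \<longleftrightarrow> ?B c y" if "c \<in> cube n" for c
      using vand_commute[OF \<open>y \<in> cube n\<close> that] by auto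
    have "?B (vxor a b) y \<longleftrightarrow> ?B a y \<noteq> ?B b y"
      using addl[OF that] ab unfolding additive_on_cube_def by blast
    then show "?B y (vxor a b) \<longleftrightarrow> ?B y a \<noteq> ?B y b"
      unfolding sym[OF ab(1)] sym[OF ab(2)] sym[OF cube_vxor[OF ab]] .
  qed
  show "\<forall>y\<in>cube n. \<forall>z\<in>cube n. G (vand y z) \<longleftrightarrow> G y \<and> G z"
  proof (rule ccontr)
    assume "\<not> ?thesis"
    then obtain y0 z0 where yz: "y0 \<in> cube n" "z0 \<in> cube n" "?B y0 z0" by blast
    \<comment> \<open>At least half of all \<open>y\<close> have a nonzero row in the form, as
      witnessed by \<open>z0\<close>, and at least half of each such row is nonzero.\<close>
    have "prob (bits n) {y. \<exists>z\<in>cube n. ?B y z} * (1/2) \<le>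
        prob (pair_pmf (bits n) (bits n)) {(y, z). ?B y z}"
    proof (rule prob_pair_ge)
      fix y assume y: "y \<in> set_pmf (bits n)" "\<exists>z\<in>cube n. ?B y z"
      then obtain z where "z \<in> cube n" "?B y z" by blast
      with y(1) show "1/2 \<le> prob (bits n) {z. ?B y z}"
        by (intro additive_half[OF addr]) auto
    qed simp
    moreover have "1/2 \<le> prob (bits n) {y. ?B y z0}"
      by (rule additive_half[OF addl[OF yz(2)] yz(1)]) fact
    moreover have "prob (bits n) {y. ?B y z0} \<le> prob (bits n) {y. \<exists>z\<in>cube n. ?B y z}"
      by (rule prob_mono) (use yz in auto)
    ultimately show False using lt by linarith
  qed
qed

lemma additive_zero:
  assumes "additive_on_cube n G"
  shows "\<not> G (replicate n False)"
proof -
  have z: "replicate n False \<in> cube n" by (simp add: cube_def)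
  have "vxor (replicate n False) (replicate n False) = replicate n False"
    by (rule cube_eqI[of _ n]) (use z in \<open>auto simp: cube_def\<close>)
  then show ?thesis using assms z unfolding additive_on_cube_def by force
qed

text \<open>Induction on the Hamming weight: if the unit vector of a coordinate set in
  \<open>x\<close> is mapped to 0, removing it from \<open>x\<close> keeps the value 1 and lowers
  the weight.\<close>

lemma additive_nonzero_unit:
  assumes G: "additive_on_cube n G" and x: "x \<in> cube n" "G x"
  shows "\<exists>i<n. G (map (\<lambda>j. j = i) [0..<n])"
  using x
proof (induction "card {i. i < n \<and> x ! i}" arbitrary: x rule: less_induct)
  case less
  have c0: "\<not> G (replicate n False)" by (rule additive_zero[OF G])
  have "\<exists>i<n. x ! i"
  proof (rule ccontr)
    assume "\<not> ?thesis"
    then have "x = replicate n False" using less.prems(1) by (intro cube_eqI[of _ n]) (auto simp: cube_def)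
    with less.prems c0 show False by simp
  qed
  then obtain i where i: "i < n" "x ! i" by blast
  define e where "e = map (\<lambda>j. j = i) [0..<n]"
  have e: "e \<in> cube n" by (simp add: e_def cube_def)
  show ?case
  proof (cases "G e")
    case True then show ?thesis using i by (auto simp: e_def)
  next
    case False
    have "G (vxor x e)" using G less.prems e False unfolding additive_on_cube_def by blast
    moreover have "{k. k < n \<and> vxor x e ! k} = {k. k < n \<and> x ! k} - {i}"
      using less.prems(1) i by (auto simp: cube_def e_def)
    then have "card {k. k < n \<and> vxor x e ! k} < card {k. k < n \<and> x ! k}"
      using i card_Diff1_less[of "{k. k < n \<and> x ! k}" i] by simp
    ultimately show ?thesis using less.hyps[of "vxor x e"] less.prems e by simp
  qed
qed

text \<open>With a unit vector \<open>e\<close> of value 1, multiplicativity gives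
  \<open>G x = G (x and e)\<close>, and \<open>x and e\<close> is either \<open>e\<close> or 0,
  depending on one coordinate of \<open>x\<close>.\<close>

lemma additive_multiplicative_dictator:
  assumes G: "additive_on_cube n G"
    and m: "\<forall>y\<in>cube n. \<forall>z\<in>cube n. G (vand y z) \<longleftrightarrow> G y \<and> G z"
  shows "(\<forall>x\<in>cube n. \<not> G x) \<or> (\<exists>\<tau><n. \<forall>x\<in>cube n. G x \<longleftrightarrow> x ! \<tau>)"
proof (rule disjCI)
  assume no: "\<not> (\<exists>\<tau><n. \<forall>x\<in>cube n. G x \<longleftrightarrow> x ! \<tau>)"
  show "\<forall>x\<in>cube n. \<not> G x"
  proof (rule ccontr)
    assume "\<not> ?thesis"
    then obtain \<tau> where \<tau>: "\<tau> < n" "G (map (\<lambda>j. j = \<tau>) [0..<n])"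
      using additive_nonzero_unit[OF G] by blast
    define e where "e = map (\<lambda>j. j = \<tau>) [0..<n]"
    have e: "e \<in> cube n" "G e" using \<tau> by (simp_all add: e_def cube_def)
    have c0: "\<not> G (replicate n False)" by (rule additive_zero[OF G])
    have "G x \<longleftrightarrow> x ! \<tau>" if x: "x \<in> cube n" for x
    proof -
      have "vand x e = (if x ! \<tau> then e else replicate n False)"
        using x \<tau> by (intro cube_eqI[of _ n]) (auto simp: e_def cube_def)
      moreover have "G x \<longleftrightarrow> G (vand x e)" using m x e by blast
      ultimately show ?thesis using e c0 by auto
    qed
    with no \<tau> show False by blast
  qed
qed

text \<open>The product is compared with a self-corrected value at \<open>y and z\<close>: that
  point is not uniform, so \<open>g\<close> itself could be wrong there although it is close to its
  correction.\<close>

definition literal_test :: "(bool list \<Rightarrow> bool) \<Rightarrow> bool list \<Rightarrow> bool list \<Rightarrow> bool list \<Rightarrow> bool" where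
  "literal_test g y z u \<longleftrightarrow> ((g y \<noteq> g z) = g (vxor y z)) \<and>
     ((g y \<and> g z) = (g u \<noteq> g (vxor u (vand y z))))"

text \<open>The constant 0 also survives the test; as a literal it makes its term vanish.\<close>

lemma literal_test_sound:
  assumes "prob (pair_pmf (pair_pmf (bits n) (bits n)) (bits n))
      {w. literal_test g (fst (fst w)) (snd (fst w)) (snd w)} > 35/36"
  shows "\<exists>d. ((\<forall>x\<in>cube n. \<not> d x) \<or> (\<exists>\<tau><n. \<forall>x\<in>cube n. d x \<longleftrightarrow> x ! \<tau>)) \<and>
    (\<forall>x\<in>cube n. prob (bits n) {u. (g u \<noteq> g (vxor u x)) \<noteq> d x} \<le> 1/2)"
proof -
  let ?U = "bits n"
  let ?P2 = "pair_pmf ?U ?U"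
  let ?P = "pair_pmf ?P2 ?U"
  let ?G = "majority n g"
  let ?pass = "\<lambda>w. literal_test g (fst (fst w)) (snd (fst w)) (snd w)"
  have "prob ?P {w. ?pass w} \<le> prob ?P {w. (\<lambda>(y, z). (g y \<noteq> g z) = g (vxor y z)) (fst w)}"
    by (rule prob_mono) (auto simp: literal_test_def)
  also have "\<dots> = prob ?P2 {w. \<not> (case w of (y, z) \<Rightarrow> (g y \<noteq> g z) \<noteq> g (vxor y z))}"
    unfolding prob_pair_fst by (rule prob_cong) auto
  also have "\<dots> = 1 - linear_defect n g"
    unfolding linear_defect_def by (rule prob_not)
  finally have defect: "linear_defect n g < 1/36" using assms by linarith
  have add: "additive_on_cube n ?G" by (rule additive_majority) (use defect in simp)
  have mult: "\<forall>y\<in>cube n. \<forall>z\<in>cube n. ?G (vand y z) \<longleftrightarrow> ?G y \<and> ?G z"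
  proof (rule ccontr)
    let ?B = "\<lambda>w. case w of (y, z) \<Rightarrow> ?G (vand y z) \<noteq> (?G y \<and> ?G z)"
    let ?err = "\<lambda>y. g y \<noteq> ?G y"
    let ?ev = "\<lambda>w. case w of (yz, u) \<Rightarrow> case yz of (y, z) \<Rightarrow>
      (g u \<noteq> g (vxor u (vand y z))) \<noteq> ?G (vand y z)"
    assume "\<not> ?thesis"
    then have quarter: "prob ?P2 {w. ?B w} \<ge> 1/4"
      using multiplicative_or_quarter[OF add] by blast
    \<comment> \<open>If the correction is not multiplicative at \<open>(y, z)\<close>, passing
      requires that \<open>g\<close> differ from it at \<open>y\<close> or at \<open>z\<close>, or
      that the vote for \<open>y and z\<close> be wrong. These events cost 3, 3 and 2
      defects.\<close>
    have "prob ?P {w. ?pass w} \<le> prob ?P {w. \<not> ?B (fst w)} +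
        prob ?P {w. (?err (fst (fst w)) \<or> ?err (snd (fst w))) \<or> ?ev w}"
      by (rule prob_le_add) (auto simp: literal_test_def)
    also have "prob ?P {w. (?err (fst (fst w)) \<or> ?err (snd (fst w))) \<or> ?ev w} \<le>
        prob ?P {w. ?err (fst (fst w)) \<or> ?err (snd (fst w))} + prob ?P {w. ?ev w}"
      by (rule prob_le_add) auto
    also have "prob ?P {w. ?err (fst (fst w)) \<or> ?err (snd (fst w))} \<le>
        prob ?P {w. ?err (fst (fst w))} + prob ?P {w. ?err (snd (fst w))}"
      by (rule prob_le_add) auto
    also have "prob ?P {w. ?err (fst (fst w))} \<le> 3 * linear_defect n g"
      using prob_pair_fst[of ?P2 ?U "\<lambda>w. ?err (fst w)"] prob_pair_fst[of ?U ?U ?err]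
        majority_distance[of n g] by simp
    also have "prob ?P {w. ?err (snd (fst w))} \<le> 3 * linear_defect n g"
      using prob_pair_fst[of ?P2 ?U "\<lambda>w. ?err (snd w)"] prob_pair_snd[of ?U ?U ?err]
        majority_distance[of n g] by simp
    also have "prob ?P {w. ?ev w} \<le> 2 * linear_defect n g"
    proof (rule prob_pair_le)
      fix w assume "w \<in> set_pmf ?P2"
      then obtain y z where w: "w = (y, z)" "vand y z \<in> cube n" by auto
      show "prob ?U {u. case w of (y, z) \<Rightarrow>
          (g u \<noteq> g (vxor u (vand y z))) \<noteq> ?G (vand y z)} \<le> 2 * linear_defect n g"
        unfolding w(1) prod.case by (rule majority_error[OF w(2)])
    qed
    also have "prob ?P {w. \<not> ?B (fst w)} = 1 - prob ?P2 {w. ?B w}"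
      unfolding prob_pair_fst[of ?P2 ?U "\<lambda>w. \<not> ?B w"] by (rule prob_not)
    \<comment> \<open>The total is below \<open>3/4 + 8/36 = 35/36\<close>.\<close>
    finally show False using quarter defect assms by linarith
  qed
  show ?thesis
  proof (intro exI[of _ ?G] conjI ballI)
    show "(\<forall>x\<in>cube n. \<not> ?G x) \<or> (\<exists>\<tau><n. \<forall>x\<in>cube n. ?G x \<longleftrightarrow> x ! \<tau>)"
      by (rule additive_multiplicative_dictator[OF add mult])
    fix x assume "x \<in> cube n"
    from majority_error[OF this, of g] defect
    show "prob ?U {u. (g u \<noteq> g (vxor u x)) \<noteq> ?G x} \<le> 1/2" by linarith
  qed
qed

lemma literal_test_dictator:
  assumes "\<And>y. y \<in> cube n \<Longrightarrow> g y \<longleftrightarrow> y ! \<tau>" "\<tau> < n" "y \<in> cube n" "z \<in> cube n" "u \<in> cube n"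
  shows "literal_test g y z u"
  using assms by (auto simp: literal_test_def cube_def)


subsection \<open>One round against a distant function\<close>

text \<open>A literal consists of the index of its term, a witness and the label of a block of variables.\<close>

type_synonym literal = "nat \<times> bool list \<times> nat"

definition blend :: "nat \<Rightarrow> (nat \<Rightarrow> nat) \<Rightarrow> bool list \<Rightarrow> nat \<Rightarrow> bool list \<Rightarrow> bool list" where
  "blend n lab w b y = map (\<lambda>v. if lab v = b then y ! v else w ! v) [0..<n]"

definition lit :: "nat \<Rightarrow> (bool list \<Rightarrow> bool) \<Rightarrow> (nat \<Rightarrow> nat) \<Rightarrow> literal \<Rightarrow> bool list \<Rightarrow> bool" where
  "lit n f lab l y = f (blend n lab (fst (snd l)) (snd (snd l)) y)"

text \<open>A mere disjunction of the votes; it is relied upon together with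
  \<open>consistent\<close>, under which all votes agree.\<close>

definition corrected :: "(bool list \<Rightarrow> bool) \<Rightarrow> bool list list \<Rightarrow> bool list \<Rightarrow> bool" where
  "corrected g us x \<longleftrightarrow> (\<exists>u\<in>set us. g u \<noteq> g (vxor u x))"

definition consistent :: "(bool list \<Rightarrow> bool) \<Rightarrow> bool list list \<Rightarrow> bool list \<Rightarrow> bool" where
  "consistent g us x \<longleftrightarrow> (\<forall>u\<in>set us. (g u \<noteq> g (vxor u x)) = corrected g us x)"

text \<open>Row 2 is both the third test point and the first vote. No probability estimate combines
  the two uses, so sharing the row is harmless.\<close>

definition lit_passes :: "(bool list \<Rightarrow> bool) \<Rightarrow> bool list list \<Rightarrow> bool list \<Rightarrow> bool" where
  "lit_passes g ys x \<longleftrightarrow> literal_test g (ys ! 0) (ys ! 1) (ys ! 2) \<and> consistent g (drop 2 ys) x"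

text \<open>A term index below \<open>nt\<close> that has no literals counts as true; this
  represents the constant 1.\<close>

definition hyp_value ::
    "(literal \<Rightarrow> bool list \<Rightarrow> bool) \<Rightarrow> nat \<Rightarrow> literal list \<Rightarrow> bool list list \<Rightarrow> bool list \<Rightarrow> bool" where
  "hyp_value g nt lits ys x \<longleftrightarrow> (\<exists>j<nt. \<forall>l\<in>set lits. fst l = j \<longrightarrow> corrected (g l) (drop 2 ys) x)"

lemma prob_Bex_le:
  assumes "\<And>l. l \<in> set ls \<Longrightarrow> prob p {x. P l x} \<le> c"
  shows "prob p {x. \<exists>l\<in>set ls. P l x} \<le> real (length ls) * c"
  using assms
proof (induction ls)
  case (Cons a ls)
  have "prob p {x. \<exists>l\<in>set (a # ls). P l x} \<le>
      prob p {x. P a x} + prob p {x. \<exists>l\<in>set ls. P l x}"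
    by (rule prob_le_add) auto
  also have "\<dots> \<le> c + real (length ls) * c"
    by (intro add_mono Cons.prems Cons.IH) auto
  finally show ?case by (simp add: algebra_simps)
qed simp

lemma replicate_pmf_Suc_pair:
  "replicate_pmf (Suc k) p = map_pmf (\<lambda>(x, xs). x # xs) (pair_pmf p (replicate_pmf k p))"
  by (simp add: pair_pmf_def map_bind_pmf)

lemma prob_replicate_all_le:
  assumes "prob p {u. P u} \<le> c"
  shows "prob (replicate_pmf k p) {us. \<forall>u\<in>set us. P u} \<le> c ^ k"
proof (induction k)
  case (Suc k)
  have c: "c \<ge> 0" using assms measure_nonneg order_trans by blast
  have "prob (replicate_pmf (Suc k) p) {us. \<forall>u\<in>set us. P u} =
      prob (pair_pmf p (replicate_pmf k p)) {(x, xs). P x \<and> (\<forall>u\<in>set xs. P u)}"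
    unfolding replicate_pmf_Suc_pair prob_map_pmf by (rule prob_cong) auto
  also have "\<dots> = measure_pmf.expectation p
      (\<lambda>x. indicator {u. P u} x * prob (replicate_pmf k p) {xs. \<forall>u\<in>set xs. P u})"
    unfolding prob_pair_integral by (intro Bochner_Integration.integral_cong) (auto simp: indicator_def)
  also have "\<dots> = prob p {u. P u} * prob (replicate_pmf k p) {xs. \<forall>u\<in>set xs. P u}"
    by simp
  also have "\<dots> \<le> c * c ^ k"
    by (intro mult_mono assms Suc.IH c) auto
  finally show ?case by simp
qed simp

lemma map_pmf_replicate_three:
  "map_pmf (\<lambda>ys. ((ys ! 0, ys ! 1), ys ! 2)) (replicate_pmf (Suc (Suc (Suc k))) p) =
   pair_pmf (pair_pmf p p) p"
  by (simp add: pair_pmf_def map_bind_pmf bind_assoc_pmf bind_return_pmf numeral_2_eq_2 bind_pmf_const)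

lemma map_pmf_replicate_drop_two:
  "map_pmf (drop 2) (replicate_pmf (k + 2) p) = replicate_pmf k p"
  by (simp add: map_bind_pmf bind_pmf_const numeral_2_eq_2 bind_assoc_pmf bind_return_pmf bind_return_pmf')

text \<open>If some literal fails its test with probability at least \<open>1/36\<close>, the round
  notices with that probability. Otherwise every literal has a correction \<open>d l\<close> that is
  a variable or 0, and replacing literals by corrections gives a function \<open>h\<close> of the
  class. The sample hits a disagreement of \<open>f\<close> and \<open>h\<close> with probability at
  least \<open>1 / E\<close>, and then the round is fooled only if some literal is read wrongly
  without dissent, which has probability at most \<open>1/2\<close>.\<close>

lemma round_sound:
  fixes E :: nat
  assumes far: "far_from D \<epsilon> f (monotone_DNF n s r)" and D: "set_pmf D \<subseteq> cube n"
    and nt: "nt \<le> s" and r: "\<And>j. length (filter (\<lambda>l. fst l = j) lits) \<le> r"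
    and len: "length lits \<le> r * s" and L: "2 * (r * s) \<le> 2 ^ L" "L \<ge> 1"
    and E: "1 / E \<le> \<epsilon>" "E \<ge> 2"
  shows "prob (pair_pmf D (replicate_pmf (L + 2) (bits n)))
    {(x, ys). (\<forall>l\<in>set lits. lit_passes (lit n f lab l) ys x) \<and>
       hyp_value (lit n f lab) nt lits ys x = f x} \<le> 1 - 1 / (18 * real E)"
proof -
  let ?U = "bits n"
  let ?R = "replicate_pmf (L + 2) ?U"
  let ?g = "lit n f lab"
  let ?good = "\<lambda>w. case w of (x, ys) \<Rightarrow> (\<forall>l\<in>set lits. lit_passes (?g l) ys x) \<and>
       hyp_value ?g nt lits ys x = f x"
  \<comment> \<open>This comparison, tight at \<open>E = 2\<close>, determines the constant
    18.\<close>
  have E36: "1 / (18 * real E) \<le> 1/36" using E(2) by (simp add: field_simps)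
  show ?thesis
  proof (cases "\<exists>l\<in>set lits. prob (pair_pmf (pair_pmf ?U ?U) ?U)
      {w. literal_test (?g l) (fst (fst w)) (snd (fst w)) (snd w)} \<le> 35/36")
    case True
    then obtain l where l: "l \<in> set lits" "prob (pair_pmf (pair_pmf ?U ?U) ?U)
      {w. literal_test (?g l) (fst (fst w)) (snd (fst w)) (snd w)} \<le> 35/36" by blast
    obtain k where k: "L = Suc k" using L(2) by (cases L) auto
    have "prob (pair_pmf D ?R) {w. ?good w} \<le>
        prob (pair_pmf D ?R) {w. literal_test (?g l) (snd w ! 0) (snd w ! 1) (snd w ! 2)}"
      by (rule prob_mono) (use l(1) in \<open>auto simp: lit_passes_def\<close>)
    also have "\<dots> = prob ?R {ys. literal_test (?g l) (ys ! 0) (ys ! 1) (ys ! 2)}"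
      by (rule prob_pair_snd)
    also have "\<dots> = prob (map_pmf (\<lambda>ys. ((ys ! 0, ys ! 1), ys ! 2)) ?R)
        {w. literal_test (?g l) (fst (fst w)) (snd (fst w)) (snd w)}"
      unfolding prob_map_pmf by simp
    also have "map_pmf (\<lambda>ys. ((ys ! 0, ys ! 1), ys ! 2)) ?R = pair_pmf (pair_pmf ?U ?U) ?U"
      using map_pmf_replicate_three[of k ?U] k by simp
    finally show ?thesis using l(2) E36 by linarith
  next
    case False
    have "\<forall>l\<in>set lits. \<exists>d. ((\<forall>x\<in>cube n. \<not> d x) \<or> (\<exists>\<tau><n. \<forall>x\<in>cube n. d x \<longleftrightarrow> x ! \<tau>)) \<and>
      (\<forall>x\<in>cube n. prob (bits n) {u. (?g l u \<noteq> ?g l (vxor u x)) \<noteq> d x} \<le> 1/2)"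
      using False by (intro ballI literal_test_sound) (auto simp: not_le)
    from bchoice[OF this] obtain d where
      "\<forall>l\<in>set lits. ((\<forall>x\<in>cube n. \<not> d l x) \<or> (\<exists>\<tau><n. \<forall>x\<in>cube n. d l x \<longleftrightarrow> x ! \<tau>)) \<and>
      (\<forall>x\<in>cube n. prob (bits n) {u. (?g l u \<noteq> ?g l (vxor u x)) \<noteq> d l x} \<le> 1/2)" ..
    then have d: "\<And>l. l \<in> set lits \<Longrightarrow>
        (\<forall>x\<in>cube n. \<not> d l x) \<or> (\<exists>\<tau><n. \<forall>x\<in>cube n. d l x \<longleftrightarrow> x ! \<tau>)"
      and err: "\<And>l x. l \<in> set lits \<Longrightarrow> x \<in> cube n \<Longrightarrow>
        prob (bits n) {u. (?g l u \<noteq> ?g l (vxor u x)) \<noteq> d l x} \<le> 1/2"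
      by simp_all
    define h where "h x \<longleftrightarrow> (\<exists>j<nt. \<forall>l\<in>set lits. fst l = j \<longrightarrow> d l x)" for x
    have hC: "h \<in> monotone_DNF n s r"
    proof -
      \<comment> \<open>Literals corrected to 0 annihilate their terms; \<open>J\<close> keeps the
        indices of the other terms, and \<open>t\<close> names the variable of each remaining
        literal.\<close>
      define Z where "Z = {l \<in> set lits. \<forall>x\<in>cube n. \<not> d l x}"
      have "\<forall>l\<in>set lits - Z. \<exists>\<tau><n. \<forall>x\<in>cube n. d l x \<longleftrightarrow> x ! \<tau>"
        using d unfolding Z_def by blast
      from bchoice[OF this] obtain t where t: "\<forall>l\<in>set lits - Z. t l < n \<and> (\<forall>x\<in>cube n. d l x \<longleftrightarrow> x ! t l)"
        by blast
      define J where "J = {j. j < nt \<and> (\<forall>l\<in>set lits. fst l = j \<longrightarrow> l \<notin> Z)}"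
      define T where "T j = t ` set (filter (\<lambda>l. fst l = j) lits)" for j
      have "T ` J \<subseteq> Pow {..<n}" using t by (auto simp: T_def J_def)
      moreover have "card (T ` J) \<le> s"
      proof -
        have "card (T ` J) \<le> card J" by (rule card_image_le) (simp add: J_def)
        also have "card J \<le> card {..<nt}" by (rule card_mono) (auto simp: J_def)
        finally show ?thesis using nt by simp
      qed
      moreover have "\<forall>A\<in>T ` J. card A \<le> r"
      proof
        fix A assume "A \<in> T ` J"
        then obtain j where A: "A = T j" by blast
        have "card A \<le> card (set (filter (\<lambda>l. fst l = j) lits))"
          unfolding A T_def by (rule card_image_le) simp
        also have "\<dots> \<le> length (filter (\<lambda>l. fst l = j) lits)" by (rule card_length)
        finally show "card A \<le> r" using r[of j] by simp
      qed
      moreover have "\<forall>x\<in>cube n. h x \<longleftrightarrow> (\<exists>A\<in>T ` J. \<forall>i\<in>A. x ! i)"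
      proof
        fix x assume x: "x \<in> cube n"
        have "h x \<longleftrightarrow> (\<exists>j\<in>J. \<forall>l\<in>set lits. fst l = j \<longrightarrow> d l x)"
        proof
          assume "h x"
          then obtain j where j: "j < nt" "\<forall>l\<in>set lits. fst l = j \<longrightarrow> d l x" by (auto simp: h_def)
          then have "j \<in> J" using x by (auto simp: J_def Z_def)
          with j show "\<exists>j\<in>J. \<forall>l\<in>set lits. fst l = j \<longrightarrow> d l x" by blast
        next
          assume "\<exists>j\<in>J. \<forall>l\<in>set lits. fst l = j \<longrightarrow> d l x"
          then show "h x" by (auto simp: h_def J_def)
        qed
        also have "\<dots> \<longleftrightarrow> (\<exists>j\<in>J. \<forall>l\<in>set lits. fst l = j \<longrightarrow> x ! t l)"
        proof (rule bex_cong[OF refl])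
          fix j assume j: "j \<in> J"
          have "d l x \<longleftrightarrow> x ! t l" if "l \<in> set lits" "fst l = j" for l
            using t that j x by (auto simp: J_def)
          then show "(\<forall>l\<in>set lits. fst l = j \<longrightarrow> d l x) \<longleftrightarrow> (\<forall>l\<in>set lits. fst l = j \<longrightarrow> x ! t l)"
            by blast
        qed
        also have "\<dots> \<longleftrightarrow> (\<exists>j\<in>J. \<forall>i\<in>T j. x ! i)"
        proof (rule bex_cong[OF refl])
          fix j
          show "(\<forall>l\<in>set lits. fst l = j \<longrightarrow> x ! t l) \<longleftrightarrow> (\<forall>i\<in>T j. x ! i)"
            unfolding T_def set_filter by blast
        qed
        also have "\<dots> \<longleftrightarrow> (\<exists>A\<in>T ` J. \<forall>i\<in>A. x ! i)" by blast
        finally show "h x \<longleftrightarrow> (\<exists>A\<in>T ` J. \<forall>i\<in>A. x ! i)" .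
      qed
      ultimately show ?thesis unfolding monotone_DNF_def by blast
    qed
    have half: "1/2 \<le> prob ?R {ys. \<not> ?good (x, ys)}" if x: "x \<in> cube n" "f x \<noteq> h x" for x
    proof -
      \<comment> \<open>A good round at such an \<open>x\<close> evaluates some literal differently
        from \<open>d\<close>; being consistent, this literal has all \<open>L\<close> votes wrong.
        The union bound over at most \<open>r * s\<close> literals is where
        \<open>2 * (r * s) <= 2 ^ L\<close> enters.\<close>
      have "prob ?R {ys. ?good (x, ys)} \<le>
          prob ?R {ys. \<exists>l\<in>set lits. \<forall>u\<in>set (drop 2 ys). (?g l u \<noteq> ?g l (vxor u x)) \<noteq> d l x}"
      proof (rule prob_mono)
        fix ys assume "?good (x, ys)"
        then have p: "\<And>l. l \<in> set lits \<Longrightarrow> consistent (?g l) (drop 2 ys) x"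
          and v: "hyp_value ?g nt lits ys x \<noteq> h x" using x(2) by (auto simp: lit_passes_def)
        have "\<exists>l\<in>set lits. corrected (?g l) (drop 2 ys) x \<noteq> d l x"
        proof (rule ccontr)
          assume "\<not> ?thesis"
          then have "\<And>l. l \<in> set lits \<Longrightarrow> corrected (?g l) (drop 2 ys) x = d l x" by blast
          then have "hyp_value ?g nt lits ys x = h x" by (simp add: hyp_value_def h_def)
          with v show False by blast
        qed
        then obtain l where l: "l \<in> set lits" "corrected (?g l) (drop 2 ys) x \<noteq> d l x" by blast
        with p[OF l(1)] show "\<exists>l\<in>set lits. \<forall>u\<in>set (drop 2 ys). (?g l u \<noteq> ?g l (vxor u x)) \<noteq> d l x"
          unfolding consistent_def by (intro bexI[OF _ l(1)]) simp
      qed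
      also have "\<dots> \<le> real (length lits) * (1/2) ^ L"
      proof (rule prob_Bex_le)
        fix l assume l: "l \<in> set lits"
        have "prob ?R {ys. \<forall>u\<in>set (drop 2 ys). (?g l u \<noteq> ?g l (vxor u x)) \<noteq> d l x} =
          prob (map_pmf (drop 2) ?R) {us. \<forall>u\<in>set us. (?g l u \<noteq> ?g l (vxor u x)) \<noteq> d l x}"
          by (rule prob_map_pmf[symmetric])
        also have "\<dots> \<le> (1/2) ^ L"
          unfolding map_pmf_replicate_drop_two by (intro prob_replicate_all_le err l x)
        finally show "prob ?R {ys. \<forall>u\<in>set (drop 2 ys). (?g l u \<noteq> ?g l (vxor u x)) \<noteq> d l x} \<le> (1/2) ^ L" .
      qed
      also have "\<dots> \<le> 1/2"
      proof -
        have "2 * length lits \<le> 2 ^ L" using len L by linarith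
        then have "real (2 * length lits) \<le> real (2 ^ L)" by (simp only: of_nat_le_iff)
        then show ?thesis by (simp add: field_simps power_divide)
      qed
      finally show ?thesis using prob_not[of ?R "\<lambda>ys. ?good (x, ys)"] by simp
    qed
    have "\<epsilon> \<le> prob D {x. f x \<noteq> h x}"
      using far hC by (auto simp: far_from_def)
    with E(1) have "1 / real E \<le> prob D {x. f x \<noteq> h x}" by linarith
    then have "1 / real E * (1/2) \<le> prob D {x. f x \<noteq> h x} * (1/2)"
      by (rule mult_right_mono) simp
    also have "\<dots> \<le> prob (pair_pmf D ?R) {(x, ys). \<not> ?good (x, ys)}"
      by (rule prob_pair_ge) (use half D in auto)
    also have "\<dots> = prob (pair_pmf D ?R) {w. \<not> ?good w}"
      by (rule prob_cong) auto
    also have "\<dots> = 1 - prob (pair_pmf D ?R) {w. ?good w}"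
      by (rule prob_not)
    finally have "prob (pair_pmf D ?R) {w. ?good w} \<le> 1 - 1 / (2 * real E)" by simp
    also have "\<dots> \<le> 1 - 1 / (18 * real E)" using E(2) by (simp add: field_simps)
    finally show ?thesis .
  qed
qed

section \<open>Collisions of random labels\<close>

lemma prob_bits_eq_le: "prob (bits L) {a. a = b} \<le> (1/2) ^ L"
proof (induction L arbitrary: b)
  case (Suc L)
  show ?case
  proof (cases b)
    case Nil
    have "prob (bits (Suc L)) {a. a = b} \<le> prob (bits (Suc L)) {a. False}"
      by (rule prob_mono) (auto simp: Nil cube_def simp del: replicate_pmf.simps)
    then show ?thesis by (simp add: order_trans[OF _ zero_le_power])
  next
    case (Cons c b')
    have "prob (bits (Suc L)) {a. a = b} =
        prob (pair_pmf (bernoulli_pmf (1/2)) (bits L)) {(x, xs). x = c \<and> xs = b'}"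
      unfolding replicate_pmf_Suc_pair prob_map_pmf by (rule prob_cong) (auto simp: Cons)
    also have "\<dots> = measure_pmf.expectation (bernoulli_pmf (1/2))
        (\<lambda>x. indicator {x. x = c} x * prob (bits L) {xs. xs = b'})"
      unfolding prob_pair_integral by (intro Bochner_Integration.integral_cong) (auto simp: indicator_def)
    also have "\<dots> = prob (bernoulli_pmf (1/2)) {x. x = c} * prob (bits L) {xs. xs = b'}"
      by simp
    also have "prob (bernoulli_pmf (1/2)) {x. x = c} = 1/2"
    proof -
      have "{x. x = c} = {c}" by auto
      then show ?thesis by (cases c) (simp_all add: measure_pmf_single)
    qed
    finally show ?thesis using Suc.IH[of b'] by simp
  qed
qed simp

lemma prob_replicate_nth_eq_le:
  assumes "\<And>b. prob p {a. a = b} \<le> c" "i < j" "j < k"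
  shows "prob (replicate_pmf k p) {rs. rs ! i = rs ! j} \<le> c"
  using assms(2,3)
proof (induction k arbitrary: i j)
  case (Suc k)
  \<comment> \<open>A single entry has law \<open>p\<close>, so it hits a given value with
    probability at most \<open>c\<close>; below, the value is the independent head of the
    list.\<close>
  have nth: "prob (replicate_pmf k' p) {rs. rs ! j' = b} \<le> c" if "j' < k'" for k' j' b
    using that
  proof (induction k' arbitrary: j')
    case (Suc k')
    have "prob (replicate_pmf (Suc k') p) {rs. rs ! j' = b} =
        prob (pair_pmf p (replicate_pmf k' p)) {w. (fst w # snd w) ! j' = b}"
      unfolding replicate_pmf_Suc_pair prob_map_pmf by (rule prob_cong) auto
    also have "\<dots> \<le> c"
    proof (cases j')
      case 0
      then show ?thesis using assms(1)[of b] prob_pair_fst[of p "replicate_pmf k' p" "\<lambda>a. a = b"] by simp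
    next
      case (Suc i')
      then show ?thesis using Suc.IH[of i'] Suc.prems
          prob_pair_snd[of p "replicate_pmf k' p" "\<lambda>a. a ! i' = b"] by simp
    qed
    finally show ?case .
  qed simp
  obtain j' where j': "j = Suc j'" using Suc.prems by (cases j) auto
  have "prob (replicate_pmf (Suc k) p) {rs. rs ! i = rs ! j} =
      prob (pair_pmf p (replicate_pmf k p)) {w. (fst w # snd w) ! i = snd w ! j'}"
    unfolding replicate_pmf_Suc_pair prob_map_pmf by (rule prob_cong) (auto simp: j')
  also have "\<dots> \<le> c"
  proof (cases i)
    case 0
    have "prob (pair_pmf p (replicate_pmf k p)) {(x, xs). xs ! j' = x} \<le> c"
      by (rule prob_pair_le) (use nth Suc.prems j' in auto)
    also have "prob (pair_pmf p (replicate_pmf k p)) {(x, xs). xs ! j' = x} =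
        prob (pair_pmf p (replicate_pmf k p)) {w. (fst w # snd w) ! i = snd w ! j'}"
      by (rule prob_cong) (auto simp: 0)
    finally show ?thesis .
  next
    case (Suc i')
    then show ?thesis using Suc.IH[of i' j'] Suc.prems j'
        prob_pair_snd[of p "replicate_pmf k p" "\<lambda>a. a ! i' = a ! j'"] by simp
  qed
  finally show ?case .
qed simp

text \<open>Birthday bound: a union bound over all pairs from \<open>R\<close>. Among them it
  suffices to look at increasing ones, since both orders of a colliding pair are listed.\<close>

lemma labels_collide_le:
  assumes R: "R \<subseteq> {..<n}" and k: "4 * (card R * card R) \<le> 2 ^ L"
  shows "prob (replicate_pmf n (bits L)) {rs. \<not> inj_on (\<lambda>v. rs ! v) R} \<le> 1/4"
proof -
  let ?P = "replicate_pmf n (bits L)"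
  have fin: "finite R" using R finite_subset by blast
  obtain ps where ps: "set ps = R \<times> R" "distinct ps"
    using finite_distinct_list[of "R \<times> R"] fin by blast
  have "prob ?P {rs. \<not> inj_on (\<lambda>v. rs ! v) R} \<le>
      prob ?P {rs. \<exists>w\<in>set ps. fst w < snd w \<and> rs ! fst w = rs ! snd w}"
  proof (rule prob_mono)
    fix rs assume "\<not> inj_on (\<lambda>v. rs ! v) R"
    then obtain i j where ij: "i \<in> R" "j \<in> R" "i \<noteq> j" "rs ! i = rs ! j" by (auto simp: inj_on_def)
    show "\<exists>w\<in>set ps. fst w < snd w \<and> rs ! fst w = rs ! snd w"
    proof (cases "i < j")
      case True
      show ?thesis by (rule bexI[of _ "(i, j)"]) (use True ij ps in auto)
    next
      case False
      show ?thesis by (rule bexI[of _ "(j, i)"]) (use False ij ps in auto)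
    qed
  qed
  also have "\<dots> \<le> real (length ps) * (1/2) ^ L"
  proof (rule prob_Bex_le)
    fix w assume w: "w \<in> set ps"
    show "prob ?P {rs. fst w < snd w \<and> rs ! fst w = rs ! snd w} \<le> (1/2) ^ L"
    proof (cases "fst w < snd w")
      case True
      moreover have "snd w < n" using w ps R by auto
      ultimately show ?thesis
        using prob_replicate_nth_eq_le[of "bits L" "(1/2) ^ L" "fst w" "snd w" n] prob_bits_eq_le by simp
    qed simp
  qed
  also have "length ps = card R * card R"
    using distinct_card[OF ps(2)] ps(1) by (simp add: card_cartesian_product)
  also have "real (card R * card R) * (1/2) ^ L \<le> 1/4"
  proof -
    have "real (4 * (card R * card R)) \<le> real (2 ^ L)" using k by (simp only: of_nat_le_iff)
    then show ?thesis by (simp add: field_simps power_divide)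
  qed
  finally show ?thesis .
qed


subsection \<open>Separating labels\<close>

definition restr :: "nat \<Rightarrow> (nat \<Rightarrow> nat) \<Rightarrow> bool list \<Rightarrow> nat set \<Rightarrow> bool list" where
  "restr n lab x S = map (\<lambda>v. x ! v \<and> lab v \<in> S) [0..<n]"

text \<open>
  The labels found by repeated binary search: each is the largest threshold at which the labels
  found before together with all labels from there on still make \<open>f\<close> true.
\<close>

definition block_chain ::
    "nat \<Rightarrow> (bool list \<Rightarrow> bool) \<Rightarrow> (nat \<Rightarrow> nat) \<Rightarrow> bool list \<Rightarrow> nat list \<Rightarrow> bool" where
  "block_chain n f lab x bs \<longleftrightarrow> (\<forall>i<length bs.
     f (restr n lab x (set (take i bs) \<union> {bs ! i..})) \<and>
     \<not> f (restr n lab x (set (take i bs) \<union> {Suc (bs ! i)..})))"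

text \<open>The common witness is the sample cut down to the chosen blocks. There \<open>f\<close>
  is true but, for members of the class with separating labels, becomes false when any chosen block
  is erased; this makes every literal sensitive to its block.\<close>

definition new_literals :: "nat \<Rightarrow> (nat \<Rightarrow> nat) \<Rightarrow> bool list \<Rightarrow> nat \<Rightarrow> nat list \<Rightarrow> literal list" where
  "new_literals n lab x j bs = map (\<lambda>b. (j, restr n lab x (set bs), b)) bs"

lemma restr_cube [simp]: "restr n lab x S \<in> cube n"
  by (simp add: restr_def cube_def)

lemma nth_restr [simp]: "v < n \<Longrightarrow> restr n lab x S ! v \<longleftrightarrow> x ! v \<and> lab v \<in> S"
  by (simp add: restr_def)

lemma blend_cube [simp]: "blend n lab w b y \<in> cube n"
  by (simp add: blend_def cube_def)

lemma nth_blend [simp]: "v < n \<Longrightarrow> blend n lab w b y ! v = (if lab v = b then y ! v else w ! v)"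
  by (simp add: blend_def)

text \<open>Labels are injective only on the variables that occur in \<open>F\<close>. Other
  variables may share their blocks, since \<open>f\<close> does not depend on them.\<close>

locale separated =
  fixes n s r :: nat and f :: "bool list \<Rightarrow> bool" and F :: "nat set set" and lab :: "nat \<Rightarrow> nat"
  assumes F: "F \<subseteq> Pow {..<n}" "card F \<le> s" "\<And>T. T \<in> F \<Longrightarrow> card T \<le> r"
    and f: "\<And>x. x \<in> cube n \<Longrightarrow> f x \<longleftrightarrow> (\<exists>T\<in>F. \<forall>i\<in>T. x ! i)"
    and inj: "inj_on lab (\<Union>F)"
begin

lemma finite_F: "finite F"
  using F(1) finite_subset by blast

lemma less_n: "T \<in> F \<Longrightarrow> i \<in> T \<Longrightarrow> i < n"
  using F(1) by blast

lemma finite_term: "T \<in> F \<Longrightarrow> finite T"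
  using F(1) finite_subset by blast

lemma f_restr: "f (restr n lab x S) \<longleftrightarrow> (\<exists>T\<in>F. (\<forall>i\<in>T. x ! i) \<and> lab ` T \<subseteq> S)"
proof -
  have "(\<forall>i\<in>T. restr n lab x S ! i) \<longleftrightarrow> (\<forall>i\<in>T. x ! i) \<and> lab ` T \<subseteq> S" if "T \<in> F" for T
    using less_n[OF that] by auto
  then show ?thesis by (auto simp: f)
qed

lemma f_restr_mono: "f (restr n lab x S) \<Longrightarrow> S \<subseteq> S' \<Longrightarrow> f (restr n lab x S')"
  unfolding f_restr by blast

text \<open>If the thresholds failed to increase, the label set that succeeds at stage
  \<open>i\<close> would lie inside the one that fails at the next stage, against
  monotonicity.\<close>

lemma sorted_block_chain:
  assumes "block_chain n f lab x bs"
  shows "sorted_wrt (<) bs"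
proof (subst sorted_wrt_iff_nth_Suc_transp)
  show "\<forall>i. Suc i < length bs \<longrightarrow> bs ! i < bs ! Suc i"
  proof (intro allI impI)
    fix i assume i: "Suc i < length bs"
    let ?S = "set (take i bs)"
    have t: "set (take (Suc i) bs) = insert (bs ! i) ?S" using i by (simp add: take_Suc_conv_app_nth)
    have 1: "f (restr n lab x (?S \<union> {bs ! i..}))"
      and 2: "\<not> f (restr n lab x (insert (bs ! i) ?S \<union> {Suc (bs ! Suc i)..}))"
      using assms i unfolding block_chain_def t[symmetric] by auto
    show "bs ! i < bs ! Suc i"
    proof (rule ccontr)
      assume "\<not> ?thesis"
      then have "?S \<union> {bs ! i..} \<subseteq> insert (bs ! i) ?S \<union> {Suc (bs ! Suc i)..}" by auto
      then show False using f_restr_mono[OF 1] 2 by blast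
    qed
  qed
qed (auto simp: transp_def)

text \<open>This is the minimality of a chain. If \<open>T\<close> avoided the label
  \<open>bs ! i\<close>, all its labels would be among the earlier ones or strictly above
  \<open>bs ! i\<close>, and \<open>T\<close> would make \<open>f\<close> true at the threshold
  where stage \<open>i\<close> saw it fail.\<close>

lemma block_chain_needed:
  assumes chain: "block_chain n f lab x bs" and T: "T \<in> F" "\<forall>i\<in>T. x ! i"
    and sub: "lab ` T \<subseteq> set bs \<union> {c. \<forall>b\<in>set bs. b < c}"
  shows "set bs \<subseteq> lab ` T"
proof
  fix b assume "b \<in> set bs"
  then obtain i where i: "i < length bs" "b = bs ! i" by (auto simp: in_set_conv_nth)
  show "b \<in> lab ` T"
  proof (rule ccontr)
    assume b: "b \<notin> lab ` T"
    have "lab ` T \<subseteq> set (take i bs) \<union> {Suc (bs ! i)..}"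
    proof
      fix c assume c: "c \<in> lab ` T"
      with sub consider "c \<in> set bs" | "\<forall>b\<in>set bs. b < c" by blast
      then show "c \<in> set (take i bs) \<union> {Suc (bs ! i)..}"
      proof cases
        case 1
        then obtain k where k: "k < length bs" "c = bs ! k" by (auto simp: in_set_conv_nth)
        have "k \<noteq> i" using k i b c by auto
        then consider "k < i" | "i < k" by linarith
        then show ?thesis
        proof cases
          case 1
          then show ?thesis using k i by (auto simp: in_set_conv_nth intro!: exI[of _ k])
        next
          case 2
          then have "bs ! i < bs ! k"
            using sorted_wrt_nth_less[OF sorted_block_chain[OF chain]] k by blast
          then show ?thesis using k by simp
        qed
      next
        case 2
        then show ?thesis using i by (auto simp: Suc_le_eq)
      qed
    qed
    then have "f (restr n lab x (set (take i bs) \<union> {Suc (bs ! i)..}))"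
      unfolding f_restr using T by blast
    then show False using chain i unfolding block_chain_def by blast
  qed
qed

text \<open>The term that makes the last stage succeed uses all \<open>r\<close> labels by
  minimality, and having at most \<open>r\<close> variables it uses no others. Hence a chain of
  length \<open>r\<close> that still leaves \<open>f\<close> false is evidence against
  membership.\<close>

lemma block_chain_length:
  assumes chain: "block_chain n f lab x bs" and len: "length bs = r" "r \<ge> 1"
  shows "f (restr n lab x (set bs))"
proof -
  define i where "i = r - 1"
  have i: "i < length bs" "Suc i = length bs" using len by (simp_all add: i_def)
  have srt: "sorted_wrt (<) bs" by (rule sorted_block_chain[OF chain])
  have "f (restr n lab x (set (take i bs) \<union> {bs ! i..}))"
    using chain i unfolding block_chain_def by blast
  then obtain T where T: "T \<in> F" "\<forall>i\<in>T. x ! i" and sub: "lab ` T \<subseteq> set (take i bs) \<union> {bs ! i..}"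
    unfolding f_restr by blast
  have "set (take i bs) \<union> {bs ! i..} \<subseteq> set bs \<union> {c. \<forall>b\<in>set bs. b < c}"
  proof
    fix c assume c: "c \<in> set (take i bs) \<union> {bs ! i..}"
    show "c \<in> set bs \<union> {c. \<forall>b\<in>set bs. b < c}"
    proof (cases "c \<in> set (take i bs) \<or> c = bs ! i")
      case True
      then show ?thesis using i set_take_subset[of i bs] by auto
    next
      case False
      then have c': "bs ! i < c" using c by auto
      have "b < c" if "b \<in> set bs" for b
      proof -
        from that obtain k where k: "k < length bs" "b = bs ! k" by (auto simp: in_set_conv_nth)
        then have "k = i \<or> bs ! k < bs ! i"
          using sorted_wrt_nth_less[OF srt, of k i] i by fastforce
        then show ?thesis using k c' by auto
      qed
      then show ?thesis by blast
    qed
  qed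
  with sub have "set bs \<subseteq> lab ` T" by (intro block_chain_needed[OF chain T]) auto
  moreover have "card (set bs) = r"
    using strict_sorted_iff[of bs] srt len distinct_card[of bs] by simp
  moreover have "card (lab ` T) \<le> r"
    using card_image_le[OF finite_term[OF T(1)], of lab] F(3)[OF T(1)] by linarith
  ultimately have "lab ` T = set bs"
    using card_seteq[of "lab ` T" "set bs"] finite_term[OF T(1)] by simp
  then show ?thesis unfolding f_restr using T by blast
qed

text \<open>The chosen blocks are exactly those of one term \<open>T\<close>. Feeding
  \<open>y\<close> into the block of \<open>tau\<close> leaves \<open>T\<close> true iff
  \<open>y ! tau\<close> holds, and no other term can take over, by minimality.\<close>

lemma block_chain_term:
  assumes chain: "block_chain n f lab x bs" and fx: "f (restr n lab x (set bs))"
  obtains T where "T \<in> F" "\<forall>i\<in>T. x ! i" "lab ` T = set bs"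
    "\<And>\<tau> y j. \<tau> \<in> T \<Longrightarrow> y \<in> cube n \<Longrightarrow> lit n f lab (j, restr n lab x (set bs), lab \<tau>) y \<longleftrightarrow> y ! \<tau>"
proof -
  from fx obtain T where T: "T \<in> F" "\<forall>i\<in>T. x ! i" "lab ` T \<subseteq> set bs" unfolding f_restr by blast
  have eq: "lab ` T = set bs"
    using block_chain_needed[OF chain T(1,2)] T(3) by blast
  have "lit n f lab (j, restr n lab x (set bs), lab \<tau>) y \<longleftrightarrow> y ! \<tau>"
    if \<tau>: "\<tau> \<in> T" and y: "y \<in> cube n" for \<tau> y j
  proof -
    let ?p = "blend n lab (restr n lab x (set bs)) (lab \<tau>) y"
    \<comment> \<open>Injectivity of the labels: within any term, the block of \<open>tau\<close>
      contains no variable but \<open>tau\<close>.\<close>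
    have same: "v = \<tau>" if "v \<in> T'" "T' \<in> F" "lab v = lab \<tau>" for v T'
      using inj that \<tau> T(1) by (auto simp: inj_on_def)
    have "f ?p \<longleftrightarrow> y ! \<tau>"
    proof
      assume "y ! \<tau>"
      have "?p ! v" if "v \<in> T" for v
      proof (cases "lab v = lab \<tau>")
        case True
        then show ?thesis using same[OF that T(1)] \<open>y ! \<tau>\<close> less_n[OF T(1) that] by simp
      next
        case False
        then show ?thesis using that T less_n[OF T(1) that] by auto
      qed
      then show "f ?p" using T(1) by (auto simp: f)
    next
      assume "f ?p"
      then obtain T' where T': "T' \<in> F" "\<forall>i\<in>T'. ?p ! i" by (auto simp: f)
      show "y ! \<tau>"
      proof (rule ccontr)
        assume ny: "\<not> y ! \<tau>"
        \<comment> \<open>With \<open>y ! tau\<close> false, \<open>T'\<close> cannot contain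
          \<open>tau\<close>, so it is true on the chosen blocks without that of \<open>tau\<close>,
          contradicting \<open>block_chain_needed\<close>.\<close>
        have "x ! v \<and> lab v \<in> set bs - {lab \<tau>}" if v: "v \<in> T'" for v
        proof -
          have "?p ! v" "v < n" using T' v less_n by auto
          moreover have "lab v \<noteq> lab \<tau>"
          proof
            assume "lab v = lab \<tau>"
            with same[OF v T'(1)] have "v = \<tau>" by blast
            with \<open>?p ! v\<close> \<open>v < n\<close> ny show False by simp
          qed
          ultimately show ?thesis by simp
        qed
        then have x': "\<forall>i\<in>T'. x ! i" and sub: "lab ` T' \<subseteq> set bs - {lab \<tau>}" by auto
        have "set bs \<subseteq> lab ` T'"
          by (rule block_chain_needed[OF chain T'(1) x']) (use sub in auto)
        then show False using sub eq \<tau> by blast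
      qed
    qed
    then show ?thesis by (simp add: lit_def)
  qed
  then show ?thesis using that T eq by blast
qed

text \<open>\<open>Tf\<close> matches hypothesis terms with terms of \<open>F\<close>. Injectivity
  bounds their number by \<open>card F\<close>; matching literals and variables in both directions
  makes each pair of terms equivalent.\<close>

definition faithful :: "nat \<Rightarrow> literal list \<Rightarrow> bool" where
  "faithful nt lits \<longleftrightarrow> (\<exists>Tf. inj_on Tf {..<nt} \<and> Tf ` {..<nt} \<subseteq> F \<and>
     (\<forall>j<nt. \<forall>\<tau>\<in>Tf j. \<exists>l\<in>set lits. fst l = j \<and> (\<forall>y\<in>cube n. lit n f lab l y \<longleftrightarrow> y ! \<tau>)) \<and>
     (\<forall>l\<in>set lits. fst l < nt \<and> (\<exists>\<tau>\<in>Tf (fst l). \<forall>y\<in>cube n. lit n f lab l y \<longleftrightarrow> y ! \<tau>)))"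

lemma faithful_empty: "faithful 0 []"
  by (simp add: faithful_def)

lemma corrected_dictator:
  assumes "\<And>y. y \<in> cube n \<Longrightarrow> g y \<longleftrightarrow> y ! \<tau>" "\<tau> < n" "x \<in> cube n" "set us \<subseteq> cube n" "us \<noteq> []"
  shows "corrected g us x \<longleftrightarrow> x ! \<tau>" "consistent g us x"
proof -
  have "(g u \<noteq> g (vxor u x)) \<longleftrightarrow> x ! \<tau>" if "u \<in> set us" for u
  proof -
    have "u \<in> cube n" using that assms(4) by blast
    then show ?thesis using assms(1)[of u] assms(1)[of "vxor u x"] assms(2,3) by (auto simp: cube_def)
  qed
  then show "corrected g us x \<longleftrightarrow> x ! \<tau>" "consistent g us x"
    using hd_in_set[OF assms(5)] by (auto simp: corrected_def consistent_def)
qed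

context
  fixes nt :: nat and lits :: "literal list" and x :: "bool list" and ys :: "bool list list"
  assumes faith: "faithful nt lits"
    and x: "x \<in> cube n" and ys: "set ys \<subseteq> cube n" "length ys \<ge> 3"
begin

lemma drop_two_rows: "set (drop 2 ys) \<subseteq> cube n" "drop 2 ys \<noteq> []"
  using ys set_drop_subset[of 2 ys] by auto

lemma faithful_passes:
  assumes l: "l \<in> set lits"
  shows "lit_passes (lit n f lab l) ys x"
proof -
  obtain Tf where Tf: "Tf ` {..<nt} \<subseteq> F"
    "\<forall>l\<in>set lits. fst l < nt \<and> (\<exists>\<tau>\<in>Tf (fst l). \<forall>y\<in>cube n. lit n f lab l y \<longleftrightarrow> y ! \<tau>)"
    using faith unfolding faithful_def by blast
  with l obtain \<tau> where t: "fst l < nt" "\<tau> \<in> Tf (fst l)" "\<forall>y\<in>cube n. lit n f lab l y \<longleftrightarrow> y ! \<tau>"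
    by blast
  then have g: "\<And>y. y \<in> cube n \<Longrightarrow> lit n f lab l y \<longleftrightarrow> y ! \<tau>" by blast
  have \<tau>: "\<tau> < n" using less_n[of "Tf (fst l)" \<tau>] Tf(1) t by auto
  have "ys ! 0 \<in> cube n" "ys ! 1 \<in> cube n" "ys ! 2 \<in> cube n"
    using ys(2) by (auto intro!: subsetD[OF ys(1)] nth_mem)
  then show ?thesis unfolding lit_passes_def
    using literal_test_dictator[OF g \<tau>] corrected_dictator(2)[OF g \<tau> x drop_two_rows] by blast
qed

lemma faithful_value:
  obtains Tf where "inj_on Tf {..<nt}" "Tf ` {..<nt} \<subseteq> F"
    "\<forall>j<nt. \<forall>\<tau>\<in>Tf j. \<exists>l\<in>set lits. fst l = j \<and> (\<forall>y\<in>cube n. lit n f lab l y \<longleftrightarrow> y ! \<tau>)"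
    "\<forall>l\<in>set lits. fst l < nt \<and> (\<exists>\<tau>\<in>Tf (fst l). \<forall>y\<in>cube n. lit n f lab l y \<longleftrightarrow> y ! \<tau>)"
    "hyp_value (lit n f lab) nt lits ys x \<longleftrightarrow> (\<exists>j<nt. \<forall>\<tau>\<in>Tf j. x ! \<tau>)"
proof -
  let ?g = "lit n f lab"
  from faith obtain Tf where Tf: "inj_on Tf {..<nt}" "Tf ` {..<nt} \<subseteq> F"
    and a: "\<forall>j<nt. \<forall>\<tau>\<in>Tf j. \<exists>l\<in>set lits. fst l = j \<and> (\<forall>y\<in>cube n. ?g l y \<longleftrightarrow> y ! \<tau>)"
    and b: "\<forall>l\<in>set lits. fst l < nt \<and> (\<exists>\<tau>\<in>Tf (fst l). \<forall>y\<in>cube n. ?g l y \<longleftrightarrow> y ! \<tau>)"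
    unfolding faithful_def by blast
  have cor: "corrected (?g l) (drop 2 ys) x \<longleftrightarrow> x ! \<tau>"
    if "\<forall>y\<in>cube n. ?g l y \<longleftrightarrow> y ! \<tau>" "\<tau> < n" for l \<tau>
    by (rule corrected_dictator(1)) (use that x drop_two_rows in auto)
  have ln: "\<tau> < n" if "j < nt" "\<tau> \<in> Tf j" for j \<tau>
    using less_n[of "Tf j" \<tau>] Tf(2) that by auto
  have "(\<forall>l\<in>set lits. fst l = j \<longrightarrow> corrected (?g l) (drop 2 ys) x) \<longleftrightarrow> (\<forall>\<tau>\<in>Tf j. x ! \<tau>)"
    if j: "j < nt" for j
  proof
    assume L: "\<forall>l\<in>set lits. fst l = j \<longrightarrow> corrected (?g l) (drop 2 ys) x"
    show "\<forall>\<tau>\<in>Tf j. x ! \<tau>"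
    proof
      fix \<tau> assume \<tau>: "\<tau> \<in> Tf j"
      with a j obtain l where l: "l \<in> set lits" "fst l = j" "\<forall>y\<in>cube n. ?g l y \<longleftrightarrow> y ! \<tau>" by blast
      with L have "corrected (?g l) (drop 2 ys) x" by blast
      then show "x ! \<tau>" using cor[OF l(3) ln[OF j \<tau>]] by blast
    qed
  next
    assume R: "\<forall>\<tau>\<in>Tf j. x ! \<tau>"
    show "\<forall>l\<in>set lits. fst l = j \<longrightarrow> corrected (?g l) (drop 2 ys) x"
    proof (intro ballI impI)
      fix l assume l: "l \<in> set lits" "fst l = j"
      with b obtain \<tau> where \<tau>: "\<tau> \<in> Tf j" "\<forall>y\<in>cube n. ?g l y \<longleftrightarrow> y ! \<tau>" by blast
      then show "corrected (?g l) (drop 2 ys) x" using cor[OF \<tau>(2) ln[OF j \<tau>(1)]] R by blast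
    qed
  qed
  then have "hyp_value ?g nt lits ys x \<longleftrightarrow> (\<exists>j<nt. \<forall>\<tau>\<in>Tf j. x ! \<tau>)"
    unfolding hyp_value_def by blast
  then show ?thesis using that Tf a b by blast
qed

lemma faithful_no_false_positive: "hyp_value (lit n f lab) nt lits ys x \<Longrightarrow> f x"
proof -
  assume v: "hyp_value (lit n f lab) nt lits ys x"
  obtain Tf where "Tf ` {..<nt} \<subseteq> F"
    "hyp_value (lit n f lab) nt lits ys x \<longleftrightarrow> (\<exists>j<nt. \<forall>\<tau>\<in>Tf j. x ! \<tau>)"
    by (rule faithful_value)
  with v show "f x" using x by (auto simp: f)
qed

text \<open>The term found is true at \<open>x\<close> whereas all matched terms are false there, so
  it is a new one and injectivity survives.\<close>

lemma faithful_extend: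
  assumes v: "\<not> hyp_value (lit n f lab) nt lits ys x"
    and chain: "block_chain n f lab x bs" and fx: "f (restr n lab x (set bs))"
  shows "faithful (Suc nt) (lits @ new_literals n lab x nt bs)"
proof -
  let ?g = "lit n f lab"
  obtain Tf where Tf: "inj_on Tf {..<nt}" "Tf ` {..<nt} \<subseteq> F"
    and a: "\<forall>j<nt. \<forall>\<tau>\<in>Tf j. \<exists>l\<in>set lits. fst l = j \<and> (\<forall>y\<in>cube n. ?g l y \<longleftrightarrow> y ! \<tau>)"
    and b: "\<forall>l\<in>set lits. fst l < nt \<and> (\<exists>\<tau>\<in>Tf (fst l). \<forall>y\<in>cube n. ?g l y \<longleftrightarrow> y ! \<tau>)"
    and val: "hyp_value ?g nt lits ys x \<longleftrightarrow> (\<exists>j<nt. \<forall>\<tau>\<in>Tf j. x ! \<tau>)"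
    by (rule faithful_value)
  obtain T where T: "T \<in> F" "\<forall>i\<in>T. x ! i" "lab ` T = set bs"
    and dict: "\<And>\<tau> y j. \<tau> \<in> T \<Longrightarrow> y \<in> cube n \<Longrightarrow> ?g (j, restr n lab x (set bs), lab \<tau>) y \<longleftrightarrow> y ! \<tau>"
    by (rule block_chain_term[OF chain fx]) blast
  have new: "T \<notin> Tf ` {..<nt}" using v val T(2) by blast
  define Tf' where "Tf' = Tf(nt := T)"
  have old: "Tf' j = Tf j" if "j < nt" for j using that by (simp add: Tf'_def)
  have "inj_on Tf' {..<Suc nt}"
    using Tf(1) new old unfolding lessThan_Suc inj_on_insert
    by (auto simp: Tf'_def inj_on_def)
  moreover have "Tf' ` {..<Suc nt} \<subseteq> F" using Tf(2) T(1) by (auto simp: Tf'_def less_Suc_eq)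
  moreover have "\<exists>l\<in>set (lits @ new_literals n lab x nt bs). fst l = j \<and> (\<forall>y\<in>cube n. ?g l y \<longleftrightarrow> y ! \<tau>)"
    if j: "j < Suc nt" and \<tau>: "\<tau> \<in> Tf' j" for j \<tau>
  proof (cases "j = nt")
    case True
    then have "\<tau> \<in> T" using \<tau> by (simp add: Tf'_def)
    then have "(nt, restr n lab x (set bs), lab \<tau>) \<in> set (new_literals n lab x nt bs)"
      using T(3) by (auto simp: new_literals_def)
    moreover have "\<forall>y\<in>cube n. ?g (nt, restr n lab x (set bs), lab \<tau>) y \<longleftrightarrow> y ! \<tau>"
      using dict[OF \<open>\<tau> \<in> T\<close>] by blast
    ultimately show ?thesis using True
      by (intro bexI[of _ "(nt, restr n lab x (set bs), lab \<tau>)"]) auto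
  next
    case False
    then have "j < nt" using j by simp
    with a \<tau> old[of j] have "\<exists>l\<in>set lits. fst l = j \<and> (\<forall>y\<in>cube n. ?g l y \<longleftrightarrow> y ! \<tau>)" by simp
    then show ?thesis by auto
  qed
  moreover have "fst l < Suc nt \<and> (\<exists>\<tau>\<in>Tf' (fst l). \<forall>y\<in>cube n. ?g l y \<longleftrightarrow> y ! \<tau>)"
    if l: "l \<in> set (lits @ new_literals n lab x nt bs)" for l
  proof (cases "l \<in> set lits")
    case True
    then show ?thesis using b old[of "fst l"] by auto
  next
    case False
    then obtain b' where b': "b' \<in> set bs" "l = (nt, restr n lab x (set bs), b')"
      using l by (auto simp: new_literals_def)
    then obtain \<tau> where "\<tau> \<in> T" "b' = lab \<tau>" using T(3) by auto
    then show ?thesis using dict[of \<tau>] b' by (auto simp: Tf'_def)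
  qed
  ultimately show ?thesis unfolding faithful_def by blast
qed

text \<open>Some term of \<open>F\<close> is true at \<open>x\<close> and none of the matched ones
  is, so the matched terms do not exhaust \<open>F\<close>.\<close>

lemma faithful_room:
  assumes "\<not> hyp_value (lit n f lab) nt lits ys x" "f x"
  shows "nt < s"
proof -
  obtain Tf where Tf: "inj_on Tf {..<nt}" "Tf ` {..<nt} \<subseteq> F"
    and val: "hyp_value (lit n f lab) nt lits ys x \<longleftrightarrow> (\<exists>j<nt. \<forall>\<tau>\<in>Tf j. x ! \<tau>)"
    by (rule faithful_value)
  from assms(2) x obtain T where T: "T \<in> F" "\<forall>i\<in>T. x ! i" by (auto simp: f)
  then have "insert T (Tf ` {..<nt}) \<subseteq> F" "T \<notin> Tf ` {..<nt}" using Tf(2) assms(1) val by auto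
  then have "Suc (card (Tf ` {..<nt})) \<le> card F"
    using card_mono[OF finite_F, of "insert T (Tf ` {..<nt})"] by simp
  then show ?thesis using card_image[OF Tf(1)] F(2) by simp
qed

end

end


subsection \<open>The program: evaluating the hypothesis\<close>

notation Seq (infixr ";;" 60)

text \<open>
  Array names. A scalar occupies cell 0 of an array of its own. Literal \<open>k\<close> has the term index
  \<open>aLT[k]\<close>, the block label \<open>aLB[k]\<close>, and its witness in \<open>aW\<close> from cell \<open>aLW[k]\<close> on. \<open>aTV[j]\<close> is the
  value of term \<open>j\<close> on the current sample, and \<open>aCh[v]\<close> tells whether the block of \<open>v\<close> has been chosen
  for the new term. The names starting with \<open>c\<close> are loop counters.
\<close>

abbreviation (input) aL :: nat where "aL \<equiv> 2"
abbreviation (input) aPow :: nat where "aPow \<equiv> 3"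
abbreviation (input) aTotal :: nat where "aTotal \<equiv> 4"
abbreviation (input) aLab :: nat where "aLab \<equiv> 5"
abbreviation (input) aTape :: nat where "aTape \<equiv> 6"
abbreviation (input) aNT :: nat where "aNT \<equiv> 7"
abbreviation (input) aNL :: nat where "aNL \<equiv> 8"
abbreviation (input) aLT :: nat where "aLT \<equiv> 9"
abbreviation (input) aLB :: nat where "aLB \<equiv> 10"
abbreviation (input) aLW :: nat where "aLW \<equiv> 11"
abbreviation (input) aW :: nat where "aW \<equiv> 12"
abbreviation (input) aWP :: nat where "aWP \<equiv> 13"
abbreviation (input) aRej :: nat where "aRej \<equiv> 14"
abbreviation (input) aX :: nat where "aX \<equiv> 15"
abbreviation (input) aBuf :: nat where "aBuf \<equiv> 16"
abbreviation (input) aCh :: nat where "aCh \<equiv> 17"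
abbreviation (input) aRS :: nat where "aRS \<equiv> 18"
abbreviation (input) aTarget :: nat where "aTarget \<equiv> 19"
abbreviation (input) aTK :: nat where "aTK \<equiv> 20"
abbreviation (input) aTL :: nat where "aTL \<equiv> 21"
abbreviation (input) aN :: nat where "aN \<equiv> 22"
abbreviation (input) aTV :: nat where "aTV \<equiv> 23"
abbreviation (input) aG1 :: nat where "aG1 \<equiv> 24"
abbreviation (input) aG2 :: nat where "aG2 \<equiv> 25"
abbreviation (input) aG3 :: nat where "aG3 \<equiv> 26"
abbreviation (input) aG4 :: nat where "aG4 \<equiv> 27"
abbreviation (input) aG5 :: nat where "aG5 \<equiv> 28"
abbreviation (input) aSum :: nat where "aSum \<equiv> 29"
abbreviation (input) aU :: nat where "aU \<equiv> 30"
abbreviation (input) aV :: nat where "aV \<equiv> 31"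
abbreviation (input) aUP :: nat where "aUP \<equiv> 32"
abbreviation (input) aH :: nat where "aH \<equiv> 33"
abbreviation (input) aFx :: nat where "aFx \<equiv> 34"
abbreviation (input) aNB :: nat where "aNB \<equiv> 35"
abbreviation (input) aRes :: nat where "aRes \<equiv> 36"
abbreviation (input) aLo :: nat where "aLo \<equiv> 37"
abbreviation (input) aP :: nat where "aP \<equiv> 38"
abbreviation (input) cV :: nat where "cV \<equiv> 40"
abbreviation (input) cQ :: nat where "cQ \<equiv> 41"
abbreviation (input) cK :: nat where "cK \<equiv> 42"
abbreviation (input) cJ :: nat where "cJ \<equiv> 43"
abbreviation (input) cI :: nat where "cI \<equiv> 44"
abbreviation (input) cL :: nat where "cL \<equiv> 45"
abbreviation (input) cN :: nat where "cN \<equiv> 46"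
abbreviation (input) cF :: nat where "cF \<equiv> 47"
abbreviation (input) cM :: nat where "cM \<equiv> 48"

abbreviation sc :: "nat \<Rightarrow> expr" where "sc a \<equiv> Get a (Const 0)"
abbreviation in_n :: expr where "in_n \<equiv> Get 0 (Const 0)"
abbreviation in_s :: expr where "in_s \<equiv> Get 0 (Const 1)"
abbreviation in_r :: expr where "in_r \<equiv> Get 0 (Const 2)"
abbreviation in_E :: expr where "in_E \<equiv> Get 0 (Const 3)"
abbreviation setc :: "nat \<Rightarrow> expr \<Rightarrow> com" where "setc a e \<equiv> Put a (Const 0) e"

text \<open>Nonzero iff the two numbers differ; on bits this is exclusive or.\<close>

abbreviation xorE :: "expr \<Rightarrow> expr \<Rightarrow> expr" where
  "xorE e1 e2 \<equiv> Plus (Minus e1 e2) (Minus e2 e1)"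

text \<open>Truncated subtraction makes this the conjunction when both values are bits.\<close>

abbreviation andE :: "expr \<Rightarrow> expr \<Rightarrow> expr" where
  "andE e1 e2 \<equiv> Minus (Plus e1 e2) (Const 1)"

text \<open>The expressions may read the counter \<open>cV\<close> and thereby act as functions of
  the coordinate.\<close>

definition Point :: "expr \<Rightarrow> expr \<Rightarrow> expr \<Rightarrow> com" where
  "Point b e1 e2 = For cV in_n (If b (Put aBuf (sc cV) e1) (Put aBuf (sc cV) e2))"

definition QPoint :: "nat \<Rightarrow> expr \<Rightarrow> expr \<Rightarrow> expr \<Rightarrow> com" where
  "QPoint a b e1 e2 = Point b e1 e2 ;; Query a (Const 0) aBuf (Const 0)"

definition QLit :: "nat \<Rightarrow> expr \<Rightarrow> com" where
  "QLit a e = QPoint a (xorE (Get aLab (sc cV)) (Get aLB (sc cK)))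
     (Get aW (Plus (Get aLW (sc cK)) (sc cV))) e"

abbreviation row_y :: expr where "row_y \<equiv> Get aTape (sc cV)"
abbreviation row_z :: expr where "row_z \<equiv> Get aTape (Plus in_n (sc cV))"
abbreviation row_u0 :: expr where "row_u0 \<equiv> Get aTape (Plus (Plus in_n in_n) (sc cV))"
abbreviation row_u :: expr where "row_u \<equiv> Get aTape (Plus (sc aUP) (sc cV))"

text \<open>\<open>aSum\<close> accumulates the votes for 1, and \<open>aUP\<close> walks along the
  rows of the tape; both are initialized by the caller, the latter to row 2.\<close>

definition Correct :: com where
  "Correct = For cQ (sc aL)
     (QLit aU row_u ;; QLit aV (xorE row_u (Get aX (sc cV))) ;;
      setc aSum (Plus (sc aSum) (xorE (sc aU) (sc aV))) ;; setc aUP (Plus (sc aUP) in_n))"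

text \<open>Dissent shows as a vote count strictly between 0 and \<open>L\<close>. A term is
  evaluated by clearing its initial value 1 whenever one of its literals gets no vote.\<close>

definition Literal :: com where
  "Literal = QLit aG1 row_y ;; QLit aG2 row_z ;; QLit aG3 (xorE row_y row_z) ;;
     QLit aG4 row_u0 ;; QLit aG5 (xorE row_u0 (andE row_y row_z)) ;;
     setc aSum (Const 0) ;; setc aUP (Plus in_n in_n) ;; Correct ;;
     If (xorE (xorE (sc aG1) (sc aG2)) (sc aG3)) (setc aRej (Const 1)) Skip ;;
     If (xorE (andE (sc aG1) (sc aG2)) (xorE (sc aG4) (sc aG5))) (setc aRej (Const 1)) Skip ;;
     If (sc aSum) (If (Minus (sc aL) (sc aSum)) (setc aRej (Const 1)) Skip)
       (Put aTV (Get aLT (sc cK)) (Const 0))"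

definition Evaluate :: com where
  "Evaluate = For cJ (sc aNT) (Put aTV (sc cJ) (Const 1)) ;; For cK (sc aNL) Literal ;;
     setc aH (Const 0) ;; For cJ (sc aNT) (If (Get aTV (sc cJ)) (setc aH (Const 1)) Skip) ;;
     Query aFx (Const 0) aX (Const 0)"

section \<open>Footprints of programs and verification of the evaluation\<close>

definition frame :: "nat set \<Rightarrow> memory \<Rightarrow> memory \<Rightarrow> bool" where
  "frame A m m' \<longleftrightarrow> (\<forall>a. a \<notin> A \<longrightarrow> m' a = m a)"

lemma frame_refl [simp]: "frame A m m"
  by (simp add: frame_def)

lemma frameD: "frame A m m' \<Longrightarrow> a \<notin> A \<Longrightarrow> m' a = m a"
  by (simp add: frame_def)

lemma frame_mono: "frame A m m' \<Longrightarrow> A \<subseteq> A' \<Longrightarrow> frame A' m m'"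
  by (auto simp: frame_def)

lemma frame_trans: "frame A m m' \<Longrightarrow> frame A' m' m'' \<Longrightarrow> A \<subseteq> A'' \<Longrightarrow> A' \<subseteq> A'' \<Longrightarrow> frame A'' m m''"
  by (auto simp: frame_def subset_iff) (metis)

lemma frame_upd [simp]: "a \<in> A \<Longrightarrow> frame A m (m'(a := v)) = frame A m m'"
  by (auto simp: frame_def)

definition bit_row :: "nat \<Rightarrow> memory \<Rightarrow> nat \<Rightarrow> nat \<Rightarrow> bool list \<Rightarrow> bool" where
  "bit_row n m a j x \<longleftrightarrow> length x = n \<and> (\<forall>v<n. m a (j + v) = of_bool (x ! v))"

context machine
begin

lemma ok_Put_Seq: "ok c q (m(a := (m a)(value_of m i := value_of m e))) Q \<Longrightarrow> ok (Put a i e ;; c) q m Q"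
  using ok_Seq[OF ok_Put[where Q = "\<lambda>m'. m' = m(a := (m a)(value_of m i := value_of m e))"], of m a i e c q Q]
  by simp

lemma ok_SeqI: "ok c1 q1 m R \<Longrightarrow> (\<And>m'. R m' \<Longrightarrow> ok c2 q2 m' Q) \<Longrightarrow> q1 + q2 = q \<Longrightarrow> ok (c1 ;; c2) q m Q"
  using ok_Seq by blast

lemma ok_Point:
  assumes n: "m 0 0 = n" "length p = n"
    and pt: "\<And>v m'. v < n \<Longrightarrow> frame {aBuf, cV} m m' \<Longrightarrow> m' cV 0 = v \<Longrightarrow>
      (if value_of m' b \<noteq> 0 then value_of m' e1 else value_of m' e2) \<noteq> 0 \<longleftrightarrow> p ! v"
  shows "ok (Point b e1 e2) 0 m (\<lambda>m'. frame {aBuf, cV} m m' \<and> row n m' aBuf 0 = p)"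
proof -
  let ?I = "\<lambda>i m'. frame {aBuf, cV} m m' \<and> (\<forall>v<i. m' aBuf v \<noteq> 0 \<longleftrightarrow> p ! v)"
  have "ok (Point b e1 e2) (n * 0) m (\<lambda>m'. frame {aBuf, cV} m m' \<and> row n m' aBuf 0 = p)"
    unfolding Point_def
  proof (rule ok_For[where I = ?I])
    show "n \<le> B" by (rule n_le)
    fix i m' assume I: "?I i m'" "m' cV 0 = i"
    show "value_of m' in_n = n" using I n by (simp add: frame_def)
    assume i: "i < n"
    show "ok (If b (Put aBuf (sc cV) e1) (Put aBuf (sc cV) e2)) 0 m'
        (\<lambda>m''. m'' cV 0 = i \<and> ?I (Suc i) (m''(cV := (m'' cV)(0 := Suc i))))"
      by (rule ok_If; rule ok_Put) (use I i pt[OF i, of m'] in \<open>auto simp: less_Suc_eq split: if_splits\<close>)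
  next
    fix m' assume "?I n m'" "m' cV 0 = n"
    then show "frame {aBuf, cV} m m' \<and> row n m' aBuf 0 = p"
      using n by (auto intro: nth_equalityI)
  qed simp
  then show ?thesis by simp
qed

lemma ok_QPoint:
  assumes "m 0 0 = n" "length p = n" "a \<noteq> aBuf"
    and "\<And>v m'. v < n \<Longrightarrow> frame {aBuf, cV} m m' \<Longrightarrow> m' cV 0 = v \<Longrightarrow>
      (if value_of m' b \<noteq> 0 then value_of m' e1 else value_of m' e2) \<noteq> 0 \<longleftrightarrow> p ! v"
  shows "ok (QPoint a b e1 e2) 1 m (\<lambda>m'. frame {aBuf, cV, a} m m' \<and> row n m' aBuf 0 = p \<and> m' a 0 = of_bool (f p))"
  unfolding QPoint_def
proof (rule ok_SeqI[OF ok_Point[where p = p]])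
  fix m' assume "frame {aBuf, cV} m m' \<and> row n m' aBuf 0 = p"
  then show "ok (Query a (Const 0) aBuf (Const 0)) 1 m'
      (\<lambda>m'. frame {aBuf, cV, a} m m' \<and> row n m' aBuf 0 = p \<and> m' a 0 = of_bool (f p))"
    by (intro ok_Query) (use assms(3) in \<open>auto simp: frame_def row_def\<close>)
qed (use assms in simp_all)

end

locale program = machine +
  fixes s r L :: nat and lab :: "nat \<Rightarrow> nat"
  assumes lab: "\<And>v. v < n \<Longrightarrow> lab v < 2 ^ L"
    and bounds: "L \<le> B" "s \<le> B" "r \<le> B" "r * s \<le> B"
begin

definition params :: "memory \<Rightarrow> bool" where
  "params m \<longleftrightarrow> m 0 0 = n \<and> m 0 1 = s \<and> m 0 2 = r \<and> m aL 0 = L \<and> m aTotal 0 = 2 ^ L \<and>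
     (\<forall>i<L. m aPow i = 2 ^ i) \<and> (\<forall>v<n. m aLab v = lab v) \<and> m aTK 0 = n * (L + 2)"

lemma params_frame:
  "params m \<Longrightarrow> frame A m m' \<Longrightarrow> A \<inter> {0, aL, aPow, aTotal, aLab, aTK} = {} \<Longrightarrow> params m'"
  unfolding params_def frame_def by (auto simp: disjoint_iff)

text \<open>Every stored witness ends below the pointer \<open>aWP\<close>, so a witness written
  from there on leaves the older ones intact.\<close>

definition repr :: "memory \<Rightarrow> nat \<Rightarrow> literal list \<Rightarrow> bool" where
  "repr m nt lits \<longleftrightarrow> m aNT 0 = nt \<and> m aNL 0 = length lits \<and>
     (\<forall>k<length lits. lits ! k = (m aLT k, row n m aW (m aLW k), m aLB k) \<and> m aLW k + n \<le> m aWP 0)"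

lemma repr_frame:
  assumes "repr m nt lits" "frame A m m'" "A \<inter> {aNT, aNL, aLT, aLB, aLW, aW, aWP} = {}"
  shows "repr m' nt lits"
proof -
  have "m' aNT = m aNT" "m' aNL = m aNL" "m' aLT = m aLT" "m' aLB = m aLB" "m' aLW = m aLW"
    "m' aW = m aW" "m' aWP = m aWP" using assms(2,3) by (auto intro!: frameD)
  then show ?thesis using assms(1) by (simp add: repr_def row_def)
qed

abbreviation g :: "literal \<Rightarrow> bool list \<Rightarrow> bool" where "g \<equiv> lit n f lab"

lemma ok_QLit:
  assumes m: "params m" "repr m nt lits" and k: "m cK 0 < length lits" and a: "a \<notin> {aBuf, cV}"
    and y: "y \<in> cube n" and e: "\<And>v m'. v < n \<Longrightarrow> frame {aBuf, cV} m m' \<Longrightarrow> m' cV 0 = v \<Longrightarrow> value_of m' e \<noteq> 0 \<longleftrightarrow> y ! v"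
  shows "ok (QLit a e) 1 m (\<lambda>m'. frame {aBuf, cV, a} m m' \<and> m' a 0 = of_bool (g (lits ! (m cK 0)) y))"
proof -
  let ?l = "lits ! (m cK 0)"
  let ?p = "blend n lab (fst (snd ?l)) (snd (snd ?l)) y"
  have l: "?l = (m aLT (m cK 0), row n m aW (m aLW (m cK 0)), m aLB (m cK 0))"
    using m(2) k by (simp add: repr_def)
  show ?thesis unfolding QLit_def lit_def
  proof (rule ok_weaken[OF ok_QPoint[where p = ?p]])
    show "m 0 0 = n" using m(1) by (simp add: params_def)
    show "length ?p = n" by (simp add: blend_def)
    show "a \<noteq> aBuf" using a by simp
    fix v m' assume v: "v < n" "frame {aBuf, cV} m m'" "m' cV 0 = v"
    have mm: "m' aLab = m aLab" "m' aLB = m aLB" "m' aW = m aW" "m' aLW = m aLW" "m' cK = m cK"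
      using v(2) by (auto intro!: frameD)
    show "(if value_of m' (xorE (Get aLab (sc cV)) (Get aLB (sc cK))) \<noteq> 0
          then value_of m' (Get aW (Plus (Get aLW (sc cK)) (sc cV))) else value_of m' e) \<noteq> 0 \<longleftrightarrow> ?p ! v"
      using v m(1) e[OF v] unfolding l by (auto simp: mm params_def)
  qed auto
qed

definition ready :: "memory \<Rightarrow> nat \<Rightarrow> literal list \<Rightarrow> bool list \<Rightarrow> bool list list \<Rightarrow> bool" where
  "ready m nt lits x ys \<longleftrightarrow> params m \<and> repr m nt lits \<and> bit_row n m aX 0 x \<and>
     length ys = L + 2 \<and> (\<forall>q<L+2. bit_row n m aTape (q * n) (ys ! q))"

lemma ready_frame:
  assumes "ready m nt lits x ys" "frame A m m'"
    "A \<inter> {0, aL, aPow, aTotal, aLab, aTK, aNT, aNL, aLT, aLB, aLW, aW, aWP, aX, aTape} = {}"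
  shows "ready m' nt lits x ys"
proof -
  have "params m'" "repr m' nt lits"
    using assms unfolding ready_def by (auto elim!: params_frame repr_frame)
  moreover have "m' aX = m aX" "m' aTape = m aTape"
    using assms(2,3) by (auto intro!: frameD)
  ultimately show ?thesis using assms(1) by (simp add: ready_def bit_row_def)
qed

context
  fixes nt :: nat and lits :: "literal list" and x :: "bool list" and ys :: "bool list list" and k :: nat
  assumes k: "k < length lits" and L: "L \<ge> 1"
begin

lemma ready_tape:
  assumes "ready m nt lits x ys" "q < L + 2" "v < n"
  shows "m aTape (q * n + v) = of_bool (ys ! q ! v)"
  using assms by (auto simp: ready_def bit_row_def)

lemma ready_cube:
  assumes "ready m nt lits x ys"
  shows "x \<in> cube n" "q < L + 2 \<Longrightarrow> ys ! q \<in> cube n"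
  using assms by (auto simp: ready_def bit_row_def cube_def)

lemma ok_QLit_ready:
  assumes m: "ready m nt lits x ys" and mk: "m cK 0 = k" and a: "a \<notin> {aBuf, cV}" and y: "y \<in> cube n"
    and e: "\<And>v m'. v < n \<Longrightarrow> ready m' nt lits x ys \<Longrightarrow> m' cV 0 = v \<Longrightarrow> m' aUP = m aUP \<Longrightarrow>
      value_of m' e \<noteq> 0 \<longleftrightarrow> y ! v"
  shows "ok (QLit a e) 1 m (\<lambda>m'. frame {aBuf, cV, a} m m' \<and> m' a 0 = of_bool (g (lits ! k) y))"
proof -
  have "ok (QLit a e) 1 m (\<lambda>m'. frame {aBuf, cV, a} m m' \<and> m' a 0 = of_bool (g (lits ! (m cK 0)) y))"
  proof (rule ok_QLit)
    show "params m" "repr m nt lits" using m by (simp_all add: ready_def)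
    fix v m' assume "v < n" "frame {aBuf, cV} m m'" "m' cV 0 = v"
    then show "value_of m' e \<noteq> 0 \<longleftrightarrow> y ! v"
      by (intro e ready_frame[OF m]) (auto intro: frameD)
  qed (use mk k a y in auto)
  then show ?thesis using mk by simp
qed

lemma ok_Correct:
  assumes m: "ready m nt lits x ys" and mk: "m cK 0 = k" and sum: "m aSum 0 = 0" and up: "m aUP 0 = 2 * n"
  shows "ok Correct (2 * L) m (\<lambda>m'. frame {aBuf, cV, aU, aV, aSum, aUP, cQ} m m' \<and>
     m' aSum 0 = card {q. q < L \<and> (g (lits ! k) (ys ! (q + 2)) \<noteq> g (lits ! k) (vxor (ys ! (q + 2)) x))})"
proof -
  let ?A = "{aBuf, cV, aU, aV, aSum, aUP, cQ}"
  let ?P = "\<lambda>q. g (lits ! k) (ys ! (q + 2)) \<noteq> g (lits ! k) (vxor (ys ! (q + 2)) x)"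
  let ?I = "\<lambda>i m'. frame ?A m m' \<and> m' aSum 0 = card {q. q < i \<and> ?P q} \<and> m' aUP 0 = (i + 2) * n"
  have xc: "x \<in> cube n" and yc: "\<And>q. q < L \<Longrightarrow> ys ! (q + 2) \<in> cube n"
    using ready_cube[OF m] by auto
  have "ok Correct (L * 2) m (\<lambda>m'. frame ?A m m' \<and> m' aSum 0 = card {q. q < L \<and> ?P q})"
    unfolding Correct_def
  proof (rule ok_For[where I = ?I])
    show "L \<le> B" by (rule bounds)
    show "?I 0 (m(cQ := (m cQ)(0 := 0)))" using sum up by simp
    fix i m1 assume I: "?I i m1" and c: "m1 cQ 0 = i"
    have r1: "ready m1 nt lits x ys" using I by (intro ready_frame[OF m]) auto
    then show "value_of m1 (sc aL) = L" by (simp add: ready_def params_def)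
    have k1: "m1 cK 0 = k" using frameD[of ?A m m1 cK] I mk by simp
    assume i: "i < L"
    let ?u = "ys ! (i + 2)"
    show "ok (QLit aU row_u ;; QLit aV (xorE row_u (Get aX (sc cV))) ;;
        setc aSum (Plus (sc aSum) (xorE (sc aU) (sc aV))) ;; setc aUP (Plus (sc aUP) in_n)) 2 m1
      (\<lambda>m''. m'' cQ 0 = i \<and> ?I (Suc i) (m''(cQ := (m'' cQ)(0 := Suc i))))"
    proof (rule ok_SeqI[OF ok_QLit_ready[where y = ?u]])
      show "ready m1 nt lits x ys" "m1 cK 0 = k" "?u \<in> cube n" by (fact r1, fact k1, fact yc[OF i])
      fix v m' assume v: "v < n" "ready m' nt lits x ys" "m' cV 0 = v" "m' aUP = m1 aUP"
      show "value_of m' row_u \<noteq> 0 \<longleftrightarrow> ?u ! v"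
        using ready_tape[OF v(2), of "i + 2" v] v I i by simp
    next
      fix m2 assume m2: "frame {aBuf, cV, aU} m1 m2 \<and> m2 aU 0 = of_bool (g (lits ! k) ?u)"
      have r2: "ready m2 nt lits x ys" using m2 by (intro ready_frame[OF r1]) auto
      show "ok (QLit aV (xorE row_u (Get aX (sc cV))) ;;
          setc aSum (Plus (sc aSum) (xorE (sc aU) (sc aV))) ;; setc aUP (Plus (sc aUP) in_n)) 1 m2
        (\<lambda>m''. m'' cQ 0 = i \<and> ?I (Suc i) (m''(cQ := (m'' cQ)(0 := Suc i))))"
      proof (rule ok_SeqI[OF ok_QLit_ready[where y = "vxor ?u x"]])
        show "ready m2 nt lits x ys" by (fact r2)
        show "m2 cK 0 = k" using m2 k1 frameD[of _ m1 m2 cK] by auto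
        show "vxor ?u x \<in> cube n" using yc[OF i] xc by simp
        fix v m' assume v: "v < n" "ready m' nt lits x ys" "m' cV 0 = v" "m' aUP = m2 aUP"
        have "m' aTape (m' aUP 0 + v) = of_bool (?u ! v)"
          using ready_tape[OF v(2), of "i + 2" v] v I i m2 frameD[of _ m1 m2 aUP] by auto
        moreover have "m' aX v = of_bool (x ! v)" using v by (simp add: ready_def bit_row_def)
        ultimately show "value_of m' (xorE row_u (Get aX (sc cV))) \<noteq> 0 \<longleftrightarrow> vxor ?u x ! v"
          using v yc[OF i] xc by (auto simp: cube_def)
      next
        fix m3 assume m3: "frame {aBuf, cV, aV} m2 m3 \<and> m3 aV 0 = of_bool (g (lits ! k) (vxor ?u x))"
        have eqs: "m3 aU = m2 aU" "m3 aSum = m1 aSum" "m3 aUP = m1 aUP" "m3 cQ = m1 cQ" "m3 0 = m1 0"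
          using m2 m3 by (auto simp: frame_def)
        have fr: "frame ?A m m3" using I m2 m3 by (auto simp: frame_def)
        have "{q. q < Suc i \<and> ?P q} = (if ?P i then insert i {q. q < i \<and> ?P q} else {q. q < i \<and> ?P q})"
          by (auto simp: less_Suc_eq)
        then have card: "card {q. q < Suc i \<and> ?P q} = card {q. q < i \<and> ?P q} + of_bool (?P i)"
          by simp
        have n0: "m1 0 0 = n" using r1 by (simp add: ready_def params_def)
        show "ok (setc aSum (Plus (sc aSum) (xorE (sc aU) (sc aV))) ;; setc aUP (Plus (sc aUP) in_n)) 0 m3
          (\<lambda>m''. m'' cQ 0 = i \<and> ?I (Suc i) (m''(cQ := (m'' cQ)(0 := Suc i))))"
          by (rule ok_Put_Seq, rule ok_Put) (use fr eqs m2 m3 I c card n0 in \<open>auto simp: algebra_simps\<close>)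
      qed (simp_all)
    qed simp_all
  next
    fix m' assume "?I L m'"
    then show "frame ?A m m' \<and> m' aSum 0 = card {q. q < L \<and> ?P q}" by simp
  qed
  then show ?thesis by (simp add: mult.commute)
qed

end

end

context program
begin

abbreviation litW :: "nat set" where
  "litW \<equiv> {aBuf, cV, aG1, aG2, aG3, aG4, aG5, aU, aV, aSum, aUP, cQ, aRej, aTV}"

abbreviation evalW :: "nat set" where
  "evalW \<equiv> insert aH (insert aFx (insert cJ (insert cK litW)))"

text \<open>The machine keeps only the number of votes for 1; the extreme counts 0 and
  \<open>L\<close> are exactly the unanimous ones.\<close>

lemma Sum_consistent:
  fixes h :: "bool list \<Rightarrow> bool" and x :: "bool list" and ys :: "bool list list"
  assumes "length ys = L + 2"
  defines "S \<equiv> {q. q < L \<and> (h (ys ! (q + 2)) \<noteq> h (vxor (ys ! (q + 2)) x))}"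
  shows "card S = 0 \<longleftrightarrow> \<not> corrected h (drop 2 ys) x"
    and "consistent h (drop 2 ys) x \<longleftrightarrow> card S = 0 \<or> card S = L"
proof -
  have fin: "finite S" "S \<subseteq> {..<L}" by (auto simp: S_def)
  have set: "set (drop 2 ys) = (\<lambda>q. ys ! (q + 2)) ` {..<L}"
  proof -
    have "set (drop 2 ys) = (\<lambda>q. drop 2 ys ! q) ` {..<L}"
      using assms(1) by (auto simp: set_conv_nth image_iff)
    also have "\<dots> = (\<lambda>q. ys ! (q + 2)) ` {..<L}"
      using assms(1) by (intro image_cong) (auto simp: add.commute)
    finally show ?thesis .
  qed
  have cor: "corrected h (drop 2 ys) x \<longleftrightarrow> S \<noteq> {}"
    unfolding corrected_def set by (auto simp: S_def)
  then show "card S = 0 \<longleftrightarrow> \<not> corrected h (drop 2 ys) x" using fin by simp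
  have "card S = L \<longleftrightarrow> S = {..<L}"
    using card_subset_eq[OF _ fin(2)] by auto
  moreover have "consistent h (drop 2 ys) x \<longleftrightarrow> S = {} \<or> S = {..<L}"
    unfolding consistent_def cor set by (auto simp: S_def)
  ultimately show "consistent h (drop 2 ys) x \<longleftrightarrow> card S = 0 \<or> card S = L" using fin by simp
qed

lemma ok_Literal:
  assumes k: "k < length lits" and L: "L \<ge> 1" and m: "ready m nt lits x ys" and mk: "m cK 0 = k"
  shows "ok Literal (2 * L + 5) m (\<lambda>m'. frame litW m m' \<and>
    (m' aRej 0 \<noteq> 0 \<longleftrightarrow> m aRej 0 \<noteq> 0 \<or> \<not> lit_passes (g (lits ! k)) ys x) \<and>
    m' aTV = (if corrected (g (lits ! k)) (drop 2 ys) x then m aTV else (m aTV)(fst (lits ! k) := 0)))"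
proof -
  let ?h = "g (lits ! k)"
  let ?y = "ys ! 0" and ?z = "ys ! 1" and ?u = "ys ! 2"
  \<comment> \<open>\<open>R\<close> collects what the five test queries preserve, so that only
    their answers are threaded through the sequence.\<close>
  define R where "R m' \<longleftrightarrow> frame litW m m' \<and> ready m' nt lits x ys \<and> m' cK 0 = k \<and>
    m' aRej = m aRej \<and> m' aTV = m aTV" for m'
  have len: "length ys = L + 2" using m by (simp add: ready_def)
  have cube: "x \<in> cube n" "?y \<in> cube n" "?z \<in> cube n" "?u \<in> cube n"
    using ready_cube[OF k L m] L by auto
  have R0: "R m" using m mk by (simp add: R_def)
  have keep: "R m''" if "R m'" "frame {aBuf, cV, a} m' m''" "a \<in> {aG1, aG2, aG3, aG4, aG5}" for m' m'' a
    unfolding R_def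
  proof (intro conjI)
    have *: "frame litW m m'" "ready m' nt lits x ys" using that(1) by (simp_all add: R_def)
    show "frame litW m m''" by (rule frame_trans[OF *(1) that(2)]) (use that(3) in auto)
    show "ready m'' nt lits x ys" by (rule ready_frame[OF *(2) that(2)]) (use that(3) in auto)
    have "m'' cK = m' cK" "m'' aRej = m' aRej" "m'' aTV = m' aTV"
      using that(2,3) by (auto intro!: frameD[OF that(2)])
    then show "m'' cK 0 = k" "m'' aRej = m aRej" "m'' aTV = m aTV" using that(1) by (auto simp: R_def)
  qed
  have rows: "m'' aTape v = of_bool (?y ! v)" "m'' aTape (n + v) = of_bool (?z ! v)"
    "m'' aTape (n + n + v) = of_bool (?u ! v)" "m'' 0 0 = n"
    if "v < n" "ready m'' nt lits x ys" for v m''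
    using ready_tape[OF k L that(2), of 0 v] ready_tape[OF k L that(2), of 1 v]
      ready_tape[OF k L that(2), of 2 v] L that by (auto simp: mult_2 ready_def params_def)
  have step: "ok (QLit a e) 1 m' (\<lambda>m''. R m'' \<and> frame {aBuf, cV, a} m' m'' \<and> m'' a 0 = of_bool (?h w))"
    if "R m'" "a \<in> {aG1, aG2, aG3, aG4, aG5}" "w \<in> cube n"
      "\<And>v m''. v < n \<Longrightarrow> m'' cV 0 = v \<Longrightarrow> m'' aTape v = of_bool (?y ! v) \<Longrightarrow>
        m'' aTape (n + v) = of_bool (?z ! v) \<Longrightarrow> m'' aTape (n + n + v) = of_bool (?u ! v) \<Longrightarrow>
        m'' 0 0 = n \<Longrightarrow> value_of m'' e \<noteq> 0 \<longleftrightarrow> w ! v"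
    for a e m' w
  proof (rule ok_weaken[OF ok_QLit_ready[OF k L, where y = w]])
    show "ready m' nt lits x ys" "m' cK 0 = k" using that(1) by (simp_all add: R_def)
    fix v m'' assume v: "v < n" and r: "ready m'' nt lits x ys" and c: "m'' cV 0 = v"
    show "value_of m'' e \<noteq> 0 \<longleftrightarrow> w ! v" by (rule that(4)[OF v c rows[OF v r]])
  qed (use that keep[OF that(1) _ that(2)] in auto)
  note len_cube = cube[unfolded cube_def, simplified]
  have 1: "ok (QLit aG1 row_y) 1 m (\<lambda>m'. R m' \<and> m' aG1 0 = of_bool (?h ?y))"
    by (rule ok_weaken[OF step[OF R0, where w = ?y]]) (use cube in auto)
  have 2: "ok (QLit aG2 row_z) 1 m' (\<lambda>m'. R m' \<and> m' aG1 0 = of_bool (?h ?y) \<and> m' aG2 0 = of_bool (?h ?z))"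
    if "R m' \<and> m' aG1 0 = of_bool (?h ?y)" for m'
    by (rule ok_weaken[OF step[where w = ?z]]) (use that cube in \<open>auto simp: frameD\<close>)
  have 3: "ok (QLit aG3 (xorE row_y row_z)) 1 m' (\<lambda>m'. R m' \<and> m' aG1 0 = of_bool (?h ?y) \<and>
      m' aG2 0 = of_bool (?h ?z) \<and> m' aG3 0 = of_bool (?h (vxor ?y ?z)))"
    if "R m' \<and> m' aG1 0 = of_bool (?h ?y) \<and> m' aG2 0 = of_bool (?h ?z)" for m'
    by (rule ok_weaken[OF step[where w = "vxor ?y ?z"]])
       (use that cube len_cube in \<open>auto simp: frameD\<close>)
  have 4: "ok (QLit aG4 row_u0) 1 m' (\<lambda>m'. R m' \<and> m' aG1 0 = of_bool (?h ?y) \<and>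
      m' aG2 0 = of_bool (?h ?z) \<and> m' aG3 0 = of_bool (?h (vxor ?y ?z)) \<and> m' aG4 0 = of_bool (?h ?u))"
    if "R m' \<and> m' aG1 0 = of_bool (?h ?y) \<and> m' aG2 0 = of_bool (?h ?z) \<and>
      m' aG3 0 = of_bool (?h (vxor ?y ?z))" for m'
    by (rule ok_weaken[OF step[where w = ?u]]) (use that cube in \<open>auto simp: frameD add.assoc\<close>)
  define R5 where "R5 m' \<longleftrightarrow> R m' \<and> m' aG1 0 = of_bool (?h ?y) \<and>
      m' aG2 0 = of_bool (?h ?z) \<and> m' aG3 0 = of_bool (?h (vxor ?y ?z)) \<and> m' aG4 0 = of_bool (?h ?u) \<and>
      m' aG5 0 = of_bool (?h (vxor ?u (vand ?y ?z)))" for m'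
  have 5: "ok (QLit aG5 (xorE row_u0 (andE row_y row_z))) 1 m' R5"
    if "R m' \<and> m' aG1 0 = of_bool (?h ?y) \<and> m' aG2 0 = of_bool (?h ?z) \<and>
      m' aG3 0 = of_bool (?h (vxor ?y ?z)) \<and> m' aG4 0 = of_bool (?h ?u)" for m'
    by (rule ok_weaken[OF step[where w = "vxor ?u (vand ?y ?z)"]])
       (use that cube len_cube in \<open>auto simp: frameD add.assoc R5_def\<close>)
  define P where "P m' \<longleftrightarrow> frame litW m m' \<and>
    (m' aRej 0 \<noteq> 0 \<longleftrightarrow> m aRej 0 \<noteq> 0 \<or> \<not> lit_passes ?h ys x) \<and>
    m' aTV = (if corrected ?h (drop 2 ys) x then m aTV else (m aTV)(fst (lits ! k) := 0))" for m'
  let ?S = "card {q. q < L \<and> (?h (ys ! (q + 2)) \<noteq> ?h (vxor (ys ! (q + 2)) x))}"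
  have fin: "ok (If (xorE (xorE (sc aG1) (sc aG2)) (sc aG3)) (setc aRej (Const 1)) Skip ;;
     If (xorE (andE (sc aG1) (sc aG2)) (xorE (sc aG4) (sc aG5))) (setc aRej (Const 1)) Skip ;;
     If (sc aSum) (If (Minus (sc aL) (sc aSum)) (setc aRej (Const 1)) Skip)
       (Put aTV (Get aLT (sc cK)) (Const 0))) 0 m' P"
    if m': "R5 m' \<and> m' aSum 0 = ?S" for m'
  proof -
    have mL: "m' aL 0 = L" and fr: "frame litW m m'" and cK: "m' cK 0 = k"
      and lt: "m' aLT k = fst (lits ! k)" and eqs: "m' aRej = m aRej" "m' aTV = m aTV"
      using m' k by (auto simp: R5_def R_def ready_def params_def repr_def)
    have le: "?S \<le> L"
      using card_mono[of "{..<L}" "{q. q < L \<and> (?h (ys ! (q + 2)) \<noteq> ?h (vxor (ys ! (q + 2)) x))}"] by auto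
    define b1 :: nat where "b1 = of_bool (\<not> ((?h ?y \<noteq> ?h ?z) = ?h (vxor ?y ?z)))"
    define b2 :: nat where "b2 = of_bool (\<not> ((?h ?y \<and> ?h ?z) = (?h ?u \<noteq> ?h (vxor ?u (vand ?y ?z)))))"
    have b1: "value_of m' (xorE (xorE (sc aG1) (sc aG2)) (sc aG3)) = b1"
      using m' by (simp add: R5_def b1_def)
    have b2: "value_of m' (xorE (andE (sc aG1) (sc aG2)) (xorE (sc aG4) (sc aG5))) = b2"
      using m' by (simp add: R5_def b2_def)
    have pass: "lit_passes ?h ys x \<longleftrightarrow> b1 = 0 \<and> b2 = 0 \<and> (?S = 0 \<or> ?S = L)"
      unfolding lit_passes_def literal_test_def Sum_consistent(2)[OF len] b1_def b2_def by auto
    have cor: "corrected ?h (drop 2 ys) x \<longleftrightarrow> ?S \<noteq> 0" using Sum_consistent(1)[OF len, of ?h x] by auto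
    have s1: "ok (If (xorE (xorE (sc aG1) (sc aG2)) (sc aG3)) (setc aRej (Const 1)) Skip) 0 m'
        (\<lambda>m2. m2 = (if b1 \<noteq> 0 then m'(aRej := (m' aRej)(0 := 1)) else m'))"
      by (rule ok_If; (rule ok_Put | rule ok_Skip)) (use b1 in auto)
    have s2: "ok (If (xorE (andE (sc aG1) (sc aG2)) (xorE (sc aG4) (sc aG5))) (setc aRej (Const 1)) Skip) 0 m2
        (\<lambda>m3. m3 = (if b1 \<noteq> 0 \<or> b2 \<noteq> 0 then m'(aRej := (m' aRej)(0 := 1)) else m'))"
      if "m2 = (if b1 \<noteq> 0 then m'(aRej := (m' aRej)(0 := 1)) else m')" for m2
      by (rule ok_If; (rule ok_Put | rule ok_Skip)) (use b2 that in \<open>auto split: if_splits\<close>)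
    have s3: "ok (If (sc aSum) (If (Minus (sc aL) (sc aSum)) (setc aRej (Const 1)) Skip)
       (Put aTV (Get aLT (sc cK)) (Const 0))) 0 m3 P"
      if m3: "m3 = (if b1 \<noteq> 0 \<or> b2 \<noteq> 0 then m'(aRej := (m' aRej)(0 := 1)) else m')" for m3
    proof -
      have v: "m3 aSum 0 = ?S" "m3 aL 0 = L" "m3 aLT (m3 cK 0) = fst (lits ! k)" "frame litW m m3" "m3 aTV = m aTV"
        "m3 aRej 0 \<noteq> 0 \<longleftrightarrow> m aRej 0 \<noteq> 0 \<or> b1 \<noteq> 0 \<or> b2 \<noteq> 0"
        using m' m3 mL cK lt fr eqs by auto
      show ?thesis
      proof (rule ok_If)
        assume "value_of m3 (sc aSum) \<noteq> 0"
        then have S: "?S \<noteq> 0" using v by simp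
        show "ok (If (Minus (sc aL) (sc aSum)) (setc aRej (Const 1)) Skip) 0 m3 P"
          by (rule ok_If; (rule ok_Put | rule ok_Skip))
             (use v S le pass cor in \<open>auto simp: P_def\<close>)
      next
        assume "value_of m3 (sc aSum) = 0"
        then have S: "?S = 0" using v by simp
        show "ok (Put aTV (Get aLT (sc cK)) (Const 0)) 0 m3 P"
          by (rule ok_Put) (use v S pass cor in \<open>auto simp: P_def\<close>)
      qed
    qed
    show ?thesis by (rule ok_SeqI[OF s1 ok_SeqI[OF s2 s3]]) (assumption | simp)+
  qed
  have cor: "ok Correct (2 * L) m1 (\<lambda>m'. R5 m' \<and> m' aSum 0 = ?S)"
    if m1: "R5 m'" "m1 = m'(aSum := (m' aSum)(0 := 0), aUP := (m' aUP)(0 := n + n))" for m' m1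
  proof -
    have r1: "ready m1 nt lits x ys"
      by (rule ready_frame[where A = "{aSum, aUP}" and m = m']) (use m1 in \<open>auto simp: R5_def R_def\<close>)
    have "ok Correct (2 * L) m1 (\<lambda>m'. frame {aBuf, cV, aU, aV, aSum, aUP, cQ} m1 m' \<and> m' aSum 0 = ?S)"
      by (rule ok_Correct[OF k L r1]) (use m1 in \<open>auto simp: R5_def R_def\<close>)
    then show ?thesis
    proof (rule ok_weaken)
      fix m2 assume m2: "frame {aBuf, cV, aU, aV, aSum, aUP, cQ} m1 m2 \<and> m2 aSum 0 = ?S"
      have r2: "ready m2 nt lits x ys" by (rule ready_frame[OF r1]) (use m2 in auto)
      have "frame litW m m1" using m1 by (auto simp: R5_def R_def)
      then have "frame litW m m2" using m2 by (auto simp: frame_def)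
      moreover have "m2 cK = m1 cK" "m2 aRej = m1 aRej" "m2 aTV = m1 aTV" "m2 aG1 = m1 aG1"
        "m2 aG2 = m1 aG2" "m2 aG3 = m1 aG3" "m2 aG4 = m1 aG4" "m2 aG5 = m1 aG5"
        using m2 by (auto simp: frame_def)
      ultimately show "R5 m2 \<and> m2 aSum 0 = ?S" using m1 m2 r2 by (simp add: R5_def R_def)
    qed simp
  qed
  have mid: "ok (setc aSum (Const 0) ;; setc aUP (Plus in_n in_n) ;; Correct ;;
     If (xorE (xorE (sc aG1) (sc aG2)) (sc aG3)) (setc aRej (Const 1)) Skip ;;
     If (xorE (andE (sc aG1) (sc aG2)) (xorE (sc aG4) (sc aG5))) (setc aRej (Const 1)) Skip ;;
     If (sc aSum) (If (Minus (sc aL) (sc aSum)) (setc aRej (Const 1)) Skip)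
       (Put aTV (Get aLT (sc cK)) (Const 0))) (2 * L) m' P" if m': "R5 m'" for m'
  proof -
    have n0: "m' 0 0 = n" using m' by (simp add: R5_def R_def ready_def params_def)
    show ?thesis
      by (rule ok_Put_Seq, rule ok_Put_Seq, rule ok_SeqI[OF cor[OF m'] fin]) (use n0 in auto)
  qed
  have "ok Literal (1 + (1 + (1 + (1 + (1 + 2 * L))))) m P"
    unfolding Literal_def
    by (rule ok_SeqI[OF 1 ok_SeqI[OF 2 ok_SeqI[OF 3 ok_SeqI[OF 4 ok_SeqI[OF 5 mid]]]]]; (assumption | rule refl))
  then show ?thesis unfolding P_def by (rule ok_weaken) (assumption | simp)+
qed

lemma ok_Evaluate:
  assumes L: "L \<ge> 1" and m: "ready m nt lits x ys" and rej: "m aRej 0 = 0"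
    and le: "nt \<le> s" "length lits \<le> r * s"
  shows "ok Evaluate (r * s * (2 * L + 5) + 1) m (\<lambda>m'. frame evalW m m' \<and>
    (m' aRej 0 = 0 \<longleftrightarrow> (\<forall>l\<in>set lits. lit_passes (g l) ys x)) \<and>
    (m' aH 0 \<noteq> 0 \<longleftrightarrow> hyp_value g nt lits ys x) \<and> (m' aFx 0 \<noteq> 0 \<longleftrightarrow> f x))"
proof -
  have nt: "nt \<le> B" and nl: "length lits \<le> B" using le bounds by linarith+
  let ?c = "\<lambda>l. corrected (g l) (drop 2 ys) x"
  have rdy: "ready m' nt lits x ys" if "frame evalW m m'" for m'
    by (rule ready_frame[OF m that]) auto
  have vals: "m' aNT 0 = nt" "m' aNL 0 = length lits" if "ready m' nt lits x ys" for m'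
    using that by (auto simp: ready_def repr_def)
  define Q1 where "Q1 m' \<longleftrightarrow> frame evalW m m' \<and> m' aRej 0 = 0 \<and> (\<forall>j<nt. m' aTV j \<noteq> 0)" for m'
  have 1: "ok (For cJ (sc aNT) (Put aTV (sc cJ) (Const 1))) (nt * 0) m Q1"
  proof (rule ok_For[where I = "\<lambda>i m'. frame evalW m m' \<and> m' aRej 0 = 0 \<and> (\<forall>j<i. m' aTV j \<noteq> 0)"])
    fix i m' assume I: "frame evalW m m' \<and> m' aRej 0 = 0 \<and> (\<forall>j<i. m' aTV j \<noteq> 0)" "m' cJ 0 = i"
    show "value_of m' (sc aNT) = nt" using vals[OF rdy[of m']] I by simp
    show "ok (Put aTV (sc cJ) (Const 1)) 0 m' (\<lambda>m''. m'' cJ 0 = i \<and>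
        (frame evalW m (m''(cJ := (m'' cJ)(0 := Suc i))) \<and> (m''(cJ := (m'' cJ)(0 := Suc i))) aRej 0 = 0 \<and>
          (\<forall>j<Suc i. (m''(cJ := (m'' cJ)(0 := Suc i))) aTV j \<noteq> 0)))"
      by (rule ok_Put) (use I in auto)
  qed (use nt rej in \<open>auto simp: Q1_def\<close>)
  define I2 where "I2 i m' \<longleftrightarrow> frame evalW m m' \<and> (m' aRej 0 = 0 \<longleftrightarrow> (\<forall>k<i. lit_passes (g (lits ! k)) ys x)) \<and>
    (\<forall>j<nt. m' aTV j \<noteq> 0 \<longleftrightarrow> (\<forall>k<i. fst (lits ! k) = j \<longrightarrow> ?c (lits ! k)))" for i m'
  have 2: "ok (For cK (sc aNL) Literal) (length lits * (2 * L + 5)) m1 (I2 (length lits))" if m1: "Q1 m1" for m1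
  proof (rule ok_For[where I = I2])
    show "I2 0 (m1(cK := (m1 cK)(0 := 0)))" using m1 by (auto simp: I2_def Q1_def)
    show "length lits \<le> B" by (rule nl)
    fix i m' assume I: "I2 i m'" "m' cK 0 = i"
    then have r: "ready m' nt lits x ys" by (auto simp: I2_def rdy)
    show "value_of m' (sc aNL) = length lits" using vals[OF r] by simp
    assume i: "i < length lits"
    show "ok Literal (2 * L + 5) m' (\<lambda>m''. m'' cK 0 = i \<and> I2 (Suc i) (m''(cK := (m'' cK)(0 := Suc i))))"
    proof (rule ok_weaken[OF ok_Literal[OF i L r I(2)]])
      fix m2 assume m2: "frame litW m' m2 \<and>
        (m2 aRej 0 \<noteq> 0 \<longleftrightarrow> m' aRej 0 \<noteq> 0 \<or> \<not> lit_passes (g (lits ! i)) ys x) \<and>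
        m2 aTV = (if ?c (lits ! i) then m' aTV else (m' aTV)(fst (lits ! i) := 0))"
      have "frame evalW m m2" using I m2 unfolding I2_def by (auto simp: frame_def)
      moreover have "m2 cK = m' cK" using m2 by (auto simp: frame_def)
      moreover have "m2 aRej 0 = 0 \<longleftrightarrow> (\<forall>k<Suc i. lit_passes (g (lits ! k)) ys x)"
        using I m2 by (auto simp: I2_def less_Suc_eq)
      moreover have "m2 aTV j \<noteq> 0 \<longleftrightarrow> (\<forall>k<Suc i. fst (lits ! k) = j \<longrightarrow> ?c (lits ! k))" if "j < nt" for j
        using I m2 that by (auto simp: I2_def less_Suc_eq)
      ultimately show "m2 cK 0 = i \<and> I2 (Suc i) (m2(cK := (m2 cK)(0 := Suc i)))"
        using I by (simp add: I2_def)
    qed simp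
  qed
  have passes: "(\<forall>k<length lits. lit_passes (g (lits ! k)) ys x) \<longleftrightarrow> (\<forall>l\<in>set lits. lit_passes (g l) ys x)"
    by (auto simp: all_set_conv_all_nth)
  have trm: "(\<forall>k<length lits. fst (lits ! k) = j \<longrightarrow> ?c (lits ! k)) \<longleftrightarrow> (\<forall>l\<in>set lits. fst l = j \<longrightarrow> ?c l)" for j
    by (auto simp: all_set_conv_all_nth)
  define I3 where "I3 i m' \<longleftrightarrow> I2 (length lits) m' \<and> (m' aH 0 \<noteq> 0 \<longleftrightarrow> (\<exists>j<i. m' aTV j \<noteq> 0))" for i m'
  have I2_upd: "I2 i (m'(a := w)) = I2 i m'" if "a \<in> {aH, cJ}" for i m' a w
    using that by (auto simp: I2_def)
  have 3: "ok (For cJ (sc aNT) (If (Get aTV (sc cJ)) (setc aH (Const 1)) Skip)) (nt * 0) m2 (I3 nt)"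
    if m2: "I2 (length lits) m2" "m2 aH 0 = 0" for m2
  proof (rule ok_For[where I = I3])
    show "I3 0 (m2(cJ := (m2 cJ)(0 := 0)))" using m2 by (simp add: I3_def I2_upd)
    show "nt \<le> B" by (rule nt)
    fix i m' assume I: "I3 i m'" "m' cJ 0 = i"
    then show "value_of m' (sc aNT) = nt" using vals[OF rdy[of m']] by (simp add: I3_def I2_def)
    assume "i < nt"
    show "ok (If (Get aTV (sc cJ)) (setc aH (Const 1)) Skip) 0 m'
        (\<lambda>m''. m'' cJ 0 = i \<and> I3 (Suc i) (m''(cJ := (m'' cJ)(0 := Suc i))))"
      by (rule ok_If; (rule ok_Put | rule ok_Skip)) (use I in \<open>auto simp: I3_def I2_upd less_Suc_eq\<close>)
  qed
  define P where "P m' \<longleftrightarrow> frame evalW m m' \<and>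
    (m' aRej 0 = 0 \<longleftrightarrow> (\<forall>l\<in>set lits. lit_passes (g l) ys x)) \<and>
    (m' aH 0 \<noteq> 0 \<longleftrightarrow> hyp_value g nt lits ys x) \<and> (m' aFx 0 \<noteq> 0 \<longleftrightarrow> f x)" for m'
  have 4: "ok (Query aFx (Const 0) aX (Const 0)) 1 m3 P" if m3: "I3 nt m3" for m3
  proof (rule ok_Query)
    have fr: "frame evalW m m3" using m3 by (simp add: I3_def I2_def)
    then have "bit_row n m3 aX 0 x" using rdy[of m3] by (simp add: ready_def)
    then have "row n m3 aX 0 = x" by (auto simp: bit_row_def row_def intro: nth_equalityI)
    then show "P (m3(aFx := (m3 aFx)(value_of m3 (Const 0) := of_bool (f (row n m3 aX (value_of m3 (Const 0)))))))"
      using m3 fr by (auto simp: P_def I3_def I2_def passes trm hyp_value_def)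
  qed
  have "ok Evaluate (nt * 0 + (length lits * (2 * L + 5) + (nt * 0 + 1))) m P"
    unfolding Evaluate_def
  proof (rule ok_SeqI[OF 1 ok_SeqI[OF 2]])
    fix m2 assume "I2 (length lits) m2"
    then show "ok (setc aH (Const 0) ;; For cJ (sc aNT) (If (Get aTV (sc cJ)) (setc aH (Const 1)) Skip) ;;
      Query aFx (Const 0) aX (Const 0)) (nt * 0 + 1) m2 P"
      by (intro ok_Put_Seq ok_SeqI[OF 3 4]) (auto simp: I2_upd)
  qed auto
  then have "ok Evaluate (r * s * (2 * L + 5) + 1) m P"
    by (rule ok_weaken) (use le in \<open>auto intro: mult_right_mono\<close>)
  then show ?thesis unfolding P_def .
qed

end


subsection \<open>The program: finding a new term\<close>

text \<open>The truncated difference \<open>lab + 1 - e\<close> is nonzero iff the label is at least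
  \<open>e\<close>. So the sample is restricted to the chosen blocks and those from threshold
  \<open>e\<close> on; with \<open>e = 2 ^ L\<close> only the chosen blocks remain.\<close>

definition FQ :: "expr \<Rightarrow> com" where
  "FQ e = QPoint aRes (Plus (Get aCh (sc cV)) (Minus (Plus (Get aLab (sc cV)) (Const 1)) e))
     (Get aX (sc cV)) (Const 0)"

text \<open>The threshold is built from its highest bit down, a bit being kept iff \<open>f\<close>
  stays true; the powers come from the table \<open>aPow\<close>.\<close>

definition Search :: com where
  "Search = setc aLo (Const 0) ;; For cL (sc aL)
     (setc aP (Plus (sc aLo) (Get aPow (Minus (Minus (sc aL) (Const 1)) (sc cL)))) ;;
      FQ (sc aP) ;; If (sc aRes) (setc aLo (sc aP)) Skip)"

definition Mark :: com where
  "Mark = For cV in_n (If (xorE (Get aLab (sc cV)) (sc aLo)) Skip (Put aCh (sc cV) (Const 1)))"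

text \<open>Literals are written beyond the current end \<open>aNL\<close> and point to the witness
  cell \<open>aWP\<close>, which is still empty: the common witness is known only when all blocks
  are. \<open>Commit\<close> makes them part of the hypothesis.\<close>

definition Add_Block :: com where
  "Add_Block = Search ;; Mark ;; Put aLB (Plus (sc aNL) (sc aNB)) (sc aLo) ;;
     Put aLT (Plus (sc aNL) (sc aNB)) (sc aNT) ;; Put aLW (Plus (sc aNL) (sc aNB)) (sc aWP) ;;
     setc aNB (Plus (sc aNB) (Const 1))"

text \<open>The last query decides between commitment and rejection and also leaves the cut-down
  sample in \<open>aBuf\<close>, from where \<open>Commit\<close> copies the witness.\<close>

definition Blocks :: com where
  "Blocks = For cV in_n (Put aCh (sc cV) (Const 0)) ;; setc aNB (Const 0) ;;
     For cI in_r (FQ (sc aTotal) ;; If (sc aRes) Skip Add_Block) ;; FQ (sc aTotal)"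

definition Commit :: com where
  "Commit = For cV in_n (Put aW (Plus (sc aWP) (sc cV)) (Get aBuf (sc cV))) ;;
     setc aNL (Plus (sc aNL) (sc aNB)) ;; setc aNT (Plus (sc aNT) (Const 1)) ;;
     setc aWP (Plus (sc aWP) in_n)"

definition Step :: com where
  "Step = Evaluate ;; If (sc aRej) Skip (If (sc aFx)
     (If (sc aH) Skip (If (Minus in_s (sc aNT))
       (Blocks ;; If (sc aRes) Commit (setc aRej (Const 1))) (setc aRej (Const 1))))
     (If (sc aH) (setc aRej (Const 1)) Skip))"

lemma restr_all: "x \<in> cube n \<Longrightarrow> restr n lab x (S \<union> {0..}) = x"
  by (intro cube_eqI[of _ n]) auto

context program
begin

text \<open>All labels are below \<open>2 ^ L\<close>, so this threshold admits no further block; it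
  is the upper end of the binary search.\<close>

lemma restr_none: "restr n lab x (S \<union> {2 ^ L..}) = restr n lab x S"
proof (rule cube_eqI[of _ n])
  fix v assume "v < n"
  with lab[OF this] show "restr n lab x (S \<union> {2 ^ L..}) ! v = restr n lab x S ! v" by auto
qed simp_all

abbreviation searchW :: "nat set" where "searchW \<equiv> {aBuf, cV, aRes, aLo, aP, cL}"

abbreviation blockW :: "nat set" where
  "blockW \<equiv> searchW \<union> {aCh, aNB, aLB, aLT, aLW, cI}"

definition chosen :: "memory \<Rightarrow> nat list \<Rightarrow> bool" where
  "chosen m bs \<longleftrightarrow> (\<forall>v<n. m aCh v \<noteq> 0 \<longleftrightarrow> lab v \<in> set bs)"

definition found :: "bool list \<Rightarrow> memory \<Rightarrow> nat list \<Rightarrow> memory \<Rightarrow> bool" where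
  "found x m bs m' \<longleftrightarrow> frame blockW m m' \<and> length bs \<le> r \<and> block_chain n f lab x bs \<and> chosen m' bs \<and>
     m' aNB 0 = length bs \<and>
     (\<forall>t<length bs. m' aLB (m aNL 0 + t) = bs ! t \<and> m' aLT (m aNL 0 + t) = m aNT 0 \<and>
        m' aLW (m aNL 0 + t) = m aWP 0) \<and>
     (\<forall>k<m aNL 0. m' aLB k = m aLB k \<and> m' aLT k = m aLT k \<and> m' aLW k = m aLW k)"

context
  fixes x :: "bool list"
  assumes x: "x \<in> cube n"
begin

lemma ok_FQ:
  assumes m: "params m" "bit_row n m aX 0 x" "chosen m bs"
    and e: "\<And>m'. frame {aBuf, cV} m m' \<Longrightarrow> value_of m' e = a"
  shows "ok (FQ e) 1 m (\<lambda>m'. frame {aBuf, cV, aRes} m m' \<and>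
    row n m' aBuf 0 = restr n lab x (set bs \<union> {a..}) \<and>
    m' aRes 0 = of_bool (f (restr n lab x (set bs \<union> {a..}))))"
  unfolding FQ_def
proof (rule ok_QPoint)
  show "m 0 0 = n" using m by (simp add: params_def)
  fix v m' assume v: "v < n" "frame {aBuf, cV} m m'" "m' cV 0 = v"
  have "m' aCh = m aCh" "m' aLab = m aLab" "m' aX = m aX" using v(2) by (auto intro!: frameD)
  then show "(if value_of m' (Plus (Get aCh (sc cV)) (Minus (Plus (Get aLab (sc cV)) (Const 1)) e)) \<noteq> 0
      then value_of m' (Get aX (sc cV)) else value_of m' (Const 0)) \<noteq> 0 \<longleftrightarrow>
      restr n lab x (set bs \<union> {a..}) ! v"
    using v(1,3) m e[OF v(2)] by (auto simp: params_def bit_row_def chosen_def)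
qed (simp_all add: restr_def)

lemma ok_Search:
  assumes m: "params m" "bit_row n m aX 0 x" "chosen m bs"
    and fx: "f x" "\<not> f (restr n lab x (set bs))"
  shows "ok Search L m (\<lambda>m'. frame searchW m m' \<and>
    f (restr n lab x (set bs \<union> {m' aLo 0..})) \<and> \<not> f (restr n lab x (set bs \<union> {Suc (m' aLo 0)..})))"
proof -
  let ?F = "\<lambda>a. f (restr n lab x (set bs \<union> {a..}))"
  \<comment> \<open>True at the lower end, false \<open>2 ^ (L - i)\<close> above it. Initially the
    ends are 0 and \<open>2 ^ L\<close>, where the restrictions are \<open>x\<close> itself and the
    chosen blocks alone; finally they are adjacent.\<close>
  let ?I = "\<lambda>i m'. frame searchW m m' \<and> ?F (m' aLo 0) \<and> \<not> ?F (m' aLo 0 + 2 ^ (L - i))"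
  have "ok Search (L * 1) m (\<lambda>m'. frame searchW m m' \<and> ?F (m' aLo 0) \<and> \<not> ?F (Suc (m' aLo 0)))"
    unfolding Search_def
  proof (rule ok_Put_Seq, rule ok_For[where I = ?I])
    show "L \<le> B" by (rule bounds)
    show "?I 0 ((m(aLo := (m aLo)(value_of m (Const 0) := value_of m (Const 0))))
      (cL := ((m(aLo := (m aLo)(value_of m (Const 0) := value_of m (Const 0)))) cL)(0 := 0)))"
      using fx restr_all[OF x] by (simp add: restr_none)
    fix i m1 assume I: "?I i m1" and c: "m1 cL 0 = i"
    have fr: "frame searchW m m1" using I by simp
    have p1: "params m1" by (rule params_frame[OF m(1) fr]) simp
    have keep: "m1 aX = m aX" "m1 aCh = m aCh" using fr by (auto intro!: frameD)
    show "value_of m1 (sc aL) = L" using p1 by (simp add: params_def)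
    assume i: "i < L"
    let ?p = "m1 aLo 0 + 2 ^ (L - Suc i)"
    have pw: "2 ^ (L - Suc i) + 2 ^ (L - Suc i) = (2::nat) ^ (L - i)"
    proof -
      have "L - i = Suc (L - Suc i)" using i by simp
      then show ?thesis by simp
    qed
    let ?m2 = "m1(aP := (m1 aP)(0 := ?p))"
    have val: "value_of m1 (Plus (sc aLo) (Get aPow (Minus (Minus (sc aL) (Const 1)) (sc cL)))) = ?p"
      using p1 c i by (simp add: params_def)
    have "ok (FQ (sc aP) ;; If (sc aRes) (setc aLo (sc aP)) Skip) 1 ?m2
       (\<lambda>m''. m'' cL 0 = i \<and> ?I (Suc i) (m''(cL := (m'' cL)(0 := Suc i))))"
    proof (rule ok_SeqI[OF ok_FQ[where bs = bs and a = ?p]])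
      have "frame {aP} m1 ?m2" by simp
      then show "params ?m2" by (rule params_frame[OF p1]) simp
      show "bit_row n ?m2 aX 0 x" "chosen ?m2 bs"
        using m(2,3) keep by (simp_all add: bit_row_def chosen_def)
      fix m' assume "frame {aBuf, cV} ?m2 m'"
      then show "value_of m' (sc aP) = ?p" using frameD[of _ ?m2 m' aP] by simp
    next
      fix m3 assume m3: "frame {aBuf, cV, aRes} ?m2 m3 \<and> row n m3 aBuf 0 = restr n lab x (set bs \<union> {?p..}) \<and>
        m3 aRes 0 = of_bool (?F ?p)"
      have fr3: "frame searchW m m3" using fr m3 by (auto simp: frame_def)
      have e3: "m3 aLo = m1 aLo" "m3 cL = m1 cL" "m3 aP 0 = ?p" using m3 by (auto simp: frame_def)
      show "ok (If (sc aRes) (setc aLo (sc aP)) Skip) 0 m3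
        (\<lambda>m''. m'' cL 0 = i \<and> ?I (Suc i) (m''(cL := (m'' cL)(0 := Suc i))))"
        by (rule ok_If; (rule ok_Put | rule ok_Skip))
           (use m3 I c pw fr3 e3 in \<open>auto simp: add.assoc\<close>)
    qed simp
    then show "ok (setc aP (Plus (sc aLo) (Get aPow (Minus (Minus (sc aL) (Const 1)) (sc cL)))) ;;
      FQ (sc aP) ;; If (sc aRes) (setc aLo (sc aP)) Skip) 1 m1
      (\<lambda>m''. m'' cL 0 = i \<and> ?I (Suc i) (m''(cL := (m'' cL)(0 := Suc i))))"
      unfolding val[symmetric] by (intro ok_Put_Seq) simp
  next
    fix m' assume "?I L m'"
    then show "frame searchW m m' \<and> ?F (m' aLo 0) \<and> \<not> ?F (Suc (m' aLo 0))" by simp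
  qed
  then show ?thesis by simp
qed

lemma ok_Mark:
  assumes m: "params m" "chosen m bs"
  shows "ok Mark 0 m (\<lambda>m'. frame {aCh, cV} m m' \<and> chosen m' (bs @ [m aLo 0]))"
proof -
  let ?I = "\<lambda>i m'. frame {aCh, cV} m m' \<and>
    (\<forall>v<n. m' aCh v \<noteq> 0 \<longleftrightarrow> lab v \<in> set bs \<or> (v < i \<and> lab v = m aLo 0))"
  have "ok Mark (n * 0) m (\<lambda>m'. frame {aCh, cV} m m' \<and> chosen m' (bs @ [m aLo 0]))"
    unfolding Mark_def
  proof (rule ok_For[where I = ?I])
    fix i m1 assume I: "?I i m1" "m1 cV 0 = i"
    have p1: "params m1" by (rule params_frame[OF m(1), of "{aCh, cV}"]) (use I in auto)
    then show "value_of m1 in_n = n" by (simp add: params_def)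
    have lo: "m1 aLo = m aLo" using I by (auto simp: frame_def)
    assume i: "i < n"
    show "ok (If (xorE (Get aLab (sc cV)) (sc aLo)) Skip (Put aCh (sc cV) (Const 1))) 0 m1
       (\<lambda>m''. m'' cV 0 = i \<and> ?I (Suc i) (m''(cV := (m'' cV)(0 := Suc i))))"
      by (rule ok_If; (rule ok_Put | rule ok_Skip))
         (use I p1 lo i in \<open>auto simp: less_Suc_eq params_def\<close>)
  next
    fix m' assume "?I n m'"
    then show "frame {aCh, cV} m m' \<and> chosen m' (bs @ [m aLo 0])" by (auto simp: chosen_def)
  qed (use m n_le in \<open>auto simp: chosen_def\<close>)
  then show ?thesis by simp
qed

lemma found_frame:
  assumes "found x m bs m1" "frame A m1 m2" "A \<subseteq> searchW \<union> {cI}"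
  shows "found x m bs m2"
proof -
  have "m2 aCh = m1 aCh" "m2 aNB = m1 aNB" "m2 aLB = m1 aLB" "m2 aLT = m1 aLT" "m2 aLW = m1 aLW"
    using assms(2,3) by (auto intro!: frameD)
  moreover have "frame blockW m m2"
    by (rule frame_trans[OF _ assms(2)]) (use assms(1,3) in \<open>auto simp: found_def\<close>)
  ultimately show ?thesis using assms(1) by (simp add: found_def chosen_def)
qed

lemma block_chain_snoc:
  assumes "block_chain n f lab x bs" "f (restr n lab x (set bs \<union> {b..}))"
    "\<not> f (restr n lab x (set bs \<union> {Suc b..}))"
  shows "block_chain n f lab x (bs @ [b])"
  using assms by (auto simp: block_chain_def nth_append less_Suc_eq)

lemma ok_Add_Block:
  assumes m: "params m" "bit_row n m aX 0 x" "f x"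
    and found: "found x m bs m1" and len: "length bs < r" and nf: "\<not> f (restr n lab x (set bs))"
  shows "ok Add_Block L m1 (\<lambda>m2. m2 cI = m1 cI \<and> (\<exists>b. found x m (bs @ [b]) m2))"
proof -
  have fr: "frame blockW m m1" using found by (simp add: found_def)
  have p1: "params m1" by (rule params_frame[OF m(1) fr]) simp
  have X1: "m1 aX = m aX" using fr by (auto intro!: frameD)
  have "ok Add_Block (L + (0 + 0)) m1 (\<lambda>m2. m2 cI = m1 cI \<and> (\<exists>b. found x m (bs @ [b]) m2))"
    unfolding Add_Block_def
  proof (rule ok_SeqI[OF ok_Search[where bs = bs]])
    show "params m1" by (rule p1)
    show "bit_row n m1 aX 0 x" using m(2) X1 by (simp add: bit_row_def)
    show "chosen m1 bs" using found by (simp add: found_def)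
    show "f x" "\<not> f (restr n lab x (set bs))" by fact+
    fix m2 assume m2: "frame searchW m1 m2 \<and> f (restr n lab x (set bs \<union> {m2 aLo 0..})) \<and>
      \<not> f (restr n lab x (set bs \<union> {Suc (m2 aLo 0)..}))"
    define b where "b = m2 aLo 0"
    have f2: "found x m bs m2" by (rule found_frame[OF found, of searchW]) (use m2 in auto)
    have p2: "params m2" by (rule params_frame[OF p1, of searchW]) (use m2 in auto)
    have chain: "block_chain n f lab x (bs @ [b])"
      using block_chain_snoc found m2 by (simp add: found_def b_def)
    show "ok (Mark ;; Put aLB (Plus (sc aNL) (sc aNB)) (sc aLo) ;;
       Put aLT (Plus (sc aNL) (sc aNB)) (sc aNT) ;; Put aLW (Plus (sc aNL) (sc aNB)) (sc aWP) ;;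
       setc aNB (Plus (sc aNB) (Const 1))) (0 + 0) m2 (\<lambda>m2. m2 cI = m1 cI \<and> (\<exists>b. found x m (bs @ [b]) m2))"
    proof (rule ok_SeqI[OF ok_Mark[where bs = bs]])
      show "params m2" by (rule p2)
      show "chosen m2 bs" using f2 by (simp add: found_def)
      fix m3 assume m3: "frame {aCh, cV} m2 m3 \<and> chosen m3 (bs @ [m2 aLo 0])"
      have e: "m3 aNL = m aNL" "m3 aNB = m2 aNB" "m3 aLo = m2 aLo" "m3 aNT = m aNT" "m3 aWP = m aWP"
        "m3 aLB = m2 aLB" "m3 aLT = m2 aLT" "m3 aLW = m2 aLW" "m3 cI = m1 cI"
        using m3 m2 fr by (auto simp: frame_def)
      have fr3: "frame blockW m m3" using f2 m3 by (auto simp: found_def frame_def)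
      have nb: "m2 aNB 0 = length bs" using f2 by (simp add: found_def)
      show "ok (Put aLB (Plus (sc aNL) (sc aNB)) (sc aLo) ;;
         Put aLT (Plus (sc aNL) (sc aNB)) (sc aNT) ;; Put aLW (Plus (sc aNL) (sc aNB)) (sc aWP) ;;
         setc aNB (Plus (sc aNB) (Const 1))) 0 m3 (\<lambda>m2. m2 cI = m1 cI \<and> (\<exists>b. found x m (bs @ [b]) m2))"
        by (intro ok_Put_Seq ok_Put conjI exI[of _ b])
           (use f2 m3 e fr3 nb chain len in \<open>auto simp: found_def chosen_def b_def less_Suc_eq nth_append\<close>)
    qed simp
  qed simp
  then show ?thesis by simp
qed

lemma ok_Blocks:
  assumes m: "params m" "bit_row n m aX 0 x" "f x"
  shows "ok Blocks (r * (1 + L) + 1) m (\<lambda>m'. \<exists>bs. found x m bs m' \<and>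
    (length bs = r \<or> f (restr n lab x (set bs))) \<and> row n m' aBuf 0 = restr n lab x (set bs) \<and>
    m' aRes 0 = of_bool (f (restr n lab x (set bs))))"
proof -
  let ?ff = "\<lambda>bs. f (restr n lab x (set bs))"
  let ?Q1 = "\<lambda>m'. frame {aCh, cV} m m' \<and> (\<forall>v<n. m' aCh v = 0)"
  have 1: "ok (For cV in_n (Put aCh (sc cV) (Const 0))) (n * 0) m ?Q1"
  proof (rule ok_For[where I = "\<lambda>i m'. frame {aCh, cV} m m' \<and> (\<forall>v<i. m' aCh v = 0)"])
    fix i m' assume I: "frame {aCh, cV} m m' \<and> (\<forall>v<i. m' aCh v = 0)" "m' cV 0 = i"
    show "value_of m' in_n = n" using I m(1) frameD[of "{aCh, cV}" m m' 0] by (simp add: params_def)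
    show "ok (Put aCh (sc cV) (Const 0)) 0 m' (\<lambda>m''. m'' cV 0 = i \<and>
        (frame {aCh, cV} m (m''(cV := (m'' cV)(0 := Suc i))) \<and>
         (\<forall>v<Suc i. (m''(cV := (m'' cV)(0 := Suc i))) aCh v = 0)))"
      by (rule ok_Put) (use I in \<open>auto simp: less_Suc_eq\<close>)
  qed (use n_le in auto)
  let ?Q2 = "\<lambda>m'. \<exists>bs. found x m bs m' \<and> (length bs = r \<or> ?ff bs)"
  have base: "params m' \<and> bit_row n m' aX 0 x" if "frame blockW m m'" for m'
    using params_frame[OF m(1) that] m(2) frameD[OF that, of aX] by (simp add: bit_row_def)
  have FQ: "ok (FQ (sc aTotal)) 1 m' (\<lambda>m''. frame {aBuf, cV, aRes} m' m'' \<and>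
      row n m'' aBuf 0 = restr n lab x (set bs) \<and> m'' aRes 0 = of_bool (?ff bs))" if "found x m bs m'" for bs m'
  proof -
    have b: "params m'" "bit_row n m' aX 0 x" "chosen m' bs" using base[of m'] that by (simp_all add: found_def)
    have "value_of m'' (sc aTotal) = 2 ^ L" if "frame {aBuf, cV} m' m''" for m''
      using b(1) frameD[OF that, of aTotal] by (simp add: params_def)
    from ok_FQ[OF b, where e = "sc aTotal" and a = "2 ^ L", OF this] show ?thesis
      unfolding restr_none .
  qed
  have 2: "ok (For cI in_r (FQ (sc aTotal) ;; If (sc aRes) Skip Add_Block)) (r * (1 + L)) m1 ?Q2"
    if m1: "?Q1 m0" "m1 = m0(aNB := (m0 aNB)(0 := 0))" for m0 m1
  \<comment> \<open>Either every iteration so far has added a label, or \<open>f\<close> is already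
    true on the chosen blocks and the remaining iterations idle.\<close>
  proof (rule ok_For[where I = "\<lambda>i m'. \<exists>bs. found x m bs m' \<and> length bs \<le> i \<and> (length bs = i \<or> ?ff bs)"])
    have "found x m [] (m1(cI := (m1 cI)(0 := 0)))"
      using m1 by (auto simp: found_def block_chain_def chosen_def frame_def)
    then show "\<exists>bs. found x m bs (m1(cI := (m1 cI)(0 := 0))) \<and> length bs \<le> 0 \<and> (length bs = 0 \<or> ?ff bs)"
      by (intro exI[of _ "[]"]) simp
    show "r \<le> B" by (rule bounds)
    fix i m2 assume I: "\<exists>bs. found x m bs m2 \<and> length bs \<le> i \<and> (length bs = i \<or> ?ff bs)" and c: "m2 cI 0 = i"
    then obtain bs where bs: "found x m bs m2" "length bs \<le> i" "length bs = i \<or> ?ff bs" by blast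
    have p2: "params m2" using base[of m2] bs(1) by (simp add: found_def)
    then show "value_of m2 in_r = r" by (simp add: params_def)
    assume i: "i < r"
    let ?I = "\<lambda>m''. m'' cI 0 = i \<and> (\<exists>bs. found x m bs (m''(cI := (m'' cI)(0 := Suc i))) \<and>
        length bs \<le> Suc i \<and> (length bs = Suc i \<or> ?ff bs))"
    have found_upd: "found x m cs (m''(cI := w))" if "found x m cs m''" for cs m'' w
      by (rule found_frame[OF that, of "{cI}"]) auto
    show "ok (FQ (sc aTotal) ;; If (sc aRes) Skip Add_Block) (1 + L) m2 ?I"
    proof (rule ok_SeqI[OF FQ[OF bs(1)]])
      fix m3 assume m3: "frame {aBuf, cV, aRes} m2 m3 \<and> row n m3 aBuf 0 = restr n lab x (set bs) \<and>
        m3 aRes 0 = of_bool (?ff bs)"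
      have f3: "found x m bs m3" by (rule found_frame[OF bs(1), of "{aBuf, cV, aRes}"]) (use m3 in auto)
      have c3: "m3 cI = m2 cI" using m3 by (auto simp: frame_def)
      show "ok (If (sc aRes) Skip Add_Block) L m3 ?I"
      proof (rule ok_If)
        assume "value_of m3 (sc aRes) \<noteq> 0"
        then have "?ff bs" using m3 by simp
        have "?I m3"
        proof (intro conjI exI[of _ bs])
          show "found x m bs (m3(cI := (m3 cI)(0 := Suc i)))" by (rule found_upd[OF f3])
        qed (use c3 c bs(2) \<open>?ff bs\<close> in auto)
        from ok_Skip[where Q = ?I and m = m3, OF this]
        show "ok Skip L m3 ?I" by (rule ok_weaken) (assumption | simp)+
      next
        assume "value_of m3 (sc aRes) = 0"
        then have nf: "\<not> ?ff bs" using m3 by simp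
        then have len: "length bs = i" using bs(3) by simp
        show "ok Add_Block L m3 ?I"
        proof (rule ok_weaken[OF ok_Add_Block[OF m f3 _ nf]])
          fix m4 assume m4: "m4 cI = m3 cI \<and> (\<exists>b. found x m (bs @ [b]) m4)"
          then obtain b where b: "found x m (bs @ [b]) m4" by blast
          show "?I m4"
          proof (intro conjI exI[of _ "bs @ [b]"])
            show "found x m (bs @ [b]) (m4(cI := (m4 cI)(0 := Suc i)))" by (rule found_upd[OF b])
          qed (use m4 c3 c len in auto)
        qed (use len i in auto)
      qed
    qed simp
  qed auto
  have 3: "ok (FQ (sc aTotal)) 1 m2 (\<lambda>m'. \<exists>bs. found x m bs m' \<and>
    (length bs = r \<or> ?ff bs) \<and> row n m' aBuf 0 = restr n lab x (set bs) \<and> m' aRes 0 = of_bool (?ff bs))"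
    if m2: "?Q2 m2" for m2
  proof -
    from m2 obtain bs where bs: "found x m bs m2" "length bs = r \<or> ?ff bs" by blast
    show ?thesis
    proof (rule ok_weaken[OF FQ[OF bs(1)]])
      fix m3 assume m3: "frame {aBuf, cV, aRes} m2 m3 \<and> row n m3 aBuf 0 = restr n lab x (set bs) \<and>
        m3 aRes 0 = of_bool (?ff bs)"
      have "found x m bs m3" by (rule found_frame[OF bs(1), of "{aBuf, cV, aRes}"]) (use m3 in auto)
      then show "\<exists>bs. found x m bs m3 \<and> (length bs = r \<or> ?ff bs) \<and>
          row n m3 aBuf 0 = restr n lab x (set bs) \<and> m3 aRes 0 = of_bool (?ff bs)"
        using bs(2) m3 by blast
    qed simp
  qed
  show ?thesis unfolding Blocks_def
  proof (rule ok_SeqI[OF 1])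
    fix m0 assume m0: "?Q1 m0"
    show "ok (setc aNB (Const 0) ;; For cI in_r (FQ (sc aTotal) ;; If (sc aRes) Skip Add_Block) ;;
      FQ (sc aTotal)) (r * (1 + L) + 1) m0 (\<lambda>m'. \<exists>bs. found x m bs m' \<and>
      (length bs = r \<or> ?ff bs) \<and> row n m' aBuf 0 = restr n lab x (set bs) \<and> m' aRes 0 = of_bool (?ff bs))"
      by (rule ok_Put_Seq, rule ok_SeqI[OF 2[OF m0] 3]) (assumption | simp)+
  qed simp
qed

abbreviation commitW :: "nat set" where "commitW \<equiv> {aW, aNL, aNT, aWP, cV}"

lemma ok_Commit:
  assumes m: "params m" "repr m nt lits" and found: "found x m bs m1"
    and buf: "row n m1 aBuf 0 = restr n lab x (set bs)"
  shows "ok Commit 0 m1 (\<lambda>m'. frame (blockW \<union> commitW) m m' \<and>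
    repr m' (Suc nt) (lits @ new_literals n lab x nt bs))"
proof -
  have fr: "frame blockW m m1" using found by (simp add: found_def)
  have p1: "params m1" by (rule params_frame[OF m(1) fr]) simp
  have e1: "m1 aW = m aW" "m1 aNL = m aNL" "m1 aNT = m aNT" "m1 aWP = m aWP"
    using fr by (auto intro!: frameD)
  let ?wp = "m aWP 0"
  let ?I = "\<lambda>i m'. frame {aW, cV} m1 m' \<and> (\<forall>k<?wp. m' aW k = m aW k) \<and>
    (\<forall>v<i. m' aW (?wp + v) = m1 aBuf v)"
  have 1: "ok (For cV in_n (Put aW (Plus (sc aWP) (sc cV)) (Get aBuf (sc cV)))) (n * 0) m1 (?I n)"
  proof (rule ok_For[where I = ?I])
    fix i m' assume I: "?I i m'" "m' cV 0 = i"
    have e: "m' 0 = m1 0" "m' aWP = m1 aWP" "m' aBuf = m1 aBuf" using I by (auto simp: frame_def)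
    show "value_of m' in_n = n" using e p1 by (simp add: params_def)
    show "ok (Put aW (Plus (sc aWP) (sc cV)) (Get aBuf (sc cV))) 0 m'
       (\<lambda>m''. m'' cV 0 = i \<and> ?I (Suc i) (m''(cV := (m'' cV)(0 := Suc i))))"
      by (rule ok_Put) (use I e e1 in \<open>auto simp: less_Suc_eq\<close>)
  qed (use n_le e1 in auto)
  show ?thesis unfolding Commit_def
  proof (rule ok_SeqI[OF 1])
    fix m2 assume I: "?I n m2"
    have e2: "m2 aNL = m aNL" "m2 aNT = m aNT" "m2 aWP = m aWP" "m2 aNB = m1 aNB" "m2 0 = m1 0"
      "m2 aLB = m1 aLB" "m2 aLT = m1 aLT" "m2 aLW = m1 aLW" "m2 aBuf = m1 aBuf"
      using I e1 by (auto simp: frame_def)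
    have n2: "m2 0 0 = n" using e2 p1 by (simp add: params_def)
    have nb: "m1 aNB 0 = length bs" using found by (simp add: found_def)
    have nl: "m aNL 0 = length lits" and nt: "m aNT 0 = nt" using m(2) by (simp_all add: repr_def)
    define m3 where "m3 = m2(aNL := (m2 aNL)(0 := length lits + length bs),
      aNT := (m2 aNT)(0 := Suc nt), aWP := (m2 aWP)(0 := ?wp + n))"
    have "frame {aW, cV, aNL, aNT, aWP} m1 m3" using I by (auto simp: m3_def frame_def)
    with fr have "frame (blockW \<union> commitW) m m3" by (auto simp: frame_def)
    moreover have "repr m3 (Suc nt) (lits @ new_literals n lab x nt bs)"
      unfolding repr_def
    proof (intro conjI allI impI)
      fix k assume k: "k < length (lits @ new_literals n lab x nt bs)"
      have "(lits @ new_literals n lab x nt bs) ! k = (m3 aLT k, row n m3 aW (m3 aLW k), m3 aLB k) \<and>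
          m3 aLW k + n \<le> m3 aWP 0"
      proof (cases "k < length lits")
        case True
        then have old: "lits ! k = (m aLT k, row n m aW (m aLW k), m aLB k)" "m aLW k + n \<le> ?wp"
          using m(2) by (simp_all add: repr_def)
        have "m1 aLB k = m aLB k" "m1 aLT k = m aLT k" "m1 aLW k = m aLW k"
          using found True nl by (auto simp: found_def)
        moreover have "row n m3 aW (m aLW k) = row n m aW (m aLW k)"
          using I old(2) by (auto simp: row_def m3_def)
        ultimately show ?thesis using True old by (simp add: nth_append m3_def e2)
      next
        case False
        define t where "t = k - length lits"
        have t: "t < length bs" "k = length lits + t" using False k by (auto simp: t_def new_literals_def)
        have "m1 aLB k = bs ! t" "m1 aLT k = nt" "m1 aLW k = ?wp"
          using found t nl nt by (auto simp: found_def)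
        moreover have "row n m3 aW ?wp = row n m1 aBuf 0"
          using I by (auto simp: row_def m3_def)
        ultimately show ?thesis
          using t buf by (simp add: nth_append m3_def e2 new_literals_def)
      qed
      then show "(lits @ new_literals n lab x nt bs) ! k = (m3 aLT k, row n m3 aW (m3 aLW k), m3 aLB k)"
        "m3 aLW k + n \<le> m3 aWP 0" by blast+
    qed (simp_all add: m3_def new_literals_def)
    moreover have "ok (setc aNL (Plus (sc aNL) (sc aNB)) ;; setc aNT (Plus (sc aNT) (Const 1)) ;;
        setc aWP (Plus (sc aWP) in_n)) 0 m2 (\<lambda>m'. m' = m3)"
      by (intro ok_Put_Seq ok_Put) (use e2 n2 nb nl nt in \<open>simp add: m3_def\<close>)
    ultimately show "ok (setc aNL (Plus (sc aNL) (sc aNB)) ;; setc aNT (Plus (sc aNT) (Const 1)) ;;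
        setc aWP (Plus (sc aWP) in_n)) 0 m2 (\<lambda>m'. frame (blockW \<union> commitW) m m' \<and>
      repr m' (Suc nt) (lits @ new_literals n lab x nt bs))"
      by (elim ok_weaken) auto
  qed simp
qed

end

abbreviation stepW :: "nat set" where "stepW \<equiv> evalW \<union> blockW \<union> commitW"

text \<open>For each of at most \<open>r * s\<close> literals, 5 test and \<open>2 * L\<close>
  correction queries; for each of \<open>r\<close> labels, \<open>L\<close> search queries and one
  check; finally \<open>f\<close> at the sample and the last check. The sample itself is charged
  separately.\<close>

definition round_queries :: nat where
  "round_queries = r * s * (2 * L + 5) + r * (1 + L) + 2"

text \<open>The rejecting branch records the reason for rejection, so that completeness can refute
  each reason separately.\<close>

definition step_post ::
    "memory \<Rightarrow> nat \<Rightarrow> literal list \<Rightarrow> bool list \<Rightarrow> bool list list \<Rightarrow> memory \<Rightarrow> bool" where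
  "step_post m nt lits x ys m' \<longleftrightarrow> (let pass = \<forall>l\<in>set lits. lit_passes (g l) ys x; hv = hyp_value g nt lits ys x in
     frame stepW m m' \<and>
     (if m' aRej 0 = 0 then pass \<and> ((hv = f x \<and> repr m' nt lits) \<or>
        (\<not> hv \<and> f x \<and> nt < s \<and> (\<exists>bs. length bs \<le> r \<and> block_chain n f lab x bs \<and>
           f (restr n lab x (set bs)) \<and> repr m' (Suc nt) (lits @ new_literals n lab x nt bs))))
      else \<not> pass \<or> (hv \<and> \<not> f x) \<or> (\<not> hv \<and> f x \<and> (s \<le> nt \<or>
        (\<exists>bs. length bs = r \<and> block_chain n f lab x bs \<and> \<not> f (restr n lab x (set bs)))))))"

lemma ok_Step:
  assumes L: "L \<ge> 1" and m: "ready m nt lits x ys" and rej: "m aRej 0 = 0"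
    and le: "nt \<le> s" "length lits \<le> r * s"
  shows "ok Step round_queries m (step_post m nt lits x ys)"
proof -
  define pass where "pass \<longleftrightarrow> (\<forall>l\<in>set lits. lit_passes (g l) ys x)"
  define hv where "hv \<longleftrightarrow> hyp_value g nt lits ys x"
  define Q where "Q = step_post m nt lits x ys"
  note Q = Q_def step_post_def Let_def pass_def[symmetric] hv_def[symmetric]
  have Q_rej: "Q m'" if "frame stepW m m'" "m' aRej 0 \<noteq> 0"
    "\<not> pass \<or> (hv \<and> \<not> f x) \<or> (\<not> hv \<and> f x \<and> (s \<le> nt \<or>
       (\<exists>bs. length bs = r \<and> block_chain n f lab x bs \<and> \<not> f (restr n lab x (set bs)))))" for m'
    unfolding Q using that(1,3) by (simp only: that(2) if_False simp_thms)
  have Q_same: "Q m'" if "frame stepW m m'" "m' aRej 0 = 0" "pass" "hv = f x" "repr m' nt lits" for m'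
    unfolding Q using that by (simp only: if_True simp_thms)
  have Q_new: "Q m'" if "frame stepW m m'" "m' aRej 0 = 0" "pass" "\<not> hv" "f x" "nt < s" "length bs \<le> r"
    "block_chain n f lab x bs" "f (restr n lab x (set bs))"
    "repr m' (Suc nt) (lits @ new_literals n lab x nt bs)" for m' bs
    unfolding Q using that by (simp only: if_True simp_thms) blast
  have xc: "x \<in> cube n" using m by (auto simp: ready_def bit_row_def cube_def)
  let ?q = "r * (1 + L) + 1"
  have rest: "ok (If (sc aRej) Skip (If (sc aFx)
     (If (sc aH) Skip (If (Minus in_s (sc aNT))
       (Blocks ;; If (sc aRes) Commit (setc aRej (Const 1))) (setc aRej (Const 1))))
     (If (sc aH) (setc aRej (Const 1)) Skip))) ?q m1 Q"
    if m1: "frame evalW m m1 \<and> (m1 aRej 0 = 0 \<longleftrightarrow> (\<forall>l\<in>set lits. lit_passes (g l) ys x)) \<and>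
      (m1 aH 0 \<noteq> 0 \<longleftrightarrow> hyp_value g nt lits ys x) \<and> (m1 aFx 0 \<noteq> 0 \<longleftrightarrow> f x)" for m1
  proof -
    have fr: "frame evalW m m1" and v: "m1 aRej 0 = 0 \<longleftrightarrow> pass" "m1 aH 0 \<noteq> 0 \<longleftrightarrow> hv" "m1 aFx 0 \<noteq> 0 \<longleftrightarrow> f x"
      using m1 by (simp_all add: pass_def hv_def)
    have r1: "ready m1 nt lits x ys" by (rule ready_frame[OF m fr]) auto
    have p1: "params m1" "repr m1 nt lits" "bit_row n m1 aX 0 x" using r1 by (simp_all add: ready_def)
    have frs: "frame stepW m m1" by (rule frame_mono[OF fr]) auto
    have skip: "ok Skip ?q m1 Q" if "Q m1"
      by (rule ok_weaken[OF ok_Skip[where Q = Q]]) (use that in auto)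
    have reject: "ok (setc aRej (Const 1)) ?q m1 Q"
      if "\<not> pass \<or> (hv \<and> \<not> f x) \<or> (\<not> hv \<and> f x \<and> s \<le> nt)"
    proof (rule ok_weaken[OF ok_Put[where Q = Q]])
      show "Q (m1(aRej := (m1 aRej)(value_of m1 (Const 0) := value_of m1 (Const 1))))"
        by (rule Q_rej) (use that frs in auto)
    qed auto
    have find: "ok (Blocks ;; If (sc aRes) Commit (setc aRej (Const 1))) ?q m1 Q"
      if h: "pass" "\<not> hv" "f x" "nt < s"
    proof (rule ok_SeqI[OF ok_Blocks[OF xc p1(1,3) h(3)]])
      fix m2 assume "\<exists>bs. found x m1 bs m2 \<and> (length bs = r \<or> f (restr n lab x (set bs))) \<and>
        row n m2 aBuf 0 = restr n lab x (set bs) \<and> m2 aRes 0 = of_bool (f (restr n lab x (set bs)))"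
      then obtain bs where bs: "found x m1 bs m2" "length bs = r \<or> f (restr n lab x (set bs))"
        "row n m2 aBuf 0 = restr n lab x (set bs)" "m2 aRes 0 = of_bool (f (restr n lab x (set bs)))"
        by blast
      have fb: "length bs \<le> r" "block_chain n f lab x bs" "frame blockW m1 m2"
        using bs(1) by (simp_all add: found_def)
      show "ok (If (sc aRes) Commit (setc aRej (Const 1))) 0 m2 Q"
      proof (rule ok_If)
        assume "value_of m2 (sc aRes) \<noteq> 0"
        then have fbs: "f (restr n lab x (set bs))" using bs(4) by simp
        show "ok Commit 0 m2 Q"
        proof (rule ok_weaken[OF ok_Commit[OF xc p1(1,2) bs(1,3)]])
          fix m3 assume m3: "frame (blockW \<union> commitW) m1 m3 \<and> repr m3 (Suc nt) (lits @ new_literals n lab x nt bs)"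
          have fr3: "frame stepW m m3"
            by (rule frame_trans[OF fr conjunct1[OF m3]]) auto
          have "m3 aRej = m1 aRej" by (rule frameD[OF conjunct1[OF m3]]) simp
          then have "m3 aRej 0 = 0" using v(1) h(1) by simp
          then show "Q m3" by (rule Q_new[OF fr3 _ h fb(1,2) fbs conjunct2[OF m3]])
        qed simp
      next
        assume "value_of m2 (sc aRes) = 0"
        then have nf: "\<not> f (restr n lab x (set bs))" using bs(4) by simp
        show "ok (setc aRej (Const 1)) 0 m2 Q"
        proof (rule ok_Put, rule Q_rej)
          have "frame stepW m m2" by (rule frame_trans[OF fr fb(3)]) auto
          then show "frame stepW m (m2(aRej := (m2 aRej)(value_of m2 (Const 0) := value_of m2 (Const 1))))"
            by simp
          show "\<not> pass \<or> (hv \<and> \<not> f x) \<or> (\<not> hv \<and> f x \<and> (s \<le> nt \<or>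
            (\<exists>bs. length bs = r \<and> block_chain n f lab x bs \<and> \<not> f (restr n lab x (set bs)))))"
            using nf bs(2) fb(2) h by blast
        qed simp
      qed
    qed simp
    have sn: "value_of m1 (Minus in_s (sc aNT)) = s - nt"
      using p1 by (simp add: params_def repr_def)
    show ?thesis
    proof (rule ok_If)
      assume "value_of m1 (sc aRej) \<noteq> 0"
      then show "ok Skip ?q m1 Q" by (intro skip Q_rej) (use v frs in auto)
    next
      assume a: "value_of m1 (sc aRej) = 0"
      then have pass using v by simp
      show "ok (If (sc aFx) (If (sc aH) Skip (If (Minus in_s (sc aNT))
         (Blocks ;; If (sc aRes) Commit (setc aRej (Const 1))) (setc aRej (Const 1))))
        (If (sc aH) (setc aRej (Const 1)) Skip)) ?q m1 Q"
      proof (rule ok_If)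
        assume "value_of m1 (sc aFx) \<noteq> 0"
        then have "f x" using v by simp
        show "ok (If (sc aH) Skip (If (Minus in_s (sc aNT))
         (Blocks ;; If (sc aRes) Commit (setc aRej (Const 1))) (setc aRej (Const 1)))) ?q m1 Q"
        proof (rule ok_If)
          assume "value_of m1 (sc aH) \<noteq> 0"
          then show "ok Skip ?q m1 Q"
            by (intro skip Q_same) (use a v \<open>pass\<close> \<open>f x\<close> frs p1 in auto)
        next
          assume "value_of m1 (sc aH) = 0"
          then have nh: "\<not> hv" using v by simp
          show "ok (If (Minus in_s (sc aNT)) (Blocks ;; If (sc aRes) Commit (setc aRej (Const 1)))
            (setc aRej (Const 1))) ?q m1 Q"
            by (rule ok_If; (rule find | rule reject)) (use \<open>pass\<close> \<open>f x\<close> nh sn in auto)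
        qed
      next
        assume "value_of m1 (sc aFx) = 0"
        then have nf: "\<not> f x" using v by simp
        show "ok (If (sc aH) (setc aRej (Const 1)) Skip) ?q m1 Q"
          by (rule ok_If; (rule reject | (rule skip, rule Q_same))) (use a v \<open>pass\<close> nf frs p1 in auto)
      qed
    qed
  qed
  have "ok Step ((r * s * (2 * L + 5) + 1) + ?q) m Q" unfolding Step_def
    by (rule ok_SeqI[OF ok_Evaluate[OF L m rej le] rest]) (assumption | rule refl)+
  then have "ok Step round_queries m Q" by (rule ok_weaken) (assumption | simp add: round_queries_def)+
  then show ?thesis by (simp only: Q_def)
qed

end


subsection \<open>The program: one round\<close>

definition Fill :: "expr \<Rightarrow> com" where
  "Fill e = For cF e (Flip aTape (sc cF))"

definition Round :: com where
  "Round = If (sc aRej) Skip (Sample aX (Const 0) ;; Fill (sc aTK) ;; Step)"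

definition chunks :: "nat \<Rightarrow> nat \<Rightarrow> bool list \<Rightarrow> bool list list" where
  "chunks k w bs = map (\<lambda>q. take w (drop (q * w) bs)) [0..<k]"

lemma length_chunks [simp]: "length (chunks k w bs) = k"
  by (simp add: chunks_def)

lemma chunks_nth:
  assumes "length bs = w * k" "q < k"
  shows "length (chunks k w bs ! q) = w" "v < w \<Longrightarrow> chunks k w bs ! q ! v = bs ! (q * w + v)"
proof -
  have "q * w + w \<le> k * w" using assms(2) mult_le_mono1[of "Suc q" k w] by simp
  then show "length (chunks k w bs ! q) = w" "v < w \<Longrightarrow> chunks k w bs ! q ! v = bs ! (q * w + v)"
    using assms by (auto simp: chunks_def mult.commute)
qed

text \<open>Peeling off the first \<open>w\<close> bits of the tape leaves an independent uniform
  tape. This connects the bitwise flips with the independent rows of the analysis.\<close>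

lemma map_pmf_chunks: "map_pmf (chunks k w) (bits (w * k)) = replicate_pmf k (bits w)"
proof (induction k)
  case (Suc k)
  have "map_pmf (chunks (Suc k) w) (bits (w * Suc k)) =
      bind_pmf (bits w) (\<lambda>xs. bind_pmf (bits (w * k)) (\<lambda>ys. return_pmf (chunks (Suc k) w (xs @ ys))))"
    by (simp only: mult_Suc_right replicate_pmf_distrib map_bind_pmf map_return_pmf)
  also have "\<dots> = bind_pmf (bits w) (\<lambda>xs. bind_pmf (bits (w * k)) (\<lambda>ys. return_pmf (xs # chunks k w ys)))"
  proof (intro bind_pmf_cong refl arg_cong[where f = return_pmf])
    fix xs ys assume "xs \<in> set_pmf (bits w)"
    then have "length xs = w" by (simp add: cube_def)
    then show "chunks (Suc k) w (xs @ ys) = xs # chunks k w ys"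
      unfolding chunks_def by (simp add: upt_conv_Cons del: upt_Suc flip: map_Suc_upt)
  qed
  also have "\<dots> = bind_pmf (bits w) (\<lambda>xs. bind_pmf (map_pmf (chunks k w) (bits (w * k))) (\<lambda>ys. return_pmf (xs # ys)))"
    by (simp add: bind_map_pmf)
  also have "\<dots> = replicate_pmf (Suc k) (bits w)" unfolding Suc.IH by simp
  finally show ?case .
qed (simp add: chunks_def)

context machine
begin

lemma pok_Fill:
  assumes K: "K \<le> B" "\<And>m'. frame {aTape, cF} m m' \<Longrightarrow> value_of m' e = K"
    and fin: "\<And>bs m'. length bs = K \<Longrightarrow> frame {aTape, cF} m m' \<Longrightarrow>
      (\<And>i. i < K \<Longrightarrow> m' aTape i = of_bool (bs ! i)) \<Longrightarrow> Q m' \<and> \<phi> m' \<le> h bs"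
    and h: "(\<integral>\<^sup>+bs. h bs \<partial>(bits K)) \<le> u"
  shows "pok (Fill e) 0 m Q \<phi> u"
proof -
  define pre where "pre i m' = map (\<lambda>j. m' aTape j \<noteq> 0) [0..<i]" for i and m' :: memory
  \<comment> \<open>The conditional expectation of \<open>h\<close> given the bits already flipped,
    a martingale along the loop.\<close>
  define \<psi> where "\<psi> i m' = (\<integral>\<^sup>+bs. h (pre i m' @ bs) \<partial>(bits (K - i)))" for i m'
  let ?I = "\<lambda>i m'. frame {aTape, cF} m m' \<and> (\<forall>j<i. m' aTape j = of_bool (pre i m' ! j))"
  have "pok (Fill e) (K * 0) m Q \<phi> u"
    unfolding Fill_def
  proof (rule pok_For[where I = ?I and \<psi> = \<psi>])
    show "?I 0 (m(cF := (m cF)(0 := 0)))" by simp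
    show "\<psi> 0 (m(cF := (m cF)(0 := 0))) \<le> u" using h by (simp add: \<psi>_def pre_def)
    show "K \<le> B" by (rule K)
    fix i m' assume I: "?I i m'" "m' cF 0 = i"
    show "value_of m' e = K" using I K(2) by simp
    assume i: "i < K"
    let ?m = "\<lambda>b. (m'(aTape := (m' aTape)(value_of m' (sc cF) := of_bool b)))"
    let ?n = "\<lambda>m''. m''(cF := (m'' cF)(0 := Suc i))"
    have pre: "pre (Suc i) (?n (?m b)) = pre i m' @ [b]" for b
      using I(2) by (auto simp: pre_def)
    show "pok (Flip aTape (sc cF)) 0 m' (\<lambda>m''. m'' cF 0 = i \<and> ?I (Suc i) (?n m''))
       (\<lambda>m''. \<psi> (Suc i) (?n m'')) (\<psi> i m')"
    proof (rule pok_Flip)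
      fix b
      show "?m b cF 0 = i \<and> ?I (Suc i) (?n (?m b))"
        unfolding pre using I by (auto simp: nth_append less_Suc_eq pre_def)
    next
      have "\<psi> i m' = (\<integral>\<^sup>+bs. h (pre i m' @ bs) \<partial>(bits (Suc (K - Suc i))))"
        using i by (simp only: \<psi>_def Suc_diff_Suc)
      also have "\<dots> = (\<integral>\<^sup>+b. \<integral>\<^sup>+bs. h (pre i m' @ b # bs) \<partial>(bits (K - Suc i)) \<partial>(bernoulli_pmf (1/2)))"
        by (simp add: replicate_pmf.simps(2))
      finally show "(\<integral>\<^sup>+b. \<psi> (Suc i) (?n (?m b)) \<partial>(bernoulli_pmf (1/2))) \<le> \<psi> i m'"
        by (simp only: \<psi>_def pre append_assoc append_Cons append_Nil order_refl)
    qed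
  next
    fix m' assume I: "?I K m'"
    have "\<psi> K m' = h (pre K m')" by (simp add: \<psi>_def)
    moreover have "Q m' \<and> \<phi> m' \<le> h (pre K m')"
      by (rule fin) (use I in \<open>auto simp: pre_def\<close>)
    ultimately show "Q m' \<and> \<phi> m' \<le> \<psi> K m'" by simp
  qed
  then show ?thesis by simp
qed

end

locale program_run = program +
  assumes samples: "set_pmf D \<subseteq> cube n" and tape: "n * (L + 2) \<le> B" and L: "L \<ge> 1"
begin

section \<open>Invariant, outcome and potential of a round\<close>

definition hyp_ok :: "memory \<Rightarrow> nat \<Rightarrow> literal list \<Rightarrow> bool" where
  "hyp_ok m nt lits \<longleftrightarrow> params m \<and> repr m nt lits \<and> nt \<le> s \<and> length lits \<le> r * nt \<and>
     (\<forall>l\<in>set lits. fst l < nt) \<and> (\<forall>j. length (filter (\<lambda>l. fst l = j) lits) \<le> r)"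

lemma hyp_ok_length: "hyp_ok m nt lits \<Longrightarrow> length lits \<le> r * s"
  unfolding hyp_ok_def by (meson mult_le_mono2 order_trans)

definition good :: "nat \<Rightarrow> literal list \<Rightarrow> bool list \<Rightarrow> bool list list \<Rightarrow> bool" where
  "good nt lits x ys \<longleftrightarrow> (\<forall>l\<in>set lits. lit_passes (g l) ys x) \<and> hyp_value g nt lits ys x = f x"

definition outcome :: "nat \<Rightarrow> literal list \<Rightarrow> bool list \<Rightarrow> bool list list \<Rightarrow> memory \<Rightarrow> bool" where
  "outcome nt lits x ys m' \<longleftrightarrow>
     m' aRej 0 = 0 \<and> good nt lits x ys \<and> hyp_ok m' nt lits \<or>
     m' aRej 0 = 0 \<and> \<not> good nt lits x ys \<and> \<not> hyp_value g nt lits ys x \<and>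
       (\<exists>bs. block_chain n f lab x bs \<and> f (restr n lab x (set bs)) \<and>
          hyp_ok m' (Suc nt) (lits @ new_literals n lab x nt bs)) \<or>
     m' aRej 0 \<noteq> 0 \<and> \<not> good nt lits x ys \<and>
       (\<not> (\<forall>l\<in>set lits. lit_passes (g l) ys x) \<or>
        hyp_value g nt lits ys x \<and> \<not> f x \<or>
        \<not> hyp_value g nt lits ys x \<and> f x \<and> (s \<le> nt \<or>
          (\<exists>bs. length bs = r \<and> block_chain n f lab x bs \<and> \<not> f (restr n lab x (set bs)))))"

text \<open>Old literals have term indices below \<open>nt\<close>, so the index \<open>nt\<close>
  collects exactly the new ones and the bound of \<open>r\<close> literals per term is
  preserved.\<close>

lemma hyp_ok_extend:
  assumes "hyp_ok m nt lits" "nt < s" "length bs \<le> r" "params m'"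
    "repr m' (Suc nt) (lits @ new_literals n lab x nt bs)"
  shows "hyp_ok m' (Suc nt) (lits @ new_literals n lab x nt bs)"
proof -
  have len: "length (new_literals n lab x nt bs) \<le> r" using assms(3) by (simp add: new_literals_def)
  have new: "fst l = nt" if "l \<in> set (new_literals n lab x nt bs)" for l
    using that by (auto simp: new_literals_def)
  have "length (filter (\<lambda>l. fst l = j) (lits @ new_literals n lab x nt bs)) \<le> r" for j
  proof (cases "j = nt")
    case True
    have "filter (\<lambda>l. fst l = j) lits = []"
      using assms(1) True by (auto simp: hyp_ok_def filter_empty_conv)
    then show ?thesis using len by (simp add: order_trans[OF length_filter_le])
  next
    case False
    then have "filter (\<lambda>l. fst l = j) (new_literals n lab x nt bs) = []"
      using new by (auto simp: filter_empty_conv)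
    then show ?thesis using assms(1) by (simp add: hyp_ok_def)
  qed
  then show ?thesis using assms len new by (fastforce simp: hyp_ok_def)
qed

abbreviation roundW :: "nat set" where "roundW \<equiv> {aX, aTape, cF} \<union> stepW"

text \<open>\<open>h x ys\<close> is a bound for each fixed sample and tape. Once these are drawn
  the round is deterministic, so randomness enters only through the double integral.\<close>

lemma pok_Round:
  assumes m: "hyp_ok m nt lits" "m aRej 0 = 0"
    and post: "\<And>x ys m'. x \<in> cube n \<Longrightarrow> set ys \<subseteq> cube n \<Longrightarrow> length ys = L + 2 \<Longrightarrow> frame roundW m m' \<Longrightarrow>
      params m' \<Longrightarrow> outcome nt lits x ys m' \<Longrightarrow> Q m' \<and> \<phi> m' \<le> h x ys"
    and h: "(\<integral>\<^sup>+x. \<integral>\<^sup>+ys. h x ys \<partial>(replicate_pmf (L + 2) (bits n)) \<partial>D) \<le> u"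
  shows "pok Round (round_queries + 1) m Q \<phi> u"
proof -
  let ?R = "replicate_pmf (L + 2) (bits n)"
  have le: "nt \<le> s" "length lits \<le> r * s" "params m" "repr m nt lits"
    using m(1) hyp_ok_length by (auto simp: hyp_ok_def)
  have step: "pok Step round_queries m2 Q \<phi> (h x ys)"
    if x: "x \<in> cube n" and ys: "set ys \<subseteq> cube n" "length ys = L + 2"
      and m2: "ready m2 nt lits x ys" "m2 aRej 0 = 0" "frame {aX, aTape, cF} m m2" for x ys m2
  proof -
    note st = ok_Step[OF L m2(1,2) le(1,2)]
    have "pok Step round_queries m2 (\<lambda>m'. Q m' \<and> \<phi> m' \<le> h x ys) \<phi> (h x ys)"
    proof (rule pok_of_ok[OF ok_weaken[OF st order_refl]])
      fix m' assume "step_post m2 nt lits x ys m'"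
      note * = this[unfolded step_post_def Let_def]
      have p': "params m'" by (rule params_frame[OF _ conjunct1[OF *]]) (use m2(1) in \<open>auto simp: ready_def\<close>)
      have fr: "frame roundW m m'"
        by (rule frame_trans[OF m2(3) conjunct1[OF *]]) auto
      have same: "hyp_ok m' nt lits" if "repr m' nt lits"
        using m(1) that p' by (simp add: hyp_ok_def)
      have "outcome nt lits x ys m'"
      proof (cases "m' aRej 0 = 0")
        case True
        then consider "\<forall>l\<in>set lits. lit_passes (g l) ys x" "hyp_value g nt lits ys x = f x" "repr m' nt lits"
          | bs where "\<not> hyp_value g nt lits ys x" "f x" "nt < s" "length bs \<le> r" "block_chain n f lab x bs"
            "f (restr n lab x (set bs))" "repr m' (Suc nt) (lits @ new_literals n lab x nt bs)"
          using * by auto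
        then show ?thesis
        proof cases
          case 1
          then show ?thesis using True same by (simp add: outcome_def good_def)
        next
          case 2
          have "hyp_ok m' (Suc nt) (lits @ new_literals n lab x nt bs)"
            by (rule hyp_ok_extend[OF m(1) 2(3,4) p' 2(7)])
          then show ?thesis using True 2 by (auto simp: outcome_def good_def)
        qed
      next
        case False
        then show ?thesis using * by (auto simp: outcome_def good_def)
      qed
      then show "Q m' \<and> \<phi> m' \<le> h x ys" by (rule post[OF x ys fr p'])
    qed simp
    then show ?thesis by (rule pok_conseq) simp
  qed
  have fill: "pok (Fill (sc aTK) ;; Step) round_queries m1 Q \<phi> (\<integral>\<^sup>+ys. h x ys \<partial>?R)"
    if x: "x \<in> cube n" and m1: "m1 = write_row aX 0 x m" for x m1
  proof -
    have e1: "params m1" "repr m1 nt lits" "frame {aX} m m1" "bit_row n m1 aX 0 x" "m1 aRej 0 = 0"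
    proof -
      show fr: "frame {aX} m m1" by (simp add: m1 write_row_def)
      show "params m1" by (rule params_frame[OF le(3) fr]) simp
      show "repr m1 nt lits" by (rule repr_frame[OF le(4) fr]) simp
      show "bit_row n m1 aX 0 x" using x by (simp add: m1 bit_row_def write_row_def cube_def)
      show "m1 aRej 0 = 0" using frameD[OF fr, of aRej] m(2) by simp
    qed
    let ?S = "\<lambda>m2 ys. ready m2 nt lits x ys \<and> m2 aRej 0 = 0 \<and> frame {aX, aTape, cF} m m2 \<and>
      set ys \<subseteq> cube n \<and> length ys = L + 2"
    \<comment> \<open>The rows are determined by the memory, so their cost can be read off it.\<close>
    let ?ys = "\<lambda>m2. map (\<lambda>q. row n m2 aTape (q * n)) [0..<L + 2]"
    have "pok (Fill (sc aTK)) 0 m1 (\<lambda>m2. ?S m2 (?ys m2)) (\<lambda>m2. h x (?ys m2)) (\<integral>\<^sup>+ys. h x ys \<partial>?R)"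
    proof (rule pok_Fill[where K = "n * (L + 2)" and h = "\<lambda>bs. h x (chunks (L + 2) n bs)"])
      show "n * (L + 2) \<le> B" by (rule tape)
      fix m' assume "frame {aTape, cF} m1 m'"
      then have "params m'" by (rule params_frame[OF e1(1)]) simp
      then show "value_of m' (sc aTK) = n * (L + 2)" by (simp add: params_def)
    next
      fix bs m2 assume bs: "length bs = n * (L + 2)" and fr: "frame {aTape, cF} m1 m2"
        and v: "\<And>i. i < n * (L + 2) \<Longrightarrow> m2 aTape i = of_bool (bs ! i)"
      let ?c = "chunks (L + 2) n bs"
      have idx: "q * n + v < n * (L + 2)" if "q < L + 2" "v < n" for q v
      proof -
        have "q * n + v < Suc q * n" using that by simp
        also have "\<dots> \<le> (L + 2) * n" using that by (intro mult_right_mono) auto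
        finally show ?thesis by (simp add: mult.commute)
      qed
      have br: "bit_row n m2 aTape (q * n) (?c ! q)" if "q < L + 2" for q
        using chunks_nth[OF bs that] v[OF idx[OF that]] by (simp add: bit_row_def)
      have eq: "?ys m2 = ?c"
      proof (rule nth_equalityI)
        fix q assume "q < length (?ys m2)"
        then have q: "q < L + 2" by simp
        have "?ys m2 ! q = row n m2 aTape (q * n)" using q by (simp del: upt_Suc)
        also have "\<dots> = ?c ! q"
          using br[OF q] by (intro nth_equalityI) (auto simp: bit_row_def)
        finally show "?ys m2 ! q = ?c ! q" .
      qed simp
      have "params m2" "repr m2 nt lits" using params_frame[OF e1(1) fr] repr_frame[OF e1(2) fr] by simp_all
      moreover have "bit_row n m2 aX 0 x" using e1(4) frameD[OF fr, of aX] by (simp add: bit_row_def)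
      ultimately have "ready m2 nt lits x ?c" using br by (simp add: ready_def)
      moreover have "m2 aRej 0 = 0" using e1(5) frameD[OF fr, of aRej] by simp
      moreover have "frame {aX, aTape, cF} m m2" by (rule frame_trans[OF e1(3) fr]) auto
      moreover have "set ?c \<subseteq> cube n" using br by (auto simp: in_set_conv_nth bit_row_def cube_def)
      ultimately show "?S m2 (?ys m2) \<and> h x (?ys m2) \<le> h x ?c" unfolding eq by simp
    next
      have "(\<integral>\<^sup>+bs. h x (chunks (L + 2) n bs) \<partial>(bits (n * (L + 2)))) =
          (\<integral>\<^sup>+ys. h x ys \<partial>(map_pmf (chunks (L + 2) n) (bits (n * (L + 2)))))"
        by simp
      then show "(\<integral>\<^sup>+bs. h x (chunks (L + 2) n bs) \<partial>(bits (n * (L + 2)))) \<le> (\<integral>\<^sup>+ys. h x ys \<partial>?R)"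
        by (simp only: map_pmf_chunks)
    qed
    then have "pok (Fill (sc aTK) ;; Step) (0 + round_queries) m1 Q \<phi> (\<integral>\<^sup>+ys. h x ys \<partial>?R)"
      by (rule pok_Seq) (use step[OF x] in blast)
    then show ?thesis by simp
  qed
  show ?thesis unfolding Round_def
  proof (rule pok_If)
    let ?x = "\<lambda>m1. row n m1 aX 0"
    have xr: "row n (write_row aX 0 x m) aX 0 = x" if "x \<in> cube n" for x
      using that by (intro nth_equalityI) (auto simp: write_row_def cube_def)
    have "pok (Sample aX (Const 0)) 1 m (\<lambda>m1. ?x m1 \<in> cube n \<and> m1 = write_row aX 0 (?x m1) m)
      (\<lambda>m1. \<integral>\<^sup>+ys. h (?x m1) ys \<partial>?R) u"
    proof (rule pok_Sample)
      fix x assume "x \<in> set_pmf D"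
      then have "x \<in> cube n" using samples by blast
      then show "?x (write_row aX (value_of m (Const 0)) x m) \<in> cube n \<and>
        write_row aX (value_of m (Const 0)) x m = write_row aX 0 (?x (write_row aX (value_of m (Const 0)) x m)) m"
        by (simp add: xr)
    next
      have "(\<integral>\<^sup>+x. \<integral>\<^sup>+ys. h (?x (write_row aX (value_of m (Const 0)) x m)) ys \<partial>?R \<partial>D) =
        (\<integral>\<^sup>+x. \<integral>\<^sup>+ys. h x ys \<partial>?R \<partial>D)"
        by (rule nn_integral_cong_AE) (use samples in \<open>auto simp: AE_measure_pmf_iff xr subset_iff\<close>)
      then show "(\<integral>\<^sup>+x. \<integral>\<^sup>+ys. h (?x (write_row aX (value_of m (Const 0)) x m)) ys \<partial>?R \<partial>D) \<le> u"
        using h by simp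
    qed
    then have "pok (Sample aX (Const 0) ;; Fill (sc aTK) ;; Step) (1 + round_queries) m Q \<phi> u"
      by (rule pok_Seq) (use fill in blast)
    then show "pok (Sample aX (Const 0) ;; Fill (sc aTK) ;; Step) (round_queries + 1) m Q \<phi> u"
      by (simp add: add.commute)
  qed (use m(2) in simp)
qed

definition potential :: "memory \<Rightarrow> ennreal" where
  "potential m = (if m aRej 0 = 0 then ennreal ((1/2) ^ m aNT 0) else 0)"

lemma outcome_hyp_ok: "outcome nt lits x ys m' \<Longrightarrow> m' aRej 0 = 0 \<Longrightarrow> \<exists>nt lits. hyp_ok m' nt lits"
  unfolding outcome_def by blast

text \<open>A good round keeps the number of terms; any other adds a term or rejects. The factors 1
  and \<open>1/2\<close> are written as \<open>(1 + indicator) / 2\<close>, so that integration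
  yields an expression linear in the probability of a good round.\<close>

lemma outcome_potential:
  assumes "outcome nt lits x ys m'"
  shows "potential m' \<le> ennreal ((1/2) ^ nt / 2) * (1 + indicator {(x, ys). good nt lits x ys} (x, ys))"
proof (cases "m' aRej 0 = 0")
  case True
  show ?thesis
  proof (cases "good nt lits x ys")
    case g: True
    then have "hyp_ok m' nt lits" using assms True by (auto simp: outcome_def)
    then have nt: "m' aNT 0 = nt" by (simp add: hyp_ok_def repr_def)
    have "ennreal ((1/2) ^ nt / 2) * (1 + 1) = ennreal ((1/2) ^ nt / 2 * 2)"
      unfolding one_add_one by (subst ennreal_mult) auto
    then show ?thesis using g True nt by (simp add: potential_def)
  next
    case False
    then obtain lits' where "hyp_ok m' (Suc nt) lits'" using assms True by (auto simp: outcome_def)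
    then have nt: "m' aNT 0 = Suc nt" by (simp add: hyp_ok_def repr_def)
    then show ?thesis using False True by (simp add: potential_def)
  qed
qed (simp add: potential_def)

lemma Round_sound:
  fixes E :: nat
  assumes far: "far_from D \<epsilon> f (monotone_DNF n s r)" and E: "1 / E \<le> \<epsilon>" "E \<ge> 2"
    and L2: "2 * (r * s) \<le> 2 ^ L"
    and m: "hyp_ok m nt lits" "m aRej 0 = 0"
    and post: "\<And>m'. frame roundW m m' \<Longrightarrow> m' aRej 0 = 0 \<Longrightarrow>
      \<exists>nt lits. hyp_ok m' nt lits \<Longrightarrow> Q m'"
    and rej: "\<And>m'. frame roundW m m' \<Longrightarrow> m' aRej 0 \<noteq> 0 \<Longrightarrow> params m' \<Longrightarrow> Q m'"
  shows "pok Round (round_queries + 1) m Q potential (ennreal (1 - 1 / (36 * real E)) * potential m)"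
proof -
  let ?R = "replicate_pmf (L + 2) (bits n)"
  let ?G = "{(x, ys). good nt lits x ys}"
  let ?a = "ennreal ((1/2) ^ nt / 2)"
  have sz: "nt \<le> s" "length lits \<le> r * s" "\<And>j. length (filter (\<lambda>l. fst l = j) lits) \<le> r"
    using m(1) hyp_ok_length by (auto simp: hyp_ok_def)
  have pr: "prob (pair_pmf D ?R) ?G \<le> 1 - 1 / (18 * real E)"
    unfolding good_def by (rule round_sound[OF far samples sz(1,3,2) L2 L E])
  have scaled: "ennreal a * (1 + ennreal p) = ennreal (a * (1 + p))" if "a \<ge> 0" "p \<ge> 0" for a p :: real
    using that by (simp add: ennreal_mult)
  have pot: "potential m = ennreal ((1/2) ^ nt)" using m by (simp add: potential_def hyp_ok_def repr_def)
  have "(\<integral>\<^sup>+x. \<integral>\<^sup>+ys. ?a * (1 + indicator ?G (x, ys)) \<partial>?R \<partial>D) =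
      (\<integral>\<^sup>+w. ?a * (1 + indicator ?G w) \<partial>(pair_pmf D ?R))"
    by (simp only: nn_integral_pair_pmf')
  also have "\<dots> = ?a * (1 + emeasure (measure_pmf (pair_pmf D ?R)) ?G)"
    by (simp add: nn_integral_cmult nn_integral_add)
  also have "\<dots> = ennreal ((1/2) ^ nt / 2 * (1 + prob (pair_pmf D ?R) ?G))"
    unfolding measure_pmf.emeasure_eq_measure by (rule scaled) simp_all
  also have "\<dots> \<le> ennreal ((1/2) ^ nt / 2 * (1 + (1 - 1 / (18 * real E))))"
    by (intro ennreal_leI mult_left_mono add_left_mono pr) simp
  \<comment> \<open>Averaging 1 with \<open>1 - 1 / (18 * E)\<close> halves the gap.\<close>
  also have "(1/2) ^ nt / 2 * (1 + (1 - 1 / (18 * real E))) = (1 - 1 / (36 * real E)) * (1/2) ^ nt"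
    using E(2) by (simp add: field_simps)
  also have "ennreal \<dots> = ennreal (1 - 1 / (36 * real E)) * potential m"
    unfolding pot using E(2) by (intro ennreal_mult) (auto simp: field_simps)
  finally show ?thesis
  proof (rule pok_Round[OF m, rotated])
    fix x ys m' assume fr: "frame roundW m m'" and p: "params m'"
      and o: "outcome nt lits x ys m'"
    have "Q m'"
    proof (cases "m' aRej 0 = 0")
      case True
      then show ?thesis using post[OF fr True outcome_hyp_ok[OF o True]] by blast
    next
      case False
      then show ?thesis using rej[OF fr False p] by blast
    qed
    then show "Q m' \<and> potential m' \<le> ?a * (1 + indicator ?G (x, ys))" using outcome_potential[OF o] by blast
  qed
qed

text \<open>Each reason for rejection is refuted: variables pass all tests, a faithful hypothesis
  has no false positives, an uncovered true sample leaves room for another term, and a full chain of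
  \<open>r\<close> labels already makes \<open>f\<close> true. So once the labels separate, a member
  is rejected with probability 0.\<close>

lemma Round_complete:
  fixes F
  assumes sep: "separated n s r f F lab" and r1: "r \<ge> 1"
    and m: "hyp_ok m nt lits" "m aRej 0 = 0" "separated.faithful n f F lab nt lits"
    and post: "\<And>m'. frame roundW m m' \<Longrightarrow> m' aRej 0 = 0 \<Longrightarrow>
      \<exists>nt lits. hyp_ok m' nt lits \<and> separated.faithful n f F lab nt lits \<Longrightarrow> Q m'"
  shows "pok Round (round_queries + 1) m Q (\<lambda>_. 0) 0"
proof (rule pok_Round[OF m(1,2), where h = "\<lambda>_ _. 0"])
  interpret separated n s r f F lab by (rule sep)
  fix x ys m' assume x: "x \<in> cube n" and ys: "set ys \<subseteq> cube n" "length ys = L + 2"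
    and fr: "frame roundW m m'"
    and o: "outcome nt lits x ys m'"
  have ys3: "length ys \<ge> 3" using ys(2) L by simp
  note ctx = m(3) x ys(1) ys3
  have pass: "\<forall>l\<in>set lits. lit_passes (g l) ys x" using faithful_passes[OF ctx] by blast
  have fp: "hyp_value g nt lits ys x \<Longrightarrow> f x" by (rule faithful_no_false_positive[OF ctx])
  have nr: "m' aRej 0 = 0"
  proof (rule ccontr)
    assume "m' aRej 0 \<noteq> 0"
    with o pass fp have h: "\<not> hyp_value g nt lits ys x" "f x"
      and c: "s \<le> nt \<or> (\<exists>bs. length bs = r \<and> block_chain n f lab x bs \<and> \<not> f (restr n lab x (set bs)))"
      unfolding outcome_def by blast+
    from faithful_room[OF ctx h] c obtain bs where
      "length bs = r" "block_chain n f lab x bs" "\<not> f (restr n lab x (set bs))" by auto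
    with block_chain_length[of x bs] r1 show False by blast
  qed
  have "\<exists>nt lits. hyp_ok m' nt lits \<and> faithful nt lits"
  proof (cases "good nt lits x ys")
    case True
    then show ?thesis using o nr m(3) unfolding outcome_def by blast
  next
    case False
    then obtain bs where bs: "block_chain n f lab x bs" "f (restr n lab x (set bs))"
      "hyp_ok m' (Suc nt) (lits @ new_literals n lab x nt bs)" "\<not> hyp_value g nt lits ys x"
      using o nr unfolding outcome_def by blast
    with faithful_extend[OF ctx bs(4,1,2)] show ?thesis by blast
  qed
  then show "Q m' \<and> 0 \<le> (0::ennreal)" using post[OF fr nr] by blast
qed simp

end


subsection \<open>The program: initialization and main loop\<close>

definition Loop :: com where
  "Loop = For cN (sc aN) Round ;; Put 0 (Const 0) (Minus (Const 1) (sc aRej))"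

text \<open>Repeated addition; the first factor is the iteration count and therefore has to stay
  below the loop bound.\<close>

definition Mul :: "nat \<Rightarrow> expr \<Rightarrow> expr \<Rightarrow> com" where
  "Mul a e1 e2 = setc a (Const 0) ;; For cM e1 (setc a (Plus (sc a) e2))"

definition Powers :: com where
  "Powers = For cI (sc aTarget) (If (Minus (sc aTarget) (sc aTotal))
     (Put aPow (sc aL) (sc aTotal) ;; setc aTotal (Plus (sc aTotal) (sc aTotal)) ;;
      setc aL (Plus (sc aL) (Const 1))) Skip)"

text \<open>\<open>aTarget\<close> becomes \<open>4 * (r * s)^2\<close>, the number of labels wanted
  for collision probability \<open>1/4\<close>; \<open>aTL\<close> and \<open>aTK\<close> are the
  tape lengths for labels and for one round, and \<open>aN\<close> is the number of rounds.\<close>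

definition Init :: com where
  "Init = Mul aRS in_r in_s ;; Mul aTarget (sc aRS) (sc aRS) ;;
     setc aTarget (Plus (sc aTarget) (sc aTarget)) ;; setc aTarget (Plus (sc aTarget) (sc aTarget)) ;;
     setc aTotal (Const 1) ;; setc aL (Const 0) ;; Powers ;;
     Mul aTL in_n (sc aL) ;; setc aTK (Plus (sc aTL) (Plus in_n in_n)) ;;
     Mul aP in_s in_E ;; Mul aN (Const 108) (sc aP)"

definition Decode :: com where
  "Decode = setc aP (Const 0) ;; For cV in_n (Put aLab (sc cV) (Const 0) ;;
     For cL (sc aL) (Put aLab (sc cV)
       (Plus (Plus (Get aLab (sc cV)) (Get aLab (sc cV))) (Get aTape (sc aP))) ;;
       setc aP (Plus (sc aP) (Const 1))))"

text \<open>The guard is 0 iff \<open>E <= 1\<close>, that is, for \<open>\<epsilon> >= 1\<close>;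
  accepting is then safe, as nothing is that far from both constants.\<close>

definition Tester :: com where
  "Tester = If (Minus in_E (Const 1)) (Init ;; Fill (sc aTL) ;; Decode ;; Loop) (Put 0 (Const 0) (Const 1))"

definition binary :: "bool list \<Rightarrow> nat" where
  "binary bs = foldl (\<lambda>a b. a + a + of_bool b) 0 bs"

lemma binary_snoc [simp]: "binary (bs @ [b]) = binary bs + binary bs + of_bool b"
  by (simp add: binary_def)

lemma binary_Nil [simp]: "binary [] = 0"
  by (simp add: binary_def)

lemma binary_less: "binary bs < 2 ^ length bs"
  by (induction bs rule: rev_induct) auto

lemma binary_inj: "length bs = length cs \<Longrightarrow> binary bs = binary cs \<Longrightarrow> bs = cs"
proof (induction bs arbitrary: cs rule: rev_induct)
  case (snoc b bs)
  then obtain c cs' where cs: "cs = cs' @ [c]" by (cases cs rule: rev_cases) auto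
  have eq: "2 * binary bs + of_bool b = 2 * binary cs' + of_bool c" using snoc.prems cs by simp
  then have "(2 * binary bs + of_bool b) mod 2 = (2 * binary cs' + of_bool c) mod 2" by simp
  then have "b = c" by (cases b; cases c) auto
  then show ?case using eq snoc cs by simp
qed simp

context machine
begin

lemma pok_scale:
  assumes "pok c q m Q \<phi> e"
  shows "pok c q m Q (\<lambda>m. k * \<phi> m) (k * e)"
  unfolding pok_def
proof (intro allI impI)
  fix \<sigma> :: config assume "mem \<sigma> = m"
  then obtain P where P: "exec n f D c \<sigma> P"
    "\<forall>\<sigma>'\<in>set_pmf P. Q (mem \<sigma>') \<and> steps \<sigma>' \<le> steps \<sigma> + cost B c \<and> queries \<sigma>' \<le> queries \<sigma> + q"
    "(\<integral>\<^sup>+\<sigma>'. \<phi> (mem \<sigma>') \<partial>P) \<le> e"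
    using assms unfolding pok_def by blast
  have "(\<integral>\<^sup>+\<sigma>'. k * \<phi> (mem \<sigma>') \<partial>P) = k * (\<integral>\<^sup>+\<sigma>'. \<phi> (mem \<sigma>') \<partial>P)"
    by (rule nn_integral_cmult) simp
  also have "\<dots> \<le> k * e" by (intro mult_left_mono P(3)) simp
  finally show "\<exists>P. exec n f D c \<sigma> P \<and>
     (\<forall>\<sigma>'\<in>set_pmf P. Q (mem \<sigma>') \<and> steps \<sigma>' \<le> steps \<sigma> + cost B c \<and> queries \<sigma>' \<le> queries \<sigma> + q) \<and>
     (\<integral>\<^sup>+\<sigma>'. k * \<phi> (mem \<sigma>') \<partial>P) \<le> k * e"
    using P(1,2) by blast
qed

lemma ok_Mul:
  assumes "k1 \<le> B" "a \<noteq> cM"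
    and e1: "\<And>m'. frame {a, cM} m m' \<Longrightarrow> value_of m' e1 = k1"
    and e2: "\<And>m'. frame {a, cM} m m' \<Longrightarrow> value_of m' e2 = k2"
  shows "ok (Mul a e1 e2) 0 m (\<lambda>m'. frame {a, cM} m m' \<and> m' a 0 = k1 * k2)"
proof -
  have "ok (Mul a e1 e2) (k1 * 0) m (\<lambda>m'. frame {a, cM} m m' \<and> m' a 0 = k1 * k2)"
    unfolding Mul_def
  proof (rule ok_Put_Seq, rule ok_For[where I = "\<lambda>i m'. frame {a, cM} m m' \<and> m' a 0 = i * k2"])
    fix i m' assume I: "frame {a, cM} m m' \<and> m' a 0 = i * k2" "m' cM 0 = i"
    show "value_of m' e1 = k1" using e1 I by simp
    show "ok (setc a (Plus (sc a) e2)) 0 m' (\<lambda>m''. m'' cM 0 = i \<and>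
        frame {a, cM} m (m''(cM := (m'' cM)(0 := Suc i))) \<and> (m''(cM := (m'' cM)(0 := Suc i))) a 0 = Suc i * k2)"
      by (rule ok_Put) (use I e2[of m'] assms(2) in auto)
  qed (use assms(1,2) in auto)
  then show ?thesis by simp
qed

definition prepared :: "memory \<Rightarrow> nat \<Rightarrow> nat \<Rightarrow> nat \<Rightarrow> nat \<Rightarrow> memory \<Rightarrow> bool" where
  "prepared m s r E L m' \<longleftrightarrow> frame {aRS, aTarget, aTotal, aL, aPow, aTL, aTK, aP, aN, cM, cI} m m' \<and>
     m' aL 0 = L \<and> m' aTotal 0 = 2 ^ L \<and> (\<forall>i<L. m' aPow i = 2 ^ i) \<and> m' aTL 0 = n * L \<and>
     m' aTK 0 = n * (L + 2) \<and> m' aN 0 = 108 * (s * E) \<and>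
     4 * (r * s * (r * s)) \<le> 2 ^ L \<and> 2 ^ L < 8 * (r * s * (r * s)) \<and> L \<le> 4 * (r * s * (r * s))"

lemma ok_Powers:
  assumes T: "m aTarget 0 = T" "T \<le> B" "T \<ge> 1" and m: "m aTotal 0 = 1" "m aL 0 = 0"
  shows "ok Powers 0 m (\<lambda>m'. frame {aTotal, aL, aPow, cI} m m' \<and> (\<exists>l. m' aL 0 = l \<and> m' aTotal 0 = 2 ^ l \<and>
    (\<forall>i<l. m' aPow i = 2 ^ i) \<and> T \<le> 2 ^ l \<and> 2 ^ l < 2 * T \<and> l \<le> T))"
proof -
  \<comment> \<open>The alternative \<open>l = i\<close> says that every iteration so far has
    doubled; at the end it gives \<open>T <= 2 ^ T\<close>, so \<open>T\<close> iterations
    suffice.\<close>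
  let ?I = "\<lambda>i m'. frame {aTotal, aL, aPow, cI} m m' \<and> (\<exists>l. m' aL 0 = l \<and> m' aTotal 0 = 2 ^ l \<and>
    (\<forall>i<l. m' aPow i = 2 ^ i) \<and> (T \<le> 2 ^ l \<or> l = i) \<and> 2 ^ l < 2 * T \<and> l \<le> i)"
  have "ok Powers (T * 0) m (\<lambda>m'. frame {aTotal, aL, aPow, cI} m m' \<and> (\<exists>l. m' aL 0 = l \<and> m' aTotal 0 = 2 ^ l \<and>
    (\<forall>i<l. m' aPow i = 2 ^ i) \<and> T \<le> 2 ^ l \<and> 2 ^ l < 2 * T \<and> l \<le> T))"
    unfolding Powers_def
  proof (rule ok_For[where I = ?I])
    fix i m' assume I: "?I i m'" "m' cI 0 = i"
    have T': "m' aTarget 0 = T" using I T(1) frameD[of "{aTotal, aL, aPow, cI}" m m' aTarget] by simp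
    then show "value_of m' (sc aTarget) = T" by simp
    show "ok (If (Minus (sc aTarget) (sc aTotal))
     (Put aPow (sc aL) (sc aTotal) ;; setc aTotal (Plus (sc aTotal) (sc aTotal)) ;;
      setc aL (Plus (sc aL) (Const 1))) Skip) 0 m'
      (\<lambda>m''. m'' cI 0 = i \<and> ?I (Suc i) (m''(cI := (m'' cI)(0 := Suc i))))"
    proof (rule ok_If)
      assume "value_of m' (Minus (sc aTarget) (sc aTotal)) \<noteq> 0"
      then show "ok (Put aPow (sc aL) (sc aTotal) ;; setc aTotal (Plus (sc aTotal) (sc aTotal)) ;;
          setc aL (Plus (sc aL) (Const 1))) 0 m'
        (\<lambda>m''. m'' cI 0 = i \<and> ?I (Suc i) (m''(cI := (m'' cI)(0 := Suc i))))"
        by (intro ok_Put_Seq ok_Put) (use I T' in \<open>auto simp: less_Suc_eq\<close>)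
    next
      assume "value_of m' (Minus (sc aTarget) (sc aTotal)) = 0"
      then show "ok Skip 0 m' (\<lambda>m''. m'' cI 0 = i \<and> ?I (Suc i) (m''(cI := (m'' cI)(0 := Suc i))))"
        by (intro ok_Skip) (use I T' in auto)
    qed
  next
    fix m' assume "?I T m'" "m' cI 0 = T"
    then show "frame {aTotal, aL, aPow, cI} m m' \<and> (\<exists>l. m' aL 0 = l \<and> m' aTotal 0 = 2 ^ l \<and>
      (\<forall>i<l. m' aPow i = 2 ^ i) \<and> T \<le> 2 ^ l \<and> 2 ^ l < 2 * T \<and> l \<le> T)"
      using less_exp[of T] by (auto simp: less_imp_le)
  qed (use T m in auto)
  then show ?thesis by simp
qed

lemma ok_Init:
  assumes m: "m 0 0 = n" "m 0 1 = s" "m 0 2 = r" "m 0 3 = E"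
    and B: "r \<le> B" "s \<le> B" "4 * (r * s * (r * s)) \<le> B" "108 \<le> B" and pos: "r \<ge> 1" "s \<ge> 1"
  shows "ok Init 0 m (\<lambda>m'. \<exists>L. prepared m s r E L m')"
proof -
  let ?T = "4 * (r * s * (r * s))"
  have rs: "r * s \<le> B" using B(3) by (cases "r * s") auto
  have T1: "?T \<ge> 1" using pos by simp
  have inp: "m' 0 = m 0" if "frame A m m'" "0 \<notin> A" for A m' by (rule frameD[OF that])
  have 1: "ok (Mul aRS in_r in_s) 0 m (\<lambda>m'. frame {aRS, cM} m m' \<and> m' aRS 0 = r * s)"
  proof (rule ok_Mul)
    fix m' assume "frame {aRS, cM} m m'"
    then have "m' 0 = m 0" by (rule frameD) simp
    then show "value_of m' in_r = r" "value_of m' in_s = s" using m by simp_all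
  qed (use B in auto)
  have 2: "ok (Mul aTarget (sc aRS) (sc aRS)) 0 m1 (\<lambda>m'. frame {aRS, aTarget, cM} m m' \<and> m' aTarget 0 = r * s * (r * s))"
    if m1: "frame {aRS, cM} m m1 \<and> m1 aRS 0 = r * s" for m1
  proof (rule ok_weaken[OF ok_Mul])
    fix m' assume "frame {aTarget, cM} m1 m' \<and> m' aTarget 0 = r * s * (r * s)"
    then show "frame {aRS, aTarget, cM} m m' \<and> m' aTarget 0 = r * s * (r * s)"
      using m1 by (auto simp: frame_def)
  next
    fix m' assume "frame {aTarget, cM} m1 m'"
    then have "m' aRS = m1 aRS" by (rule frameD) simp
    then show "value_of m' (sc aRS) = r * s" using m1 by simp
    then show "value_of m' (sc aRS) = r * s" .
  qed (use rs in auto)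
  let ?P = "\<lambda>m'. frame {aRS, aTarget, aTotal, aL, aPow, cM, cI} m m' \<and> (\<exists>l. m' aL 0 = l \<and> m' aTotal 0 = 2 ^ l \<and>
    (\<forall>i<l. m' aPow i = 2 ^ i) \<and> ?T \<le> 2 ^ l \<and> 2 ^ l < 2 * ?T \<and> l \<le> ?T)"
  have 3: "ok Powers 0 m3 ?P" if m3: "frame {aRS, aTarget, aTotal, aL, cM} m m3" "m3 aTarget 0 = ?T"
    "m3 aTotal 0 = 1" "m3 aL 0 = 0" for m3
  proof (rule ok_weaken[OF ok_Powers[where m = m3 and T = ?T, OF m3(2) B(3) T1 m3(3,4)]])
    fix m' assume m': "frame {aTotal, aL, aPow, cI} m3 m' \<and> (\<exists>l. m' aL 0 = l \<and> m' aTotal 0 = 2 ^ l \<and>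
      (\<forall>i<l. m' aPow i = 2 ^ i) \<and> ?T \<le> 2 ^ l \<and> 2 ^ l < 2 * ?T \<and> l \<le> ?T)"
    have "frame {aRS, aTarget, aTotal, aL, aPow, cM, cI} m m'"
      by (rule frame_trans[OF m3(1) conjunct1[OF m']]) auto
    then show "?P m'" using m' by blast
  qed simp
  have 4: "ok (Mul aTL in_n (sc aL)) 0 m4 (\<lambda>m'. frame {aTL, cM} m4 m' \<and> m' aTL 0 = n * m4 aL 0)"
    if m4: "?P m4" for m4
  proof (rule ok_Mul)
    fix m' assume fr: "frame {aTL, cM} m4 m'"
    have "m4 0 = m 0" by (rule inp[OF conjunct1[OF m4]]) simp
    then show "value_of m' in_n = n" using frameD[OF fr, of 0] m(1) by simp
    show "value_of m' (sc aL) = m4 aL 0" using frameD[OF fr, of aL] by simp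
  qed (use n_le in auto)
  have 5: "ok (Mul aP in_s in_E) 0 m5 (\<lambda>m'. frame {aP, cM} m5 m' \<and> m' aP 0 = s * E)"
    if m5: "m5 0 = m 0" for m5
  proof (rule ok_Mul)
    fix m' assume fr: "frame {aP, cM} m5 m'"
    show "value_of m' in_s = s" "value_of m' in_E = E" using frameD[OF fr, of 0] m m5 by simp_all
  qed (use B in auto)
  have 6: "ok (Mul aN (Const 108) (sc aP)) 0 m6 (\<lambda>m'. frame {aN, cM} m6 m' \<and> m' aN 0 = 108 * (s * E))"
    if m6: "m6 aP 0 = s * E" for m6
  proof (rule ok_Mul)
    fix m' assume fr: "frame {aN, cM} m6 m'"
    show "value_of m' (sc aP) = s * E" using frameD[OF fr, of aP] m6 by simp
  qed (use B in auto)
  have tail: "ok (Mul aTL in_n (sc aL) ;; setc aTK (Plus (sc aTL) (Plus in_n in_n)) ;;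
     Mul aP in_s in_E ;; Mul aN (Const 108) (sc aP)) 0 m4 (\<lambda>m'. \<exists>L. prepared m s r E L m')"
    if m4: "?P m4" for m4
  proof (rule ok_SeqI[OF 4[OF m4]])
    fix m5 assume m5: "frame {aTL, cM} m4 m5 \<and> m5 aTL 0 = n * m4 aL 0"
    let ?m6 = "m5(aTK := (m5 aTK)(0 := n * m4 aL 0 + (n + n)))"
    have "m4 0 = m 0" by (rule inp[OF conjunct1[OF m4]]) simp
    then have z: "m5 0 = m 0" using m5 frameD[of _ m4 m5 0] by auto
    then have n5: "m5 0 0 = n" using m(1) by simp
    show "ok (setc aTK (Plus (sc aTL) (Plus in_n in_n)) ;; Mul aP in_s in_E ;; Mul aN (Const 108) (sc aP)) 0 m5
       (\<lambda>m'. \<exists>L. prepared m s r E L m')"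
    proof (rule ok_Put_Seq)
      have eq: "m5(aTK := (m5 aTK)(value_of m5 (Const 0) := value_of m5 (Plus (sc aTL) (Plus in_n in_n)))) = ?m6"
        using m5 n5 by simp
      have "ok (Mul aP in_s in_E ;; Mul aN (Const 108) (sc aP)) 0 ?m6 (\<lambda>m'. \<exists>L. prepared m s r E L m')"
      proof (rule ok_SeqI[OF 5])
        show "?m6 0 = m 0" using z by simp
        fix m7 assume m7: "frame {aP, cM} ?m6 m7 \<and> m7 aP 0 = s * E"
        show "ok (Mul aN (Const 108) (sc aP)) 0 m7 (\<lambda>m'. \<exists>L. prepared m s r E L m')"
        proof (rule ok_weaken[OF 6[of m7, OF conjunct2[OF m7]]])
          fix m8 assume m8: "frame {aN, cM} m7 m8 \<and> m8 aN 0 = 108 * (s * E)"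
          have e: "m8 aL = m4 aL" "m8 aTotal = m4 aTotal" "m8 aPow = m4 aPow" "m8 aTL = m5 aTL"
            "m8 aTK = ?m6 aTK"
            using m5 m7 m8 by (auto simp: frame_def)
          have "frame {aRS, aTarget, aTotal, aL, aPow, aTL, aTK, aP, aN, cM, cI} m m8"
            using m4 m5 m7 m8 by (auto simp: frame_def)
          then have "prepared m s r E (m4 aL 0) m8"
            unfolding prepared_def e using m4 m5 m8 by (auto simp: algebra_simps)
          then show "\<exists>L. prepared m s r E L m8" ..
        qed simp
      qed simp
      then show "ok (Mul aP in_s in_E ;; Mul aN (Const 108) (sc aP)) 0
        (m5(aTK := (m5 aTK)(value_of m5 (Const 0) := value_of m5 (Plus (sc aTL) (Plus in_n in_n)))))
        (\<lambda>m'. \<exists>L. prepared m s r E L m')" unfolding eq .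
    qed
  qed simp
  show ?thesis unfolding Init_def
  proof (rule ok_SeqI[OF 1 ok_SeqI[OF 2]])
    fix m2 assume m2: "frame {aRS, aTarget, cM} m m2 \<and> m2 aTarget 0 = r * s * (r * s)"
    show "ok (setc aTarget (Plus (sc aTarget) (sc aTarget)) ;; setc aTarget (Plus (sc aTarget) (sc aTarget)) ;;
     setc aTotal (Const 1) ;; setc aL (Const 0) ;; Powers ;;
     Mul aTL in_n (sc aL) ;; setc aTK (Plus (sc aTL) (Plus in_n in_n)) ;;
     Mul aP in_s in_E ;; Mul aN (Const 108) (sc aP)) 0 m2 (\<lambda>m'. \<exists>L. prepared m s r E L m')"
    proof (rule ok_Put_Seq, rule ok_Put_Seq, rule ok_Put_Seq, rule ok_Put_Seq, rule ok_SeqI[OF 3 tail])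
    qed (use m2 in \<open>auto simp: frame_def\<close>)
  qed auto
qed

lemma ok_Decode:
  assumes m: "m 0 0 = n" "m aL 0 = L" "L \<le> B"
    and bs: "length bs = L * n" "\<And>i. i < L * n \<Longrightarrow> m aTape i = of_bool (bs ! i)"
  shows "ok Decode 0 m (\<lambda>m'. frame {aP, cV, cL, aLab} m m' \<and> (\<forall>v<n. m' aLab v = binary (chunks n L bs ! v)))"
proof -
  let ?c = "chunks n L bs"
  let ?A = "{aP, cV, cL, aLab}"
  let ?I = "\<lambda>i m'. frame ?A m m' \<and> m' aP 0 = i * L \<and> (\<forall>v<i. m' aLab v = binary (?c ! v))"
  let ?body = "Put aLab (sc cV) (Plus (Plus (Get aLab (sc cV)) (Get aLab (sc cV))) (Get aTape (sc aP))) ;;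
       setc aP (Plus (sc aP) (Const 1))"
  have "ok Decode (n * (L * 0)) m (\<lambda>m'. frame ?A m m' \<and> (\<forall>v<n. m' aLab v = binary (?c ! v)))"
    unfolding Decode_def
  proof (rule ok_Put_Seq, rule ok_For[where I = ?I])
    fix i m1 assume I: "?I i m1" "m1 cV 0 = i"
    show "value_of m1 in_n = n" using I m(1) frameD[of ?A m m1 0] by simp
    assume i: "i < n"
    let ?m2 = "m1(aLab := (m1 aLab)(value_of m1 (sc cV) := value_of m1 (Const 0)))"
    let ?J = "\<lambda>l m'. frame ?A m m' \<and> m' cV 0 = i \<and> m' aP 0 = i * L + l \<and> (\<forall>v<i. m' aLab v = binary (?c ! v)) \<and>
      m' aLab i = binary (take l (?c ! i))"
    show "ok (Put aLab (sc cV) (Const 0) ;; For cL (sc aL) ?body) (L * 0) m1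
      (\<lambda>m''. m'' cV 0 = i \<and> ?I (Suc i) (m''(cV := (m'' cV)(0 := Suc i))))"
    proof (rule ok_Put_Seq, rule ok_For[where I = ?J])
      show "?J 0 (?m2(cL := (?m2 cL)(0 := 0)))" using I by auto
      show "L \<le> B" by fact
      fix l m' assume J: "?J l m'" "m' cL 0 = l"
      show "value_of m' (sc aL) = L" using J m(2) frameD[of ?A m m' aL] by simp
      assume l: "l < L"
      have "i * L + l < L * n"
      proof -
        have "i * L + l < Suc i * L" using l by simp
        also have "\<dots> \<le> n * L" using i by (intro mult_right_mono) auto
        finally show ?thesis by (simp add: mult.commute)
      qed
      then have "m aTape (i * L + l) = of_bool (?c ! i ! l)"
        using bs chunks_nth[OF bs(1) i] l by simp
      moreover have "m' aTape = m aTape" using J frameD[of ?A m m' aTape] by simp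
      moreover have "take (Suc l) (?c ! i) = take l (?c ! i) @ [?c ! i ! l]"
        using chunks_nth(1)[OF bs(1) i] l by (simp add: take_Suc_conv_app_nth)
      ultimately show "ok ?body 0 m' (\<lambda>m''. m'' cL 0 = l \<and> ?J (Suc l) (m''(cL := (m'' cL)(0 := Suc l))))"
        by (intro ok_Put_Seq ok_Put) (use J in auto)
    next
      fix m' assume J: "?J L m'"
      have "take L (?c ! i) = ?c ! i" using chunks_nth(1)[OF bs(1) i] by simp
      then show "m' cV 0 = i \<and> ?I (Suc i) (m'(cV := (m' cV)(0 := Suc i)))"
        using J by (auto simp: less_Suc_eq)
    qed
  qed (use n_le in auto)
  then show ?thesis by simp
qed

end

context program_run
begin

lemma hyp_ok_frame:
  assumes "hyp_ok m nt lits" "frame A m m'"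
    "A \<inter> {0, aL, aPow, aTotal, aLab, aTK, aNT, aNL, aLT, aLB, aLW, aW, aWP} = {}"
  shows "hyp_ok m' nt lits"
proof -
  have "params m'" by (rule params_frame[OF _ assms(2)]) (use assms in \<open>auto simp: hyp_ok_def\<close>)
  moreover have "repr m' nt lits" by (rule repr_frame[OF _ assms(2)]) (use assms in \<open>auto simp: hyp_ok_def\<close>)
  ultimately show ?thesis using assms(1) by (simp add: hyp_ok_def)
qed

lemma hyp_ok_counter [simp]: "hyp_ok (m(cN := w)) nt lits = hyp_ok m nt lits"
proof
  have fr: "frame {cN} (m(cN := w)) m" by (simp add: frame_def)
  show "hyp_ok m nt lits" if "hyp_ok (m(cN := w)) nt lits" by (rule hyp_ok_frame[OF that fr]) simp
  show "hyp_ok (m(cN := w)) nt lits" if "hyp_ok m nt lits" by (rule hyp_ok_frame[OF that, of "{cN}"]) simp_all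
qed

context
  fixes m0 :: memory and N :: nat
  assumes start: "hyp_ok m0 0 []" "m0 aRej 0 = 0" and N: "m0 aN 0 = N" "N \<le> B"
begin

text \<open>Termination and resource bounds only. It covers the outcomes whose error is bounded
  trivially: colliding labels, and functions neither in the class nor far from it.\<close>

lemma Loop_run: "pok Loop (N * (round_queries + 1)) m0 (\<lambda>_. True) (\<lambda>_. 0) 0"
proof -
  let ?I = "\<lambda>i m. m aN 0 = N \<and> (m aRej 0 = 0 \<longrightarrow> (\<exists>nt lits. hyp_ok m nt lits))"
  have body: "pok Round (round_queries + 1) m (\<lambda>m'. m' cN 0 = i \<and> ?I (Suc i) (m'(cN := (m' cN)(0 := Suc i)))) (\<lambda>_. 0) 0"
    if I: "?I i m" "m cN 0 = i" for i m
  proof (cases "m aRej 0 = 0")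
    case True
    then obtain nt lits where h: "hyp_ok m nt lits" using I by blast
    show ?thesis
    proof (rule pok_Round[OF h True, where h = "\<lambda>_ _. 0"])
      fix x ys m' assume fr: "frame roundW m m'"
        and o: "outcome nt lits x ys m'"
      have "m' cN = m cN" "m' aN = m aN" by (rule frameD[OF fr]; simp)+
      then show "(m' cN 0 = i \<and> ?I (Suc i) (m'(cN := (m' cN)(0 := Suc i)))) \<and> 0 \<le> (0::ennreal)"
        using I outcome_hyp_ok[OF o] by simp
    qed simp
  next
    case False
    have "pok Skip 0 m (\<lambda>m'. m' cN 0 = i \<and> ?I (Suc i) (m'(cN := (m' cN)(0 := Suc i)))) (\<lambda>_. 0) 0"
      by (rule pok_Skip) (use I False in auto)
    then have "pok Skip (round_queries + 1) m (\<lambda>m'. m' cN 0 = i \<and> ?I (Suc i) (m'(cN := (m' cN)(0 := Suc i)))) (\<lambda>_. 0) 0"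
      by (rule pok_weaken) auto
    then show ?thesis unfolding Round_def by (intro pok_If) (use False in auto)
  qed
  have "pok (For cN (sc aN) Round) (N * (round_queries + 1)) m0 (\<lambda>_. True) (\<lambda>_. 0) 0"
    by (rule pok_For[where I = ?I and \<psi> = "\<lambda>_ _. 0"]) (use N start body in auto)
  then have "pok Loop (N * (round_queries + 1) + 0) m0 (\<lambda>_. True) (\<lambda>_. 0) 0"
    unfolding Loop_def by (rule pok_Seq) (rule pok_Put, auto)
  then show ?thesis by simp
qed

lemma Loop_complete:
  assumes sep: "separated n s r f F lab" and r1: "r \<ge> 1"
  shows "pok Loop (N * (round_queries + 1)) m0 (\<lambda>_. True) (\<lambda>m. indicator {m. m 0 0 = 0} m) 0"
proof -
  let ?I = "\<lambda>i m. m aN 0 = N \<and> m aRej 0 = 0 \<and> (\<exists>nt lits. hyp_ok m nt lits \<and> separated.faithful n f F lab nt lits)"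
  have body: "pok Round (round_queries + 1) m (\<lambda>m'. m' cN 0 = i \<and> ?I (Suc i) (m'(cN := (m' cN)(0 := Suc i)))) (\<lambda>_. 0) 0"
    if I: "?I i m" "m cN 0 = i" for i m
  proof -
    obtain nt lits where h: "hyp_ok m nt lits" "m aRej 0 = 0" "separated.faithful n f F lab nt lits"
      using I by blast
    show ?thesis
    proof (rule Round_complete[OF sep r1 h])
      fix m' assume fr: "frame roundW m m'" and "m' aRej 0 = 0"
        "\<exists>nt lits. hyp_ok m' nt lits \<and> separated.faithful n f F lab nt lits"
      moreover have "m' cN = m cN" "m' aN = m aN" by (rule frameD[OF fr]; simp)+
      ultimately show "m' cN 0 = i \<and> ?I (Suc i) (m'(cN := (m' cN)(0 := Suc i)))" using I by simp
    qed
  qed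
  have "pok (For cN (sc aN) Round) (N * (round_queries + 1)) m0 (\<lambda>m. m aRej 0 = 0) (\<lambda>_. 0) 0"
    by (rule pok_For[where I = ?I and \<psi> = "\<lambda>_ _. 0"])
       (use N start body separated.faithful_empty[OF sep] in auto)
  then have "pok Loop (N * (round_queries + 1) + 0) m0 (\<lambda>_. True) (\<lambda>m. indicator {m. m 0 0 = 0} m) 0"
    unfolding Loop_def by (rule pok_Seq) (rule pok_Put, auto)
  then show ?thesis by simp
qed

lemma Loop_sound:
  fixes E :: nat
  assumes far: "far_from D \<epsilon> f (monotone_DNF n s r)" and E: "1 / E \<le> \<epsilon>" "E \<ge> 2"
    and L2: "2 * (r * s) \<le> 2 ^ L"
  shows "pok Loop (N * (round_queries + 1)) m0 (\<lambda>_. True) (\<lambda>m. indicator {m. m 0 0 \<noteq> 0} m)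
    (ennreal (2 ^ s * (1 - 1 / (36 * real E)) ^ N))"
proof -
  define c where "c = 1 - 1 / (36 * real E)"
  have c0: "c \<ge> 0" using E(2) by (simp add: c_def field_simps)
  let ?I = "\<lambda>i m. m aN 0 = N \<and> (m aRej 0 = 0 \<longrightarrow> (\<exists>nt lits. hyp_ok m nt lits))"
  \<comment> \<open>The potential, discounted by the decay still to come and scaled by
    \<open>2 ^ s\<close>, so that at the end it is at least 1 unless the run has rejected.\<close>
  let ?\<psi> = "\<lambda>i m. ennreal (2 ^ s * c ^ (N - i)) * potential m"
  have body: "pok Round (round_queries + 1) m (\<lambda>m'. m' cN 0 = i \<and> ?I (Suc i) (m'(cN := (m' cN)(0 := Suc i))))
      (\<lambda>m'. ?\<psi> (Suc i) (m'(cN := (m' cN)(0 := Suc i)))) (?\<psi> i m)"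
    if i: "i < N" and I: "?I i m" "m cN 0 = i" for i m
  proof (cases "m aRej 0 = 0")
    case True
    then obtain nt lits where h: "hyp_ok m nt lits" using I by blast
    have "pok Round (round_queries + 1) m (\<lambda>m'. m' cN 0 = i \<and> ?I (Suc i) (m'(cN := (m' cN)(0 := Suc i))))
        potential (ennreal c * potential m)"
      unfolding c_def
    proof (rule Round_sound[OF far E L2 h True])
      fix m' assume fr: "frame roundW m m'"
      have e: "m' cN = m cN" "m' aN = m aN" by (rule frameD[OF fr]; simp)+
      show "m' cN 0 = i \<and> ?I (Suc i) (m'(cN := (m' cN)(0 := Suc i)))"
        if "\<exists>nt lits. hyp_ok m' nt lits" using I e that by simp
      show "m' cN 0 = i \<and> ?I (Suc i) (m'(cN := (m' cN)(0 := Suc i)))"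
        if "m' aRej 0 \<noteq> 0" using I e that by simp
    qed
    from pok_scale[OF this, of "ennreal (2 ^ s * c ^ (N - Suc i))"]
    show ?thesis
    proof (rule pok_weaken)
      have "N - i = Suc (N - Suc i)" using i by simp
      then have "2 ^ s * c ^ (N - i) = (2 ^ s * c ^ (N - Suc i)) * c" by (simp only: power_Suc mult_ac)
      then have "ennreal (2 ^ s * c ^ (N - i)) = ennreal (2 ^ s * c ^ (N - Suc i)) * ennreal c"
        using c0 by (simp only: ennreal_mult mult_nonneg_nonneg zero_le_power zero_le_numeral)
      then show "ennreal (2 ^ s * c ^ (N - Suc i)) * (ennreal c * potential m) \<le> ?\<psi> i m"
        by (simp add: mult.assoc[symmetric])
    qed (auto simp: potential_def)
  next
    case False
    have "pok Skip 0 m (\<lambda>m'. m' cN 0 = i \<and> ?I (Suc i) (m'(cN := (m' cN)(0 := Suc i))))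
      (\<lambda>m'. ?\<psi> (Suc i) (m'(cN := (m' cN)(0 := Suc i)))) (?\<psi> i m)"
      by (rule pok_Skip) (use I False in \<open>auto simp: potential_def\<close>)
    then have "pok Skip (round_queries + 1) m (\<lambda>m'. m' cN 0 = i \<and> ?I (Suc i) (m'(cN := (m' cN)(0 := Suc i))))
      (\<lambda>m'. ?\<psi> (Suc i) (m'(cN := (m' cN)(0 := Suc i)))) (?\<psi> i m)"
      by (rule pok_weaken) auto
    then show ?thesis unfolding Round_def by (intro pok_If) (use False in auto)
  qed
  have "pok (For cN (sc aN) Round) (N * (round_queries + 1)) m0 (\<lambda>m. ?I N m) (?\<psi> N) (ennreal (2 ^ s * c ^ N))"
  proof (rule pok_For[where I = ?I and \<psi> = ?\<psi>])
    have "m0 aNT 0 = 0" using start(1) by (simp add: hyp_ok_def repr_def)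
    then show "?\<psi> 0 (m0(cN := (m0 cN)(0 := 0))) \<le> ennreal (2 ^ s * c ^ N)"
      using start(2) by (simp add: potential_def)
    show "?I 0 (m0(cN := (m0 cN)(0 := 0)))" using start N by auto
  qed (use N body in auto)
  then have "pok Loop (N * (round_queries + 1) + 0) m0 (\<lambda>_. True) (\<lambda>m. indicator {m. m 0 0 \<noteq> 0} m) (ennreal (2 ^ s * c ^ N))"
    unfolding Loop_def
  proof (rule pok_Seq)
    fix m assume I: "?I N m"
    show "pok (Put 0 (Const 0) (Minus (Const 1) (sc aRej))) 0 m (\<lambda>_. True) (\<lambda>m. indicator {m. m 0 0 \<noteq> 0} m) (?\<psi> N m)"
    proof (rule pok_Put)
      show "indicator {m. m 0 0 \<noteq> 0} (m(0 := (m 0)(value_of m (Const 0) := value_of m (Minus (Const 1) (sc aRej))))) \<le> ?\<psi> N m"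
      proof (cases "m aRej 0 = 0")
        case True
        with I obtain nt lits where "hyp_ok m nt lits" by blast
        then have nt: "m aNT 0 \<le> s" by (simp add: hyp_ok_def repr_def)
        \<comment> \<open>A surviving hypothesis has at most \<open>s\<close> terms, hence the
          scaled potential dominates the indicator of acceptance.\<close>
        have "(1::real) \<le> 2 ^ s * (1/2) ^ m aNT 0"
        proof -
          have "(2::real) ^ m aNT 0 \<le> 2 ^ s" using nt by (intro power_increasing) auto
          then show ?thesis by (simp add: power_divide field_simps)
        qed
        then have "1 \<le> ennreal (2 ^ s) * ennreal ((1/2) ^ m aNT 0)"
          by (subst ennreal_mult[symmetric]) (simp_all only: zero_le_power zero_le_numeral
            zero_le_divide_1_iff ennreal_1[symmetric] ennreal_leI)
        then show ?thesis using True by (simp add: potential_def)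
      qed simp
    qed simp
  qed
  then show ?thesis by (simp add: c_def)
qed

end

end


subsection \<open>The tester\<close>

text \<open>The indicator of a wrong verdict, and 0 where no verdict is prescribed; one expectation
  bound then expresses both guarantees.\<close>

definition error :: "nat \<Rightarrow> (bool list \<Rightarrow> bool) \<Rightarrow> bool list pmf \<Rightarrow> nat \<Rightarrow> nat \<Rightarrow> real \<Rightarrow> memory \<Rightarrow> ennreal" where
  "error n f D s r \<epsilon> m = (if f \<in> monotone_DNF n s r then indicator {m. m 0 0 = 0} m
     else if far_from D \<epsilon> f (monotone_DNF n s r) then indicator {m. m 0 0 \<noteq> 0} m else 0)"

lemma error_le_1: "error n f D s r \<epsilon> m \<le> 1"
  by (simp add: error_def indicator_def)

text \<open>From \<open>1 - t <= exp (-t)\<close> the product is at most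
  \<open>(2 * exp (-3)) ^ s\<close>. Since \<open>exp 1 >= 2\<close>, this is at most
  \<open>2/8\<close>.\<close>

lemma power_decay_le:
  fixes E s :: nat
  assumes "E \<ge> 2" "s \<ge> 1"
  shows "2 ^ s * (1 - 1 / (36 * real E)) ^ (108 * (s * E)) \<le> 1 / 3"
proof -
  have "(1 - 1 / (36 * real E)) ^ (108 * (s * E)) \<le> exp (- 1 / (36 * real E)) ^ (108 * (s * E))"
    using assms(1) exp_ge_add_one_self[of "- 1 / (36 * real E)"]
    by (intro power_mono) (auto simp: field_simps)
  also have "\<dots> = exp (real (108 * (s * E)) * (- 1 / (36 * real E)))"
    by (rule exp_of_nat_mult[symmetric])
  also have "real (108 * (s * E)) * (- 1 / (36 * real E)) = real s * - 3"
    using assms(1) by (simp add: field_simps)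
  also have "exp (real s * - 3) = exp (- 3) ^ s" by (rule exp_of_nat_mult)
  finally have "2 ^ s * (1 - 1 / (36 * real E)) ^ (108 * (s * E)) \<le> 2 ^ s * exp (- 3) ^ s"
    by (intro mult_left_mono) auto
  also have "\<dots> = (2 * exp (- 3)) ^ s" by (simp add: power_mult_distrib)
  also have "\<dots> \<le> (2 * exp (- 3)) ^ 1"
  proof (rule power_decreasing)
    show "2 * exp (- 3) \<le> (1::real)" using exp_ge_add_one_self[of "3::real"] by (simp add: exp_minus field_simps)
  qed (use assms(2) in auto)
  also have "\<dots> \<le> 1 / 3"
  proof -
    have "(2::real) ^ 3 \<le> exp 1 ^ 3" using exp_ge_add_one_self[of "1::real"] by (intro power_mono) auto
    then have "8 \<le> exp (3::real)" by (simp flip: exp_of_nat_mult)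
    then show ?thesis by (simp add: exp_minus field_simps)
  qed
  finally show ?thesis .
qed

context machine
begin

lemma pok_Loop:
  fixes m :: memory and s r E L :: nat
  assumes prep: "prepared m s r E L m1" and m3: "frame {aTape, cF, aP, cV, cL, aLab} m1 m3"
    and lab: "\<And>v. v < n \<Longrightarrow> m3 aLab v < 2 ^ L"
    and m: "m 0 0 = n" "m 0 1 = s" "m 0 2 = r" "\<And>a. a \<noteq> 0 \<Longrightarrow> m a = (\<lambda>_. 0)"
    and D: "set_pmf D \<subseteq> cube n" and E: "E \<ge> 2" "1 / E \<le> \<epsilon>" and pos: "s \<ge> 1" "r \<ge> 1"
    and B: "4 * (r * s * (r * s)) \<le> B" "s \<le> B" "r \<le> B" "108 * (s * E) \<le> B"
      "n * (4 * (r * s * (r * s)) + 2) \<le> B"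
    and q: "108 * (s * E) * (r * s * (2 * L + 5) + r * (1 + L) + 3) \<le> q"
    and F: "f \<in> monotone_DNF n s r \<Longrightarrow> F \<subseteq> Pow {..<n} \<and> card F \<le> s \<and> (\<forall>T\<in>F. card T \<le> r) \<and>
      (\<forall>x\<in>cube n. f x \<longleftrightarrow> (\<exists>T\<in>F. \<forall>i\<in>T. x ! i))"
  shows "pok Loop q m3 (\<lambda>_. True) (error n f D s r \<epsilon>)
    (if f \<in> monotone_DNF n s r then indicator {m. \<not> inj_on (m aLab) (\<Union>F)} m3 else ennreal (1/3))"
proof -
  let ?T = "4 * (r * s * (r * s))"
  have LT: "L \<le> ?T" "?T \<le> 2 ^ L" using prep by (simp_all add: prepared_def)
  \<comment> \<open>A target of at least 4 forces \<open>L >= 1\<close>, so that there is at least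
    one vote and a third row on the tape.\<close>
  have "r * s * (r * s) > 0" using pos by simp
  then have "\<not> ?T \<le> 1" by linarith
  then have L1: "L \<ge> 1" using LT(2) by (cases L) simp_all
  have rs: "r * s \<le> B" using B(1) by (cases "r * s") auto
  \<comment> \<open>The labels have been drawn, so within the locale they are a fixed function;
    their randomness is handled by the caller.\<close>
  interpret program_run n f D B s r L "m3 aLab"
  proof unfold_locales
    have "n * (L + 2) \<le> n * (?T + 2)" using LT(1) by (intro mult_left_mono) auto
    then show "n * (L + 2) \<le> B" using B(5) by linarith
  qed (use lab LT(1) B L1 D rs in auto)
  have fr1: "frame {aRS, aTarget, aTotal, aL, aPow, aTL, aTK, aP, aN, cM, cI} m m1"
    using prep by (simp add: prepared_def)
  have e3: "m3 aL = m1 aL" "m3 aTotal = m1 aTotal" "m3 aPow = m1 aPow" "m3 aTK = m1 aTK" "m3 aN = m1 aN"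
    by (rule frameD[OF m3]; simp)+
  have e0: "m3 0 = m 0" "m3 aNT = m aNT" "m3 aNL = m aNL" "m3 aRej = m aRej"
    using m3 fr1 by (auto simp: frame_def)
  have par: "params m3"
    using prep unfolding params_def e3 e0 prepared_def using m by simp
  have start: "hyp_ok m3 0 []" "m3 aRej 0 = 0"
    using par by (simp_all add: hyp_ok_def repr_def e0 m)
  have N: "m3 aN 0 = 108 * (s * E)" using prep by (simp add: e3 prepared_def)
  have qq: "108 * (s * E) * (round_queries + 1) \<le> q"
  proof -
    have "round_queries + 1 = r * s * (2 * L + 5) + r * (1 + L) + 3" by (simp add: round_queries_def)
    with q show ?thesis by (simp only:)
  qed
  note loop = start N B(4)
  have trivial: "pok Loop q m3 (\<lambda>_. True) \<phi> e" if "\<And>m. \<phi> m \<le> e" for \<phi> e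
  proof -
    have "ok Loop q m3 (\<lambda>_. True)"
      unfolding ok_def using Loop_run[OF loop] by (rule pok_weaken) (use qq in auto)
    then show ?thesis by (rule pok_of_ok) (rule that)
  qed
  show ?thesis
  proof (cases "f \<in> monotone_DNF n s r")
    case True
    show ?thesis
    proof (cases "inj_on (m3 aLab) (\<Union>F)")
      case inj: True
      have sep: "separated n s r f F (m3 aLab)" using F[OF True] inj by unfold_locales auto
      from Loop_complete[OF loop sep pos(2)] show ?thesis
        by (rule pok_weaken) (use True inj qq in \<open>auto simp: error_def\<close>)
    next
      case False
      then show ?thesis using True by (intro trivial) (simp add: error_le_1)
    qed
  next
    case nC: False
    show ?thesis
    proof (cases "far_from D \<epsilon> f (monotone_DNF n s r)")
      case True
      have L2: "2 * (r * s) \<le> 2 ^ L"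
      proof -
        have "r * s \<ge> 1" using pos by simp
        then have "2 * (r * s) \<le> ?T" using mult_le_mono[of 1 "r * s" "r * s" "r * s"] by simp
        then show ?thesis using LT(2) by linarith
      qed
      from Loop_sound[OF loop True E(2,1) L2] show ?thesis
        by (rule pok_weaken) (use nC True qq power_decay_le[OF E(1) pos(1)] in \<open>auto simp: error_def intro!: ennreal_leI\<close>)
    next
      case False
      then show ?thesis using nC by (intro trivial) (simp add: error_def)
    qed
  qed
qed

text \<open>Reading bits as a binary number is injective at fixed length, so labels collide only if
  their bit blocks do.\<close>

lemma collision_integral:
  fixes R :: "nat set"
  assumes R: "R \<subseteq> {..<n}" and L: "4 * (card R * card R) \<le> 2 ^ L"
  shows "(\<integral>\<^sup>+bs. indicator {bs. \<not> inj_on (\<lambda>v. binary (chunks n L bs ! v)) R} bs \<partial>(bits (L * n))) \<le> ennreal (1/3)"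
proof -
  have "prob (bits (L * n)) {bs. \<not> inj_on (\<lambda>v. binary (chunks n L bs ! v)) R} \<le>
      prob (bits (L * n)) {bs. \<not> inj_on (\<lambda>v. chunks n L bs ! v) R}"
  proof (rule prob_mono)
    fix bs assume "bs \<in> set_pmf (bits (L * n))" and n: "\<not> inj_on (\<lambda>v. binary (chunks n L bs ! v)) R"
    then have len: "length bs = L * n" by (simp add: cube_def)
    show "\<not> inj_on (\<lambda>v. chunks n L bs ! v) R"
    proof
      assume i: "inj_on (\<lambda>v. chunks n L bs ! v) R"
      have "inj_on (\<lambda>v. binary (chunks n L bs ! v)) R"
      proof (rule inj_onI)
        fix v w assume "v \<in> R" "w \<in> R" "binary (chunks n L bs ! v) = binary (chunks n L bs ! w)"
        moreover from this have "v < n" "w < n" using R by auto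
        then have "length (chunks n L bs ! v) = length (chunks n L bs ! w)"
          using chunks_nth(1)[OF len] by simp
        ultimately show "v = w" using binary_inj i by (auto simp: inj_on_def)
      qed
      with n show False by blast
    qed
  qed
  also have "\<dots> = prob (replicate_pmf n (bits L)) {rs. \<not> inj_on (\<lambda>v. rs ! v) R}"
    unfolding map_pmf_chunks[symmetric] prob_map_pmf ..
  also have "\<dots> \<le> 1/4" by (rule labels_collide_le[OF R L])
  finally have "ennreal (prob (bits (L * n)) {bs. \<not> inj_on (\<lambda>v. binary (chunks n L bs ! v)) R}) \<le> ennreal (1/3)"
    by (intro ennreal_leI) simp
  then show ?thesis by (simp add: measure_pmf.emeasure_eq_measure)
qed

lemma pok_Tester:
  fixes m :: memory and s r E :: nat
  assumes m: "m 0 0 = n" "m 0 1 = s" "m 0 2 = r" "m 0 3 = E" "\<And>a. a \<noteq> 0 \<Longrightarrow> m a = (\<lambda>_. 0)"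
    and D: "set_pmf D \<subseteq> cube n" and E: "E \<ge> 2" "1 / E \<le> \<epsilon>" and pos: "s \<ge> 1" "r \<ge> 1"
    and B: "4 * (r * s * (r * s)) \<le> B" "s \<le> B" "r \<le> B" "108 * (s * E) \<le> B"
      "n * (4 * (r * s * (r * s)) + 2) \<le> B"
    and q: "\<And>L. 2 ^ L < 8 * (r * s * (r * s)) \<Longrightarrow>
      108 * (s * E) * (r * s * (2 * L + 5) + r * (1 + L) + 3) \<le> q"
  shows "pok Tester q m (\<lambda>_. True) (error n f D s r \<epsilon>) (ennreal (1/3))"
proof -
  let ?C = "monotone_DNF n s r"
  let ?T = "4 * (r * s * (r * s))"
  have "\<exists>F. f \<in> ?C \<longrightarrow> F \<subseteq> Pow {..<n} \<and> card F \<le> s \<and> (\<forall>T\<in>F. card T \<le> r) \<and>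
      (\<forall>x\<in>cube n. f x \<longleftrightarrow> (\<exists>T\<in>F. \<forall>i\<in>T. x ! i))"
    by (auto simp: monotone_DNF_def)
  then obtain F where F: "f \<in> ?C \<Longrightarrow> F \<subseteq> Pow {..<n} \<and> card F \<le> s \<and> (\<forall>T\<in>F. card T \<le> r) \<and>
      (\<forall>x\<in>cube n. f x \<longleftrightarrow> (\<exists>T\<in>F. \<forall>i\<in>T. x ! i))" by blast
  have B108: "108 \<le> B"
  proof -
    have "1 \<le> s * E" using pos E by simp
    then show ?thesis using B(4) by linarith
  qed
  have "ok Init 0 m (\<lambda>m'. \<exists>L. prepared m s r E L m')"
    by (rule ok_Init[where m = m, OF m(1-4) B(3,2,1) B108 pos(2,1)])
  then have init: "pok Init 0 m (\<lambda>m'. \<exists>L. prepared m s r E L m') (\<lambda>_. ennreal (1/3)) (ennreal (1/3))"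
    by (rule pok_of_ok) simp
  have rest: "pok (Fill (sc aTL) ;; Decode ;; Loop) q m1 (\<lambda>_. True) (error n f D s r \<epsilon>) (ennreal (1/3))"
    if ex: "\<exists>L. prepared m s r E L m1" for m1
  proof -
    from ex obtain L where prep: "prepared m s r E L m1" by blast
    have L: "L \<le> ?T" "?T \<le> 2 ^ L" "2 ^ L < 8 * (r * s * (r * s))" using prep by (simp_all add: prepared_def)
    \<comment> \<open>A bound on the expected error given the label bits: for members it is 1 on
      collisions and 0 otherwise, while soundness gives \<open>1/3\<close> whatever the labels
      are.\<close>
    define \<beta> where "\<beta> bs = (if f \<in> ?C then indicator {bs. \<not> inj_on (\<lambda>v. binary (chunks n L bs ! v)) (\<Union>F)} bs
      else ennreal (1/3))" for bs
    let ?bs = "\<lambda>m2. map (\<lambda>i. m2 aTape i \<noteq> 0) [0..<L * n]"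
    have LB: "L * n \<le> B" "L \<le> B"
    proof -
      have "n * L \<le> n * (?T + 2)" using L(1) by (intro mult_left_mono) auto
      then show "L * n \<le> B" using B(5) by (simp add: mult.commute)
    qed (use L(1) B(1) in linarith)
    have dec: "pok (Decode ;; Loop) q m2 (\<lambda>_. True) (error n f D s r \<epsilon>) (\<beta> bs)"
      if fr2: "frame {aTape, cF} m1 m2" and len: "length bs = L * n"
        and bit: "\<And>i. i < L * n \<Longrightarrow> m2 aTape i = of_bool (bs ! i)" for m2 bs
    proof -
      have e2: "m2 0 = m 0" "m2 aL = m1 aL" using fr2 prep by (auto simp: frame_def prepared_def)
      have "m2 0 0 = n" "m2 aL 0 = L" using e2 prep m(1) by (auto simp: prepared_def)
      then have "ok Decode 0 m2 (\<lambda>m'. frame {aP, cV, cL, aLab} m2 m' \<and> (\<forall>v<n. m' aLab v = binary (chunks n L bs ! v)))"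
        by (rule ok_Decode[where m = m2 and bs = bs, OF _ _ LB(2) len bit])
      then have "pok Decode 0 m2 (\<lambda>m'. frame {aP, cV, cL, aLab} m2 m' \<and> (\<forall>v<n. m' aLab v = binary (chunks n L bs ! v)))
          (\<lambda>_. \<beta> bs) (\<beta> bs)" by (rule pok_of_ok) simp
      then have "pok (Decode ;; Loop) (0 + q) m2 (\<lambda>_. True) (error n f D s r \<epsilon>) (\<beta> bs)"
      proof (rule pok_Seq)
        fix m3 assume m3: "frame {aP, cV, cL, aLab} m2 m3 \<and> (\<forall>v<n. m3 aLab v = binary (chunks n L bs ! v))"
        have fr3: "frame {aTape, cF, aP, cV, cL, aLab} m1 m3"
          by (rule frame_trans[OF fr2 conjunct1[OF m3]]) auto
        have lab: "m3 aLab v < 2 ^ L" if "v < n" for v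
          using m3 that binary_less[of "chunks n L bs ! v"] chunks_nth(1)[OF len that] by simp
        have le: "(if f \<in> ?C then indicator {m. \<not> inj_on (m aLab) (\<Union>F)} m3 else ennreal (1/3)) = \<beta> bs"
        proof (cases "f \<in> ?C")
          case True
          have "inj_on (m3 aLab) (\<Union>F) = inj_on (\<lambda>v. binary (chunks n L bs ! v)) (\<Union>F)"
            by (rule inj_on_cong) (use F[OF True] m3 in auto)
          then show ?thesis using True by (simp add: \<beta>_def indicator_def)
        qed (simp add: \<beta>_def)
        show "pok Loop q m3 (\<lambda>_. True) (error n f D s r \<epsilon>) (\<beta> bs)"
          using pok_Loop[OF prep fr3 lab m(1-3,5) D E pos B q[OF L(3)] F] unfolding le by simp
      qed
      then show ?thesis by simp
    qed
    have beta: "(\<integral>\<^sup>+bs. \<beta> bs \<partial>(bits (L * n))) \<le> ennreal (1/3)"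
    proof (cases "f \<in> ?C")
      case True
      let ?R = "\<Union>F"
      have R: "?R \<subseteq> {..<n}" using F[OF True] by blast
      have fin: "finite F" using F[OF True] finite_subset[of F "Pow {..<n}"] by simp
      have "card ?R \<le> (\<Sum>T\<in>F. card T)" by (rule card_Union_le_sum_card)
      also have "\<dots> \<le> (\<Sum>T\<in>F. r)" by (rule sum_mono) (use F[OF True] in blast)
      also have "\<dots> \<le> r * s" using F[OF True] by (simp add: mult.commute)
      finally have "card ?R * card ?R \<le> r * s * (r * s)" by (intro mult_le_mono)
      then have "4 * (card ?R * card ?R) \<le> 2 ^ L" using L(2) by linarith
      from collision_integral[OF R this] show ?thesis using True by (simp add: \<beta>_def)
    qed (simp add: \<beta>_def)
    have "pok (Fill (sc aTL)) 0 m1 (\<lambda>m2. frame {aTape, cF} m1 m2 \<and>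
        (\<forall>i<L * n. m2 aTape i = of_bool (?bs m2 ! i))) (\<lambda>m2. \<beta> (?bs m2)) (ennreal (1/3))"
    proof (rule pok_Fill[OF LB(1) _ _ beta])
      fix m' assume "frame {aTape, cF} m1 m'"
      then show "value_of m' (sc aTL) = L * n"
        using prep frameD[of "{aTape, cF}" m1 m' aTL] by (simp add: prepared_def mult.commute)
    next
      fix bs m2 assume len: "length bs = L * n" and fr: "frame {aTape, cF} m1 m2"
        and bit: "\<And>i. i < L * n \<Longrightarrow> m2 aTape i = of_bool (bs ! i)"
      have "?bs m2 = bs" by (rule nth_equalityI) (use len bit in auto)
      then show "(frame {aTape, cF} m1 m2 \<and> (\<forall>i<L * n. m2 aTape i = of_bool (?bs m2 ! i))) \<and> \<beta> (?bs m2) \<le> \<beta> bs"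
        using fr bit by simp
    qed
    then have "pok (Fill (sc aTL) ;; Decode ;; Loop) (0 + q) m1 (\<lambda>_. True) (error n f D s r \<epsilon>) (ennreal (1/3))"
    proof (rule pok_Seq)
      fix m2 assume m2: "frame {aTape, cF} m1 m2 \<and> (\<forall>i<L * n. m2 aTape i = of_bool (?bs m2 ! i))"
      then show "pok (Decode ;; Loop) q m2 (\<lambda>_. True) (error n f D s r \<epsilon>) (\<beta> (?bs m2))"
        by (intro dec) auto
    qed
    then show ?thesis by simp
  qed
  have "pok (Init ;; Fill (sc aTL) ;; Decode ;; Loop) (0 + q) m (\<lambda>_. True) (error n f D s r \<epsilon>) (ennreal (1/3))"
    by (rule pok_Seq[OF init rest])
  then show ?thesis unfolding Tester_def
    by (intro pok_If) (use E m in auto)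
qed

end

lemma mem_initial:
  "mem (initial [n, s, r, E]) 0 0 = n" "mem (initial [n, s, r, E]) 0 1 = s"
  "mem (initial [n, s, r, E]) 0 2 = r" "mem (initial [n, s, r, E]) 0 3 = E"
  "a \<noteq> 0 \<Longrightarrow> mem (initial [n, s, r, E]) a = (\<lambda>_. 0)"
  "steps (initial [n, s, r, E]) = 0" "queries (initial [n, s, r, E]) = 0"
  by (auto simp: initial_def numeral_2_eq_2 numeral_3_eq_3)

text \<open>Both constants belong to the class, 0 as the empty formula and 1 as a single empty term,
  and the distances of \<open>f\<close> from them add up to 1.\<close>

lemma not_far_above_half:
  assumes "\<epsilon> > 1/2" "s \<ge> 1"
  shows "\<not> far_from D \<epsilon> f (monotone_DNF n s r)"
proof
  assume far: "far_from D \<epsilon> f (monotone_DNF n s r)"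
  have "(\<lambda>_. False) \<in> monotone_DNF n s r"
    unfolding monotone_DNF_def by (rule CollectI, rule exI[of _ "{}"]) simp
  moreover have "(\<lambda>_. True) \<in> monotone_DNF n s r"
    unfolding monotone_DNF_def by (rule CollectI, rule exI[of _ "{{}}"]) (use assms(2) in simp)
  ultimately have "\<epsilon> \<le> prob D {x. f x}" "\<epsilon> \<le> prob D {x. \<not> f x}"
    using far by (auto simp: far_from_def)
  then show False using prob_not[of D f] assms(1) by linarith
qed

text \<open>From \<open>2 ^ L < 8 * (r * s)^2\<close> one gets
  \<open>L <= 3 + 2 * log 2 (r * s)\<close>, and \<open>r * s <= T\<close> because
  \<open>s / \<epsilon> >= 1\<close>. So \<open>L\<close> is absorbed by the logarithm of
  \<open>T\<close>.\<close>

lemma query_bound: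
  fixes n s r E L :: nat and \<epsilon> :: real
  assumes pos: "s \<ge> 1" "r \<ge> 1" and e: "0 < \<epsilon>" "\<epsilon> < 1" and E: "real E \<le> 2 / \<epsilon>"
    and L: "2 ^ L < 8 * (r * s * (r * s))"
  defines "T \<equiv> real r * real s ^ 2 / \<epsilon>"
  shows "real (108 * (s * E) * (r * s * (2 * L + 5) + r * (1 + L) + 3)) \<le> 5184 * (T * log 2 (2 + T))"
proof -
  let ?m = "real r * real s"
  let ?l = "log 2 (2 + T)"
  have m1: "?m \<ge> 1" using pos mult_mono[of 1 "real r" 1 "real s"] by simp
  have T0: "T \<ge> 0" using e by (simp add: T_def)
  have mT: "?m \<le> T"
  proof -
    have "?m * 1 \<le> ?m * (real s / \<epsilon>)"
      using pos e by (intro mult_left_mono) (auto simp: field_simps)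
    then show ?thesis by (simp add: T_def power2_eq_square)
  qed
  have "log 2 2 \<le> ?l" using T0 by (intro log_mono) auto
  then have l1: "1 \<le> ?l" by simp
  have "real (2 ^ L) \<le> real (8 * (r * s * (r * s)))" using L by (simp only: of_nat_le_iff)
  then have "2 ^ L \<le> 2 ^ 3 * ?m ^ 2" by (simp add: power2_eq_square)
  then have "log 2 (2 ^ L) \<le> log 2 (2 ^ 3 * ?m ^ 2)" by (intro log_mono) auto
  also have "\<dots> = log 2 (2 ^ 3) + log 2 (?m ^ 2)" by (rule log_mult_pos) (use pos in auto)
  also have "log 2 ((2::real) ^ 3) = 3" by (subst log_nat_power) auto
  also have "log 2 (?m ^ 2) = 2 * log 2 ?m" using m1 by (subst log_nat_power) auto
  also have "log 2 ?m \<le> ?l" using m1 mT by (intro log_mono) auto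
  finally have "real L \<le> 3 + 2 * ?l" by (simp add: log_nat_power)
  with l1 have L5: "real L \<le> 5 * ?l" by linarith
  have "real r * 1 \<le> ?m" using pos by (intro mult_left_mono) auto
  then have rm: "real r * (1 + real L) \<le> ?m * (1 + real L)" by (intro mult_right_mono) auto
  have "real (r * s * (2 * L + 5) + r * (1 + L) + 3) = ?m * (2 * real L + 5) + real r * (1 + real L) + 3"
    by (simp add: algebra_simps)
  also have "\<dots> \<le> ?m * (2 * real L + 5) + ?m * (1 + real L) + ?m * 3" using rm m1 by linarith
  also have "\<dots> = ?m * (3 * real L + 9)" by (simp add: algebra_simps)
  \<comment> \<open>With \<open>L <= 5 * l\<close> and \<open>1 <= l\<close> the factor is at most
    \<open>15 * l + 9 * l\<close>.\<close>
  also have "\<dots> \<le> ?m * (24 * ?l)" using L5 l1 m1 by (intro mult_left_mono) linarith+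
  finally have inner: "real (r * s * (2 * L + 5) + r * (1 + L) + 3) \<le> ?m * (24 * ?l)" .
  have "real (108 * (s * E) * (r * s * (2 * L + 5) + r * (1 + L) + 3)) =
      (108 * real s * real E) * real (r * s * (2 * L + 5) + r * (1 + L) + 3)" by simp
  \<comment> \<open>The rounding in \<open>E\<close> costs a factor 2; altogether
    \<open>108 * 2 * 24 = 5184\<close>.\<close>
  also have "\<dots> \<le> (108 * real s * (2 / \<epsilon>)) * (?m * (24 * ?l))"
    using E e by (intro mult_mono inner) auto
  also have "\<dots> = 5184 * (T * ?l)" by (simp add: T_def power2_eq_square)
  finally show ?thesis .
qed

text \<open>Degree 5 comes from the tape, of length about \<open>n * (r * s)^2\<close> at worst, and
  the factor 108 from the number of rounds.\<close>

lemma loop_bounds: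
  fixes n s r E X :: nat
  assumes "n \<le> X" "s \<le> X" "r \<le> X" "E \<le> X" "X \<ge> 1"
  defines "B \<equiv> 108 * X ^ 5"
  shows "n \<le> B" "s \<le> B" "r \<le> B" "4 * (r * s * (r * s)) \<le> B" "108 * (s * E) \<le> B"
    "n * (4 * (r * s * (r * s)) + 2) \<le> B"
proof -
  have p: "X ^ i \<le> X ^ 5" if "i \<le> 5" for i using assms(5) that by (rule power_increasing[rotated])
  have X1: "X \<le> X ^ 5" using p[of 1] by simp
  have rs: "r * s * (r * s) \<le> X ^ 4" 
    using mult_le_mono[OF mult_le_mono[OF assms(3,2)] mult_le_mono[OF assms(3,2)]]
    by (simp add: power4_eq_xxxx mult.assoc)
  have sE: "s * E \<le> X ^ 2" using mult_le_mono[OF assms(2,4)] by (simp add: power2_eq_square)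
  have "n * (4 * (r * s * (r * s)) + 2) \<le> X * (4 * X ^ 4 + 2)"
    using rs by (intro mult_le_mono assms(1)) simp
  also have "\<dots> = 4 * X ^ 5 + 2 * X" by (simp add: algebra_simps flip: power_Suc)
  finally have "n * (4 * (r * s * (r * s)) + 2) \<le> 4 * X ^ 5 + 2 * X" .
  then show "n * (4 * (r * s * (r * s)) + 2) \<le> B" unfolding B_def using X1 by linarith
  show "n \<le> B" "s \<le> B" "r \<le> B" unfolding B_def using X1 assms by linarith+
  show "4 * (r * s * (r * s)) \<le> B" unfolding B_def using rs p[of 4] by linarith
  show "108 * (s * E) \<le> B" unfolding B_def using sE p[of 2] by linarith
qed

theorem theorem9:
  "\<exists>(c :: com) (q :: nat \<times> nat \<times> nat \<times> real \<Rightarrow> real) (K :: real) (d :: nat).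
     soft_O {(n, s, r, \<epsilon>). s \<ge> 1 \<and> r \<ge> 1 \<and> \<epsilon> > 0} q (\<lambda>(n, s, r, \<epsilon>). real r * real s ^ 2 / \<epsilon>) \<and>
     (\<forall>(n :: nat) (s :: nat) (r :: nat) (\<epsilon> :: real). s \<ge> 1 \<longrightarrow> r \<ge> 1 \<longrightarrow> \<epsilon> > 0 \<longrightarrow>
        distribution_free_tester c [n, s, r, nat \<lceil>1 / \<epsilon>\<rceil>] n (monotone_DNF n s r) \<epsilon>
          (q (n, s, r, \<epsilon>)) (K * (real n + real s + real r + 1 / \<epsilon>) ^ d))"
proof -
  obtain K d where cost: "\<And>B. B \<ge> 1 \<Longrightarrow> cost B Tester \<le> K * B ^ d"
    using cost_polynomial[of Tester] by blast
  \<comment> \<open>The value 0 for \<open>\<epsilon> >= 1\<close> matches the branch that makes no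
    query.\<close>
  define q :: "nat \<times> nat \<times> nat \<times> real \<Rightarrow> real" where
    "q = (\<lambda>(n, s, r, \<epsilon>). let T = real r * real s ^ 2 / \<epsilon> in if \<epsilon> \<ge> 1 then 0 else 5184 * (T * log 2 (2 + T)))"
  define K' where "K' = real K * 3456 ^ d"
  have soft: "soft_O {(n, s, r, \<epsilon>). s \<ge> 1 \<and> r \<ge> 1 \<and> \<epsilon> > 0} q (\<lambda>(n, s, r, \<epsilon>). real r * real s ^ 2 / \<epsilon>)"
    unfolding soft_O_def
  proof (rule exI[of _ 5184], rule exI[of _ 1], rule ballI)
    fix p :: "nat \<times> nat \<times> nat \<times> real"
    assume "p \<in> {(n, s, r, \<epsilon>). s \<ge> 1 \<and> r \<ge> 1 \<and> \<epsilon> > 0}"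
    then obtain n s r \<epsilon> where p: "p = (n, s, r, \<epsilon>)" "\<epsilon> > 0" by auto
    have "real r * real s ^ 2 / \<epsilon> \<ge> 0" using p(2) by simp
    then show "q p \<le> 5184 * ((case p of (n, s, r, \<epsilon>) \<Rightarrow> real r * real s ^ 2 / \<epsilon>) *
        log 2 (2 + (case p of (n, s, r, \<epsilon>) \<Rightarrow> real r * real s ^ 2 / \<epsilon>)) ^ 1)"
      by (simp add: p(1) q_def Let_def)
  qed
  have "distribution_free_tester Tester [n, s, r, nat \<lceil>1 / \<epsilon>\<rceil>] n (monotone_DNF n s r) \<epsilon>
      (q (n, s, r, \<epsilon>)) (K' * (real n + real s + real r + 1 / \<epsilon>) ^ (5 * d))"
    if pos: "s \<ge> 1" "r \<ge> 1" and e0: "\<epsilon> > 0" for n s r :: nat and \<epsilon> :: real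
    unfolding distribution_free_tester_def
  proof (intro allI impI)
    fix f D assume D: "set_pmf D \<subseteq> cube n"
    let ?C = "monotone_DNF n s r"
    define E where "E = nat \<lceil>1 / \<epsilon>\<rceil>"
    define X where "X = n + s + r + E"
    define B where "B = 108 * X ^ 5"
    let ?Y = "real n + real s + real r + 1 / \<epsilon>"
    let ?\<sigma> = "initial [n, s, r, E]"
    have inv: "1 / \<epsilon> > 0" using e0 by simp
    have E1: "1 / \<epsilon> \<le> real E" "real E \<le> 1 / \<epsilon> + 1" using inv unfolding E_def by linarith+
    note B_ge = loop_bounds[of n X s r E, folded B_def]
    have XB: "n \<le> X" "s \<le> X" "r \<le> X" "E \<le> X" "X \<ge> 1" using pos by (auto simp: X_def)
    have B1: "B \<ge> 1" using XB(5) by (simp add: B_def)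
    interpret machine n f D B by unfold_locales (rule B_ge(1)[OF XB])
    have time: "real (cost B Tester) \<le> K' * ?Y ^ (5 * d)"
    proof -
      \<comment> \<open>\<open>E\<close> exceeds \<open>1 / \<epsilon>\<close> by at most 1, which
        the doubling absorbs because \<open>s >= 1\<close>.\<close>
      have X2: "real X \<le> 2 * ?Y" using E1(2) inv pos by (simp add: X_def)
      have "real (cost B Tester) \<le> real (K * B ^ d)" using cost[OF B1] by (simp only: of_nat_le_iff)
      also have "\<dots> = real K * (108 * real X ^ 5) ^ d" by (simp add: B_def)
      also have "\<dots> \<le> real K * (108 * (2 * ?Y) ^ 5) ^ d"
        using X2 by (intro mult_left_mono power_mono) auto
      also have "(108 * (2 * ?Y) ^ 5) ^ d = 3456 ^ d * ?Y ^ (5 * d)"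
      proof -
        have "108 * (2 * y) ^ 5 = 3456 * y ^ 5" for y :: real by (simp add: power_mult_distrib)
        then show ?thesis by (simp only: power_mult_distrib power_mult)
      qed
      finally have "real (cost B Tester) \<le> real K * (3456 ^ d * ?Y ^ (5 * d))" .
      also have "\<dots> = K' * ?Y ^ (5 * d)" by (simp only: K'_def mult.assoc)
      finally show ?thesis .
    qed
    have "\<exists>q0. pok Tester q0 (mem ?\<sigma>) (\<lambda>_. True) (error n f D s r \<epsilon>) (ennreal (1/3)) \<and> real q0 \<le> q (n, s, r, \<epsilon>)"
    proof (cases "\<epsilon> \<ge> 1")
      case True
      then have "1 / \<epsilon> \<le> 1" by simp
      then have "E = 1" using inv unfolding E_def by linarith
      have "pok Tester 0 (mem ?\<sigma>) (\<lambda>_. True) (error n f D s r \<epsilon>) (ennreal (1/3))"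
        unfolding Tester_def
      proof (rule pok_If)
        show "pok (Put 0 (Const 0) (Const 1)) 0 (mem ?\<sigma>) (\<lambda>_. True) (error n f D s r \<epsilon>) (ennreal (1/3))"
          by (rule pok_Put) (use True not_far_above_half[of \<epsilon> s D f n r] pos in \<open>auto simp: error_def\<close>)
      qed (simp add: mem_initial \<open>E = 1\<close>)
      then show ?thesis using True by (intro exI[of _ 0]) (simp add: q_def)
    next
      case False
      then have e1: "\<epsilon> < 1" by simp
      then have "1 / \<epsilon> > 1" using e0 by simp
      then have E2: "E \<ge> 2" and E3: "real E \<le> 2 / \<epsilon>" using E1 unfolding E_def by linarith+
      have inverse: "1 / real E \<le> \<epsilon>" using E1(1) e0 E2 by (simp add: field_simps)
      define T where "T = real r * real s ^ 2 / \<epsilon>"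
      \<comment> \<open>Queries are counted by a natural number, so the integer part of the real
        bound loses nothing.\<close>
      define q0 where "q0 = nat \<lfloor>5184 * (T * log 2 (2 + T))\<rfloor>"
      have T0: "T \<ge> 0" using e0 by (simp add: T_def)
      have "pok Tester q0 (mem ?\<sigma>) (\<lambda>_. True) (error n f D s r \<epsilon>) (ennreal (1/3))"
      proof (rule pok_Tester[where m = "mem ?\<sigma>" and s = s and r = r and E = E and \<epsilon> = \<epsilon>, OF mem_initial(1-5) D E2 inverse pos])
        fix L :: nat assume "2 ^ L < 8 * (r * s * (r * s))"
        from query_bound[OF pos e0 e1 E3 this]
        show "108 * (s * E) * (r * s * (2 * L + 5) + r * (1 + L) + 3) \<le> q0"
          unfolding q0_def T_def by (rule le_nat_floor)
      qed (assumption | rule B_ge[OF XB])+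
      moreover have "real q0 \<le> q (n, s, r, \<epsilon>)"
        using False T0 by (simp add: q0_def q_def T_def[symmetric])
      ultimately show ?thesis by blast
    qed
    then obtain q0 where run: "pok Tester q0 (mem ?\<sigma>) (\<lambda>_. True) (error n f D s r \<epsilon>) (ennreal (1/3))"
      and q0: "real q0 \<le> q (n, s, r, \<epsilon>)" by blast
    from run obtain P where P: "exec n f D Tester ?\<sigma> P"
      "\<And>\<sigma>. \<sigma> \<in> set_pmf P \<Longrightarrow> steps \<sigma> \<le> cost B Tester \<and> queries \<sigma> \<le> q0"
      "(\<integral>\<^sup>+\<sigma>. error n f D s r \<epsilon> (mem \<sigma>) \<partial>P) \<le> ennreal (1/3)"
      unfolding pok_def by (auto simp: mem_initial)
    have bounds: "real (queries \<sigma>) \<le> q (n, s, r, \<epsilon>) \<and> real (steps \<sigma>) \<le> K' * ?Y ^ (5 * d)"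
      if "\<sigma> \<in> set_pmf P" for \<sigma>
      using P(2)[OF that] q0 time by (meson of_nat_le_iff order_trans)
    have third: "prob P {\<sigma>. A \<sigma>} \<le> 1/3"
      if "\<And>\<sigma>. error n f D s r \<epsilon> (mem \<sigma>) = indicator {\<sigma>. A \<sigma>} \<sigma>" for A
      using P(3) unfolding that by (simp add: measure_pmf.emeasure_eq_measure)
    have complete: "prob P {\<sigma>. accepts \<sigma>} \<ge> 2/3" if "f \<in> ?C"
    proof -
      have "prob P {\<sigma>. \<not> accepts \<sigma>} \<le> 1/3"
        by (rule third) (use that in \<open>simp add: error_def accepts_def indicator_def\<close>)
      then show ?thesis using prob_not[of P accepts] by linarith
    qed
    have sound: "prob P {\<sigma>. \<not> accepts \<sigma>} \<ge> 2/3" if far: "far_from D \<epsilon> f ?C"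
    proof -
      have "f \<notin> ?C"
      proof
        assume "f \<in> ?C"
        with far have "\<epsilon> \<le> prob D {x. f x \<noteq> f x}" unfolding far_from_def by blast
        then show False using e0 by simp
      qed
      then have "prob P {\<sigma>. accepts \<sigma>} \<le> 1/3"
        by (intro third) (use far in \<open>simp add: error_def accepts_def indicator_def\<close>)
      then show ?thesis using prob_not[of P accepts] by linarith
    qed
    show "\<exists>P. exec n f D Tester (initial [n, s, r, nat \<lceil>1 / \<epsilon>\<rceil>]) P \<and>
        (\<forall>\<sigma>\<in>set_pmf P. real (queries \<sigma>) \<le> q (n, s, r, \<epsilon>) \<and> real (steps \<sigma>) \<le> K' * ?Y ^ (5 * d)) \<and>
        (f \<in> ?C \<longrightarrow> prob P {\<sigma>. accepts \<sigma>} \<ge> 2/3) \<and>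
        (far_from D \<epsilon> f ?C \<longrightarrow> prob P {\<sigma>. \<not> accepts \<sigma>} \<ge> 2/3)"
      using P(1) bounds complete sound unfolding E_def by blast
  qed
  then show ?thesis using soft by blast
qed

end
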